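(* Let $(L,L')$ be a cross on a germ of smooth complex surface $(S,o)$, let $w=c_we_1+d_we_2\in\sigma_0\cap N_{L,L'}$ be a weight vector, let $\pi_w:(S_w,\partial S_w)\to(S,L+L')$ be the modification obtained by subdividing $\sigma_0$ along the ray $\mathbb R_+w$, with exceptional divisor $E_w$, and let $o_w$ be a point of $E_w\setminus(L_w\cup L'_w)$, where $L_w,L'_w$ are the strict transforms of $L,L'$. Let $(C_w,o_w)$ be a reduced curve singularity on $(S_w,o_w)$, and let $C$ be its image by $\pi_w$. Identify the Eggers-Wall tree $\Theta_{o_w,E_w}(C_w)$ with the subtree of $\Theta_{o,L}(C)$ defined by the natural embedding. One has the following relations in restriction to this subtree: (1) $\mathbf i_L=c_w\,\mathbf i_{E_w}$. (2) $\mathbf e_L=\dfrac1{c_w}\,\mathbf e_{E_w}+\dfrac{d_w}{c_w}$.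
   Context: $(S,o)$ has completed local ring $\hat{\mathcal O}_{S,o}\simeq\mathbb C[[x,y]]$. A curve singularity is a formal germ of effective divisor; it is a branch if irreducible. A cross is an ordered pair $(L,L')$ of transversal smooth branches; coordinates $(x,y)$ define it if $L=Z(x)$, $L'=Z(y)$. $N_{L,L'}$ is the rank two lattice with basis $(e_1,e_2)$, dual to the lattice of exponents of monomials in $(x,y)$; $\sigma_0=\mathbb R_+e_1+\mathbb R_+e_2$. Identifying $(S,o)$ with $(\mathbb C^2,0)$ by $(x,y)$, $\pi_w$ is the restriction over $S$ of the toric modification of $\mathbb C^2$ defined by the fan subdividing $\sigma_0$ along $\mathbb R_+w$; $\partial S_w=L_w+E_w+L'_w$. $S_w$ is smooth at $o_w$, and $E_w$ also denotes its germ at $o_w$, which is a smooth branch. $C_w$ is thought of as the germ at $o_w$ of the strict transform of $C$ (so $E_w$ is not one of its components). **Eggers-Wall tree.** Let $L$ be a smooth branch, $L=Z(x)$. A reduced curve $D$ not containing $L$ has a finite set $\mathcal Z_x(D)$ of Newton-Puiseux roots $\eta(x)\in\bigcup_n\mathbb C[[x^{1/n}]]$, with defining function a unit times $\prod_{\eta\in\mathcal Z_x(D)}(y-\eta(x))$. For distinct branches $A,B\ne L$, $k_x(A,B)=\max\{\nu_x(\xi-\xi'):\xi\in\mathcal Z_x(A),\xi'\in\mathcal Z_x(B)\}$; the characteristic exponents of $A$ are the numbers $\nu_x(\xi-\xi')$, $\xi\ne\xi'$ in $\mathcal Z_x(A)$. For a branch $A\neq L$, $\Theta_L(A)$ is a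 segment with a homeomorphism $\mathbf e_L:\Theta_L(A)\to[0,\infty]$ (exponent), $\mathbf e_L^{-1}(0)$ labeled $L$ and $\mathbf e_L^{-1}(\infty)$ labeled $A$; the index $\mathbf i_L(P)\in\mathbb N^*$ is the lowest common multiple of the denominators of the characteristic exponents of $A$ which are $<\mathbf e_L(P)$. For a reduced curve $D$, $\Theta_L(D)$ is obtained by gluing the segments of its branches, identifying for $l\ne m$ the points of $\Theta_L(D_l),\Theta_L(D_m)$ of equal exponent $\le k_x(D_l,D_m)$; $\mathbf e_L,\mathbf i_L$ glue to functions on $\Theta_L(D)$. It is rooted at $L$. The contact complexity is $\mathbf c_L(P)=\int_L^P\frac{d\mathbf e_L}{\mathbf i_L}$. These objects depend only on $L$ and $D$, not on the coordinates. One writes $\Theta_{o,L}$ to indicate the base point $o$; $\Theta_{o_w,E_w}$ is the analogous object on $(S_w,o_w)$ relative to the smooth branch $E_w$. **Natural embedding.** For a branch $A_w$ on $(S_w,o_w)$ with image $A=\pi_w(A_w)$, each point $Q$ of $\Theta_{o_w,E_w}(A_w)$ is sent to the unique point $Q'$ of $\Theta_{o,L}(A)$ such that $\mathbf c_L(Q')=\frac1{c_w^2}\mathbf c_{E_w}(Q)+\frac{d_w}{c_w}$. For a reduced curve $C_w$, the embeddings associated with its branches glue into an embedding $\Theta_{o_w,E_w}(C_w)\hookrightarrow\Theta_{o,L}(C)$; the root $E_w$ is sent to the point $W$ of $\Theta_L(L')$ of exponent $d_w/c_w$.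
   Formalization: The weight vector w is taken primitive with c_w, d_w > 0; relation (1) is asserted at all points of the subtree except, when c_w > 1, its root E_w = W, where it fails since i_L(W) = 1 while c_w i_{E_w}(E_w) = c_w. Relation (2) is asserted at every point. *)

theory Defs
  imports "HOL-Analysis.Analysis" "HOL-Computational_Algebra.Computational_Algebra"
begin

section \<open>Formal germs of smooth surfaces and their curves\<close>

text \<open>
  The completed local ring of a germ of smooth complex surface is \<open>\<complex>[[X,Y]]\<close>, realized as
  \<open>\<complex>[[X]][[Y]]\<close>. The variables \<open>X\<close>, \<open>Y\<close> only serve to present the ring: all the notions
  below are relative to arbitrary local coordinates \<open>(x, y)\<close>.
\<close>

type_synonym ser2 = "complex fps fps"

definition coeff2 :: "ser2 \<Rightarrow> nat \<Rightarrow> nat \<Rightarrow> complex" where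
  "coeff2 f i j = fps_nth (fps_nth f j) i"

abbreviation const2 :: "complex \<Rightarrow> ser2" where
  "const2 z \<equiv> fps_const (fps_const z)"

abbreviation ideal_gen :: "ser2 set \<Rightarrow> ser2 set" where
  "ideal_gen \<equiv> module.span (*)"

definition max_ideal :: "ser2 set" where
  "max_ideal = {f. coeff2 f 0 0 = 0}"

definition local_coords :: "ser2 \<Rightarrow> ser2 \<Rightarrow> bool" where
  "local_coords x y \<longleftrightarrow> ideal_gen {x, y} = max_ideal"

text \<open>
  \<open>subst2 f a b = f(a, b)\<close>, for \<open>a\<close>, \<open>b\<close> in the maximal ideal. The truncation of the sum is then
  harmless, since \<open>a ^ i * b ^ j\<close> has no monomials of total degree less than \<open>i + j\<close>.
\<close>

definition subst2 :: "ser2 \<Rightarrow> ser2 \<Rightarrow> ser2 \<Rightarrow> ser2" where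
  "subst2 f a b = Abs_fps (\<lambda>q. Abs_fps (\<lambda>p.
     \<Sum>i\<le>p + q. \<Sum>j\<le>p + q. coeff2 f i j * coeff2 (a ^ i * b ^ j) p q))"

text \<open>The expansion of \<open>g\<close> in the local coordinates \<open>(x, y)\<close>.\<close>

definition in_coords :: "ser2 \<Rightarrow> ser2 \<Rightarrow> ser2 \<Rightarrow> ser2" where
  "in_coords x y g = (THE G. subst2 G x y = g)"

text \<open>Effective divisors on the germ are represented by their (principal, nonzero) ideals.\<close>

type_synonym curve = "ser2 set"

definition Z :: "ser2 \<Rightarrow> curve" where
  "Z f = {g. f dvd g}"

definition branch :: "curve \<Rightarrow> bool" where
  "branch A \<longleftrightarrow> (\<exists>f. irreducible f \<and> A = Z f)"

definition reduced_curve :: "curve \<Rightarrow> bool" where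
  "reduced_curve D \<longleftrightarrow> (\<exists>f. squarefree f \<and> D = Z f)"

definition branches_of :: "curve \<Rightarrow> curve set" where
  "branches_of D = {A. branch A \<and> D \<subseteq> A}"

definition smooth_branch :: "curve \<Rightarrow> bool" where
  "smooth_branch A \<longleftrightarrow>
     branch A \<and> (\<exists>f. coeff2 f 0 0 = 0 \<and> (coeff2 f 1 0 \<noteq> 0 \<or> coeff2 f 0 1 \<noteq> 0) \<and> A = Z f)"

definition transversal :: "curve \<Rightarrow> curve \<Rightarrow> bool" where
  "transversal A B \<longleftrightarrow> ideal_gen (A \<union> B) = max_ideal"

definition is_cross :: "curve \<Rightarrow> curve \<Rightarrow> bool" where
  "is_cross L L' \<longleftrightarrow> smooth_branch L \<and> smooth_branch L' \<and> transversal L L'"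

definition defines_cross :: "ser2 \<Rightarrow> ser2 \<Rightarrow> curve \<Rightarrow> curve \<Rightarrow> bool" where
  "defines_cross x y L L' \<longleftrightarrow> local_coords x y \<and> L = Z x \<and> L' = Z y"

section \<open>Newton-Puiseux roots and Eggers-Wall trees\<close>

text \<open>
  A Puiseux series is represented by its coefficient function: \<open>puiseux n e\<close> is \<open>e(x\<^sup>1\<^sup>/\<^sup>n)\<close>, so that
  equality and differences do not depend on the choice of \<open>n\<close>.
\<close>

type_synonym puiseux_series = "rat \<Rightarrow> complex"

definition puiseux :: "nat \<Rightarrow> complex fps \<Rightarrow> puiseux_series" where
  "puiseux n e = (\<lambda>r. if r * of_nat n \<in> \<nat> then fps_nth e (nat \<lfloor>r * of_nat n\<rfloor>) else 0)"

text \<open>\<open>\<nu>\<^sub>x(\<xi> - \<xi>')\<close>, for distinct \<open>\<xi>\<close> and \<open>\<xi>'\<close>.\<close>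

definition diff_order :: "puiseux_series \<Rightarrow> puiseux_series \<Rightarrow> rat" where
  "diff_order \<xi> \<xi>' = (LEAST r. \<xi> r - \<xi>' r \<noteq> 0)"

text \<open>
  A series \<open>\<eta> = e(x\<^sup>1\<^sup>/\<^sup>n)\<close> vanishing at the origin is a root of \<open>D\<close> if \<open>g(t\<^sup>n, e(t)) = 0\<close> for all
  \<open>g\<close> in the ideal of \<open>D\<close> (expanded in the coordinates \<open>(x, y)\<close>). Here \<open>\<complex>[[t]]\<close> is embedded in
  \<^typ>\<open>ser2\<close> by \<^const>\<open>fps_const\<close>, that is, \<open>t\<close> is the first variable.
\<close>

definition np_roots :: "ser2 \<Rightarrow> ser2 \<Rightarrow> curve \<Rightarrow> puiseux_series set" where
  "np_roots x y D = {puiseux n e | n e. n > 0 \<and> fps_nth e 0 = 0 \<and>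
     (\<forall>g\<in>D. subst2 (in_coords x y g) (fps_const (fps_X ^ n)) (fps_const e) = 0)}"

definition coincidence :: "ser2 \<Rightarrow> ser2 \<Rightarrow> curve \<Rightarrow> curve \<Rightarrow> rat" where
  "coincidence x y A B = Max {diff_order \<xi> \<xi>' | \<xi> \<xi>'. \<xi> \<in> np_roots x y A \<and> \<xi>' \<in> np_roots x y B}"

definition char_exponents :: "ser2 \<Rightarrow> ser2 \<Rightarrow> curve \<Rightarrow> rat set" where
  "char_exponents x y A =
     {diff_order \<xi> \<xi>' | \<xi> \<xi>'. \<xi> \<in> np_roots x y A \<and> \<xi>' \<in> np_roots x y A \<and> \<xi> \<noteq> \<xi>'}"

text \<open>
  The segment \<open>\<Theta>\<^sub>L(A)\<close> of a branch is identified with \<open>[0, \<infinity>]\<close> through the exponent function.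
  The inequality in the index is strict: the index of the root is \<open>1\<close>, and a point whose exponent
  is characteristic still has the index of the points just below it.
\<close>

definition index_at :: "ser2 \<Rightarrow> ser2 \<Rightarrow> curve \<Rightarrow> ennreal \<Rightarrow> nat" where
  "index_at x y A e =
     Lcm {nat (snd (quotient_of r)) | r. r \<in> char_exponents x y A \<and> ennreal (of_rat r) < e}"

definition contact_at :: "ser2 \<Rightarrow> ser2 \<Rightarrow> curve \<Rightarrow> ennreal \<Rightarrow> ennreal" where
  "contact_at x y A e =
     (\<integral>\<^sup>+ t. indicator {t. 0 \<le> t \<and> ennreal t \<le> e} t / of_nat (index_at x y A (ennreal t)) \<partial>lborel)"

text \<open>
  The points of \<open>\<Theta>\<^sub>L(D)\<close>, \<open>L = Z(x)\<close>, are the classes of pairs (branch of \<open>D\<close>, exponent).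
  The root is the point of exponent \<open>0\<close>.
\<close>

type_synonym ew_point = "(curve \<times> ennreal) set"

definition ew_glue :: "ser2 \<Rightarrow> ser2 \<Rightarrow> curve \<Rightarrow> ((curve \<times> ennreal) \<times> (curve \<times> ennreal)) set" where
  "ew_glue x y D = {((A, e), (B, e')). A \<in> branches_of D \<and> B \<in> branches_of D \<and> e = e' \<and>
     (A = B \<or> e \<le> ennreal (of_rat (coincidence x y A B)))}"

definition ew_tree :: "ser2 \<Rightarrow> ser2 \<Rightarrow> curve \<Rightarrow> ew_point set" where
  "ew_tree x y D = (branches_of D \<times> UNIV) // ew_glue x y D"

definition ew_exponent :: "ew_point \<Rightarrow> ennreal" where
  "ew_exponent P = the_elem (snd ` P)"

definition ew_index :: "ser2 \<Rightarrow> ser2 \<Rightarrow> ew_point \<Rightarrow> nat" where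
  "ew_index x y P = the_elem ((\<lambda>(A, e). index_at x y A e) ` P)"

section \<open>The toric modification at a point of its exceptional divisor\<close>

text \<open>
  Let \<open>w = c e\<^sub>1 + d e\<^sub>2\<close>. The complement of \<open>L\<^sub>w \<union> L'\<^sub>w\<close> in \<open>S\<^sub>w\<close> lies in the affine toric surface of
  the cone \<open>\<real>\<^sub>+ w\<close>, whose ring is the algebra of the semigroup of monomials
  \<open>x\<^sup>p y\<^sup>q\<close>, \<open>p, q \<in> \<int>\<close>, of nonnegative \<open>w\<close>-weight.
\<close>

definition weight :: "nat \<Rightarrow> nat \<Rightarrow> int \<Rightarrow> int \<Rightarrow> int" where
  "weight c d p q = int c * p + int d * q"

text \<open>
  Closed points of that surface are the semigroup morphisms to \<open>(\<complex>, \<cdot>)\<close>; those of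
  \<open>E\<^sub>w - (L\<^sub>w \<union> L'\<^sub>w)\<close>, which is the orbit associated with \<open>\<real>\<^sub>+ w\<close>, are the following ones
  (values at monomials of negative weight are irrelevant, here and below).
\<close>

definition point_of_exc :: "nat \<Rightarrow> nat \<Rightarrow> (int \<Rightarrow> int \<Rightarrow> complex) \<Rightarrow> bool" where
  "point_of_exc c d \<gamma> \<longleftrightarrow> \<gamma> 0 0 = 1 \<and>
     (\<forall>p q p' q'. weight c d p q \<ge> 0 \<and> weight c d p' q' \<ge> 0 \<longrightarrow>
        \<gamma> (p + p') (q + q') = \<gamma> p q * \<gamma> p' q') \<and>
     (\<forall>p q. weight c d p q \<ge> 0 \<longrightarrow> (\<gamma> p q = 0 \<longleftrightarrow> weight c d p q > 0))"

text \<open>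
  An isomorphism of the completed local ring of \<open>S\<^sub>w\<close> at \<open>o\<^sub>w = \<gamma>\<close> with \<^typ>\<open>ser2\<close>, given by the
  images \<open>\<phi> p q\<close> of the monomials. The maximal ideal of \<open>\<gamma>\<close> in the semigroup algebra is generated
  by the differences of monomials and their values at \<open>\<gamma>\<close>. The last condition says that its image
  generates the maximal ideal of \<^typ>\<open>ser2\<close>, that is, that the morphism from the completed local
  ring is surjective; it is then bijective, both rings being regular of dimension two.
\<close>

definition completion_at :: "nat \<Rightarrow> nat \<Rightarrow> (int \<Rightarrow> int \<Rightarrow> complex) \<Rightarrow> (int \<Rightarrow> int \<Rightarrow> ser2) \<Rightarrow> bool" where
  "completion_at c d \<gamma> \<phi> \<longleftrightarrow> \<phi> 0 0 = 1 \<and>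
     (\<forall>p q p' q'. weight c d p q \<ge> 0 \<and> weight c d p' q' \<ge> 0 \<longrightarrow>
        \<phi> (p + p') (q + q') = \<phi> p q * \<phi> p' q') \<and>
     (\<forall>p q. weight c d p q \<ge> 0 \<longrightarrow> coeff2 (\<phi> p q) 0 0 = \<gamma> p q) \<and>
     ideal_gen {\<phi> p q - const2 (\<gamma> p q) | p q. weight c d p q \<ge> 0} = max_ideal"

text \<open>The germ of \<open>E\<^sub>w\<close> at \<open>o\<^sub>w\<close>: the ideal of the orbit of \<open>\<real>\<^sub>+ w\<close>.\<close>

definition exc_divisor :: "nat \<Rightarrow> nat \<Rightarrow> (int \<Rightarrow> int \<Rightarrow> ser2) \<Rightarrow> curve" where
  "exc_divisor c d \<phi> = ideal_gen {\<phi> p q | p q. weight c d p q > 0}"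

text \<open>
  The morphism \<open>\<pi>\<^sub>w\<^sup>*\<close> of completed local rings, which sends \<open>x\<close> and \<open>y\<close> to the monomials of exponents
  \<open>(1, 0)\<close> and \<open>(0, 1)\<close>, and the image by \<open>\<pi>\<^sub>w\<close> of a curve (the ideal of functions vanishing on it).
\<close>

definition toric_pullback :: "ser2 \<Rightarrow> ser2 \<Rightarrow> (int \<Rightarrow> int \<Rightarrow> ser2) \<Rightarrow> ser2 \<Rightarrow> ser2" where
  "toric_pullback x y \<phi> g = subst2 (in_coords x y g) (\<phi> 1 0) (\<phi> 0 1)"

definition image_curve :: "ser2 \<Rightarrow> ser2 \<Rightarrow> (int \<Rightarrow> int \<Rightarrow> ser2) \<Rightarrow> curve \<Rightarrow> curve" where
  "image_curve x y \<phi> D = {g. toric_pullback x y \<phi> g \<in> D}"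

section \<open>The natural embedding\<close>

text \<open>
  Below, \<open>\<pi>\<close> is the image of curves, and the trees on \<open>(S\<^sub>w, o\<^sub>w)\<close> and \<open>(S, o)\<close> are computed
  in the coordinates \<open>(u, v)\<close> and \<open>(x, y)\<close> respectively. The root \<open>E\<^sub>w\<close> is sent to the point of
  exponent \<open>d / c\<close>; as \<open>d / c\<close> is at most the smallest characteristic exponent of any branch
  through it, this point has index \<open>1\<close>, not \<open>c\<close>.
\<close>

definition branch_embedding ::
  "nat \<Rightarrow> nat \<Rightarrow> (curve \<Rightarrow> curve) \<Rightarrow> ser2 \<Rightarrow> ser2 \<Rightarrow> ser2 \<Rightarrow> ser2 \<Rightarrow> curve \<Rightarrow> ennreal \<Rightarrow> ennreal" where
  "branch_embedding c d \<pi> u v x y A e = (THE e'.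
     contact_at x y (\<pi> A) e' = 1 / of_nat c ^ 2 * contact_at u v A e + of_nat d / of_nat c)"

definition natural_embedding ::
  "nat \<Rightarrow> nat \<Rightarrow> (curve \<Rightarrow> curve) \<Rightarrow> ser2 \<Rightarrow> ser2 \<Rightarrow> ser2 \<Rightarrow> ser2 \<Rightarrow> curve \<Rightarrow> ew_point \<Rightarrow> ew_point" where
  "natural_embedding c d \<pi> u v x y D Q = the_elem
     ((\<lambda>(A, e). ew_glue x y (\<pi> D) `` {(\<pi> A, branch_embedding c d \<pi> u v x y A e)}) ` Q)"

end

theory Submission
  imports Defs
begin

text \<open>
  A branch \<open>A \<noteq> Z(x)\<close> is the kernel of a parametrization \<open>x = t\<^sup>N\<close>, \<open>y = e(t)\<close>, which exists by the
  Newton-Puiseux theorem; its roots are the conjugates of \<open>e(x\<^sup>1\<^sup>/\<^sup>N)\<close> under \<open>t \<mapsto> \<zeta> t\<close>, \<open>\<zeta>\<^sup>N = 1\<close>. The index, the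
  contact complexity and the gluing of the tree only depend on the sets of orders of differences of
  distinct roots of two branches. These sets are unchanged by a change of coordinates that preserves
  \<open>Z(x)\<close>, so one may choose coordinates at \<open>o\<^sub>w\<close> in which the modification reads \<open>x = u\<^sup>c\<close>,
  \<open>y = u\<^sup>d (\<mu> + v)\<close> with \<open>\<mu> \<noteq> 0\<close>. It sends a root \<open>\<eta>(u)\<close> to the \<open>c\<close> conjugates of
  \<open>x\<^sup>d\<^sup>/\<^sup>c (\<mu> + \<eta>(x\<^sup>1\<^sup>/\<^sup>c))\<close>, hence it changes each order \<open>k\<close> into \<open>(d + k)/c\<close> and adds the order \<open>d/c\<close>
  when \<open>c > 1\<close>. The formulas for the index, for the contact complexity and for the exponent follow.
\<close>

unbundle no vec_syntax

section \<open>Power series in two variables and substitution\<close>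

text \<open>The constants of the embedding come from the change of variable from \<open>t\<close> to
  \<open>d/c + t/c\<close>: it contributes one factor \<open>1/c\<close>, and the index,
  \<open>c\<close> times larger on the image, contributes the other; the additive term
  \<open>d/c\<close> is the contact complexity of the initial segment, where the index is 1. As the
  embedding is defined by an equation between contact complexities, its value is found by checking
  that this shift of exponents is a solution and that contact complexity is strictly increasing, its
  density being bounded below because a branch has finitely many characteristic exponents.
  Coprimality of \<open>c\<close> and \<open>d\<close>, besides giving a monomial of weight one,
  makes a \<open>c\<close>-th root of unity trivial as soon as its \<open>d\<close>-th power is, so
  \<open>d/c\<close> is the only new order; it also makes \<open>c\<close> the denominator of
  \<open>d/c\<close>, whence the factor \<open>c\<close> in the index. Finally, the image of a curve
  is only known as a contracted ideal, so it takes an argument to see that \<open>L\<close> is not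
  one of its branches.\<close>

abbreviation X2 :: ser2 where "X2 \<equiv> fps_const fps_X"
abbreviation Y2 :: ser2 where "Y2 \<equiv> fps_X"

lemma coeff2_eqI: "(\<And>i j. coeff2 f i j = coeff2 g i j) \<Longrightarrow> f = g"
  by (simp add: coeff2_def fps_eq_iff)

lemma coeff2_simps [simp]:
  "coeff2 (f + g) i j = coeff2 f i j + coeff2 g i j"
  "coeff2 (f - g) i j = coeff2 f i j - coeff2 g i j"
  "coeff2 (- f) i j = - coeff2 f i j"
  "coeff2 0 i j = 0"
  "coeff2 (const2 z * f) i j = z * coeff2 f i j"
  "coeff2 (const2 z) i j = (if i = 0 \<and> j = 0 then z else 0)"
  "coeff2 1 i j = (if i = 0 \<and> j = 0 then 1 else 0)"
  "coeff2 X2 i j = (if i = 1 \<and> j = 0 then 1 else 0)"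
  "coeff2 Y2 i j = (if i = 0 \<and> j = 1 then 1 else 0)"
  by (simp_all add: coeff2_def)

lemma coeff2_sum [simp]: "coeff2 (sum f A) i j = (\<Sum>a\<in>A. coeff2 (f a) i j)"
  by (simp add: coeff2_def fps_sum_nth)

lemma coeff2_mult:
  "coeff2 (f * g) i j = (\<Sum>l\<le>j. \<Sum>k\<le>i. coeff2 f k l * coeff2 g (i - k) (j - l))"
  by (simp add: coeff2_def fps_mult_nth fps_sum_nth atLeast0AtMost)

lemma coeff2_mult_00 [simp]: "coeff2 (f * g) 0 0 = coeff2 f 0 0 * coeff2 g 0 0"
  by (simp add: coeff2_mult)

lemma coeff2_power_00 [simp]: "coeff2 (f ^ n) 0 0 = coeff2 f 0 0 ^ n"
  by (induction n) auto

lemma coeff2_X_pow_Y_pow: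
  "coeff2 (fps_const (fps_X ^ k) * Y2 ^ l) i j = (if i = k \<and> j = l then 1 else 0)"
  by (auto simp: coeff2_def fps_X_power_mult_right_nth)

definition mpow :: "nat \<Rightarrow> ser2 set" where
  "mpow N = {f. \<forall>i j. i + j < N \<longrightarrow> coeff2 f i j = 0}"

lemma mpow_0 [simp]: "f \<in> mpow 0"
  by (simp add: mpow_def)

lemma mpow_Suc_0_iff: "f \<in> mpow (Suc 0) \<longleftrightarrow> coeff2 f 0 0 = 0"
  by (auto simp: mpow_def)

lemma max_ideal_eq: "max_ideal = mpow (Suc 0)"
  by (auto simp: max_ideal_def mpow_def)

lemma zero_in_mpow [simp]: "0 \<in> mpow N"
  by (simp add: mpow_def)

lemma mpow_add: "f \<in> mpow N \<Longrightarrow> g \<in> mpow N \<Longrightarrow> f + g \<in> mpow N"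
  by (auto simp: mpow_def)

lemma mpow_diff: "f \<in> mpow N \<Longrightarrow> g \<in> mpow N \<Longrightarrow> f - g \<in> mpow N"
  by (auto simp: mpow_def)

lemma mpow_sum: "(\<And>a. a \<in> A \<Longrightarrow> f a \<in> mpow N) \<Longrightarrow> sum f A \<in> mpow N"
  by (induction A rule: infinite_finite_induct) (auto intro: mpow_add)

lemma mpow_antimono: "f \<in> mpow N \<Longrightarrow> M \<le> N \<Longrightarrow> f \<in> mpow M"
  by (auto simp: mpow_def)

lemma mpow_mult:
  assumes "f \<in> mpow M" "g \<in> mpow N"
  shows "f * g \<in> mpow (M + N)"
  unfolding mpow_def
proof (intro CollectI allI impI)
  fix i j :: nat
  assume ij: "i + j < M + N"
  have "coeff2 f k l * coeff2 g (i - k) (j - l) = 0" if "k \<le> i" "l \<le> j" for k l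
  proof (cases "k + l < M")
    case True
    then show ?thesis using assms(1) by (simp add: mpow_def)
  next
    case False
    then have "(i - k) + (j - l) < N" using that ij by linarith
    then show ?thesis using assms(2) by (simp add: mpow_def)
  qed
  then show "coeff2 (f * g) i j = 0"
    unfolding coeff2_mult by (intro sum.neutral ballI) auto
qed

lemma mpow_mult_left: "g \<in> mpow N \<Longrightarrow> f * g \<in> mpow N"
  using mpow_mult[of f 0 g N] by simp

lemma mpow_mult_right: "f \<in> mpow N \<Longrightarrow> f * g \<in> mpow N"
  using mpow_mult[of f N g 0] by simp

lemma mpow_power: "f \<in> mpow (Suc 0) \<Longrightarrow> f ^ n \<in> mpow n"
proof (induction n)
  case (Suc n)
  then show ?case using mpow_mult[of f "Suc 0" "f ^ n" n] by simp
qed simp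

text \<open>Krull separation. Identities between series are proved below modulo
  \<open>mpow N\<close> for every \<open>N\<close>, mostly by induction on \<open>N\<close>.\<close>

lemma mpow_Inter:
  assumes "\<And>N. f \<in> mpow N"
  shows "f = 0"
proof (rule coeff2_eqI)
  show "coeff2 f i j = coeff2 0 i j" for i j
    using assms[of "Suc (i + j)"] by (simp add: mpow_def)
qed

lemma eq_mod_mpow: "(\<And>N. f - g \<in> mpow N) \<Longrightarrow> f = g"
  using mpow_Inter[of "f - g"] by simp

lemma X2_Y2_in_mpow [simp]: "X2 \<in> mpow (Suc 0)" "Y2 \<in> mpow (Suc 0)"
  by (auto simp: mpow_def)

lemma fps_const_decomp: "fps_const (f :: complex fps) = const2 (f $ 0) + X2 * fps_const (fps_shift 1 f)"
proof -
  have "f = fps_const (f $ 0) + fps_X * fps_shift 1 f"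
    by (rule fps_ext) (auto simp: fps_X_mult_nth)
  then have "fps_const f = fps_const (fps_const (f $ 0) + fps_X * fps_shift 1 f)" by (rule arg_cong)
  then show ?thesis unfolding fps_const_add[symmetric] fps_const_mult[symmetric] .
qed

lemma ser2_outer_decomp: "(f :: ser2) = fps_const (f $ 0) + Y2 * fps_shift 1 f"
  by (rule fps_ext) (auto simp: fps_X_mult_nth)

lemma ser2_decomp:
  "f = const2 (coeff2 f 0 0) + X2 * fps_const (fps_shift 1 (f $ 0)) + Y2 * fps_shift 1 f"
proof -
  have "f = (const2 (f $ 0 $ 0) + X2 * fps_const (fps_shift 1 (f $ 0))) + Y2 * fps_shift 1 f"
    unfolding fps_const_decomp[symmetric] by (rule ser2_outer_decomp)
  then show ?thesis unfolding coeff2_def .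
qed

text \<open>Monomials free of Y are divided by X, all others by Y. Both quotients lose one degree,
  which drives the inductions on the power of the maximal ideal.\<close>

lemma mpow_Suc_decomp:
  assumes "f \<in> mpow (Suc K)"
  obtains g h where "f = X2 * g + Y2 * h" "g \<in> mpow K" "h \<in> mpow K"
proof
  have "coeff2 f 0 0 = 0" using assms by (simp add: mpow_def)
  then show "f = X2 * fps_const (fps_shift 1 (f $ 0)) + Y2 * fps_shift 1 f"
    by (subst (1) ser2_decomp) simp
  show "fps_const (fps_shift 1 (f $ 0)) \<in> mpow K" "fps_shift 1 f \<in> mpow K"
    using assms by (auto simp: mpow_def coeff2_def)
qed

section \<open>Local endomorphisms of the algebra of series\<close>

definition alg_hom :: "(ser2 \<Rightarrow> ser2) \<Rightarrow> bool" where
  "alg_hom \<psi> \<longleftrightarrow> (\<forall>f g. \<psi> (f + g) = \<psi> f + \<psi> g) \<and> (\<forall>f g. \<psi> (f * g) = \<psi> f * \<psi> g) \<and>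
     (\<forall>z. \<psi> (const2 z) = const2 z) \<and> \<psi> X2 \<in> mpow (Suc 0) \<and> \<psi> Y2 \<in> mpow (Suc 0)"

lemma alg_homD:
  assumes "alg_hom \<psi>"
  shows "\<psi> (f + g) = \<psi> f + \<psi> g" "\<psi> (f * g) = \<psi> f * \<psi> g" "\<psi> (const2 z) = const2 z"
    "\<psi> 0 = 0" "\<psi> 1 = 1" "\<psi> (f - g) = \<psi> f - \<psi> g" "\<psi> (f ^ n) = \<psi> f ^ n"
proof -
  show *: "\<psi> (f + g) = \<psi> f + \<psi> g" "\<psi> (f * g) = \<psi> f * \<psi> g" "\<psi> (const2 z) = const2 z" for f g z
    using assms by (auto simp: alg_hom_def)
  show "\<psi> 0 = 0" using *(3)[of 0] by simp
  show 1: "\<psi> 1 = 1" using *(3)[of 1] by simp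
  show "\<psi> (f - g) = \<psi> f - \<psi> g" using *(1)[of "f - g" g] by simp
  show "\<psi> (f ^ n) = \<psi> f ^ n" by (induction n) (auto simp: 1 *(2))
qed

lemma alg_hom_decomp:
  assumes "alg_hom \<psi>"
  shows "\<psi> f = const2 (coeff2 f 0 0) + \<psi> X2 * \<psi> (fps_const (fps_shift 1 (f $ 0))) + \<psi> Y2 * \<psi> (fps_shift 1 f)"
proof -
  have "\<psi> f = \<psi> (const2 (coeff2 f 0 0) + X2 * fps_const (fps_shift 1 (f $ 0)) + Y2 * fps_shift 1 f)"
    by (rule arg_cong[OF ser2_decomp])
  then show ?thesis by (simp only: alg_homD[OF assms])
qed

lemma alg_hom_prod:
  assumes "alg_hom \<psi>"
  shows "\<psi> (prod f A) = (\<Prod>x\<in>A. \<psi> (f x))"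
  by (induction A rule: infinite_finite_induct) (simp_all add: alg_homD[OF assms])

lemma alg_hom_dvd:
  assumes "alg_hom \<psi>" "f dvd g"
  shows "\<psi> f dvd \<psi> g"
  using assms(2) by (auto simp: alg_homD[OF assms(1)] elim!: dvdE)

text \<open>Continuity is automatic: each variable peeled off has its image in the maximal
  ideal.\<close>

lemma alg_hom_mpow: "alg_hom \<psi> \<Longrightarrow> f \<in> mpow K \<Longrightarrow> \<psi> f \<in> mpow K"
proof (induction K arbitrary: f)
  case (Suc K)
  obtain g h where *: "f = X2 * g + Y2 * h" "g \<in> mpow K" "h \<in> mpow K"
    using mpow_Suc_decomp[OF Suc.prems(2)] .
  have "\<psi> X2 * \<psi> g \<in> mpow (Suc 0 + K)" "\<psi> Y2 * \<psi> h \<in> mpow (Suc 0 + K)"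
    using Suc * unfolding alg_hom_def by (blast intro: mpow_mult)+
  then show ?case using *(1) by (simp add: alg_homD[OF Suc.prems(1)] mpow_add)
qed simp

lemma alg_hom_coeff2_00:
  assumes "alg_hom \<psi>"
  shows "coeff2 (\<psi> f) 0 0 = coeff2 f 0 0"
  using alg_hom_mpow[OF assms, of "f - const2 (coeff2 f 0 0)" "Suc 0"]
  by (simp add: alg_homD[OF assms] mpow_Suc_0_iff)

lemma alg_hom_X_Y:
  assumes "alg_hom \<psi>"
  shows "\<psi> X2 \<in> mpow (Suc 0)" "\<psi> Y2 \<in> mpow (Suc 0)"
  using assms by (simp_all only: alg_hom_def)

lemma alg_hom_compose:
  assumes "alg_hom \<psi>" "alg_hom \<phi>"
  shows "alg_hom (\<lambda>f. \<psi> (\<phi> f))"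
  unfolding alg_hom_def alg_homD[OF assms(1)] alg_homD[OF assms(2)]
  using alg_hom_mpow[OF assms(1) alg_hom_X_Y(1)[OF assms(2)]]
    alg_hom_mpow[OF assms(1) alg_hom_X_Y(2)[OF assms(2)]] by simp

text \<open>The difference of the two maps at \<open>f\<close> is a combination of their differences
  at the two quotients of \<open>ser2_decomp\<close>, with coefficients in the maximal ideal; each
  unfolding gains one order.\<close>

lemma alg_hom_eqI:
  assumes "alg_hom \<psi>" "alg_hom \<phi>" "\<psi> X2 = \<phi> X2" "\<psi> Y2 = \<phi> Y2"
  shows "\<psi> f = \<phi> f"
proof (rule eq_mod_mpow)
  fix K
  show "\<psi> f - \<phi> f \<in> mpow K"
  proof (induction K arbitrary: f)
    case (Suc K)
    have eq: "\<psi> f - \<phi> f = \<psi> X2 * (\<psi> (fps_const (fps_shift 1 (f $ 0))) - \<phi> (fps_const (fps_shift 1 (f $ 0))))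
        + \<psi> Y2 * (\<psi> (fps_shift 1 f) - \<phi> (fps_shift 1 f))"
      unfolding alg_hom_decomp[OF assms(1), of f] alg_hom_decomp[OF assms(2), of f] assms(3,4)
      by (simp add: algebra_simps)
    have "\<psi> X2 \<in> mpow (Suc 0)" "\<psi> Y2 \<in> mpow (Suc 0)" by (fact alg_hom_X_Y[OF assms(1)])+
    then show ?case unfolding eq
      using mpow_mult[of _ "Suc 0" _ K] Suc.IH by (auto intro!: mpow_add)
  qed simp
qed

lemma alg_hom_ident: "alg_hom (\<lambda>f. f)"
  by (simp add: alg_hom_def)

section \<open>Substitution as a local endomorphism\<close>

lemma coeff2_subst2: "coeff2 (subst2 f a b) p q =
    (\<Sum>i\<le>p + q. \<Sum>j\<le>p + q. coeff2 f i j * coeff2 (a ^ i * b ^ j) p q)"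
  by (simp add: subst2_def coeff2_def)

lemma subst2_add: "subst2 (f + g) a b = subst2 f a b + subst2 g a b"
  by (rule coeff2_eqI) (simp add: coeff2_subst2 ring_distribs sum.distrib)

lemma subst2_sum: "subst2 (sum f A) a b = (\<Sum>x\<in>A. subst2 (f x) a b)"
proof (induction A rule: infinite_finite_induct)
  have "subst2 0 a b = 0" by (rule coeff2_eqI) (simp add: coeff2_subst2)
  then show "subst2 (sum f {}) a b = (\<Sum>x\<in>{}. subst2 (f x) a b)" by simp
  then show "subst2 (sum f A) a b = (\<Sum>x\<in>A. subst2 (f x) a b)" if "infinite A" for A
    using that by simp
qed (simp add: subst2_add)

context
  fixes a b :: ser2
  assumes ab: "a \<in> mpow (Suc 0)" "b \<in> mpow (Suc 0)"
begin

lemma monom_subst_mpow: "a ^ i * b ^ j \<in> mpow (i + j)"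
  by (intro mpow_mult mpow_power ab)

lemma subst2_mpow:
  assumes "f \<in> mpow K"
  shows "subst2 f a b \<in> mpow K"
  unfolding mpow_def
proof (intro CollectI allI impI)
  fix p q :: nat assume pq: "p + q < K"
  have "coeff2 f i j * coeff2 (a ^ i * b ^ j) p q = 0" for i j
  proof (cases "i + j < K")
    case True
    then show ?thesis using assms by (simp add: mpow_def)
  next
    case False
    then show ?thesis using monom_subst_mpow[of i j] pq by (auto simp: mpow_def)
  qed
  then show "coeff2 (subst2 f a b) p q = 0"
    unfolding coeff2_subst2 by (intro sum.neutral ballI) auto
qed

lemma subst2_monom:
  "subst2 (const2 z * (fps_const (fps_X ^ k) * Y2 ^ l)) a b = const2 z * (a ^ k * b ^ l)"
proof (rule coeff2_eqI)
  fix p q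
  have *: "(\<Sum>i\<le>p + q. \<Sum>j\<le>p + q. (if i = k \<and> j = l then c else 0))
      = (if k \<le> p + q \<and> l \<le> p + q then c else (0::complex))" for c
  proof -
    have "(\<Sum>i\<le>p + q. \<Sum>j\<le>p + q. (if i = k \<and> j = l then c else 0))
      = (\<Sum>i\<le>p + q. if i = k then (if l \<le> p + q then c else 0) else 0)"
      by (intro sum.cong refl) (auto simp: sum.delta)
    then show ?thesis by (auto simp: sum.delta)
  qed
  have "coeff2 (subst2 (const2 z * (fps_const (fps_X ^ k) * Y2 ^ l)) a b) p q =
    (\<Sum>i\<le>p + q. \<Sum>j\<le>p + q. (if i = k \<and> j = l then z * coeff2 (a ^ k * b ^ l) p q else 0))"
    unfolding coeff2_subst2 coeff2_simps(5) coeff2_X_pow_Y_pow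
    by (intro sum.cong refl) auto
  \<comment> \<open>If \<open>k\<close> or \<open>l\<close> exceeds the truncation bound
    \<open>p + q\<close>, the coefficient vanishes anyway, because \<open>a ^ k * b ^ l\<close> has
    order at least \<open>k + l\<close>.\<close>
  also have "\<dots> = z * coeff2 (a ^ k * b ^ l) p q"
    unfolding * using monom_subst_mpow[of k l] by (auto simp: mpow_def)
  finally show "coeff2 (subst2 (const2 z * (fps_const (fps_X ^ k) * Y2 ^ l)) a b) p q
    = coeff2 (const2 z * (a ^ k * b ^ l)) p q" by simp
qed

text \<open>A square of exponents suffices, since it contains every exponent of total degree less
  than \<open>K\<close>.\<close>

lemma trunc_approx:
  "f - (\<Sum>(i, j)\<in>{..<K} \<times> {..<K}. const2 (coeff2 f i j) * (fps_const (fps_X ^ i) * Y2 ^ j)) \<in> mpow K"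
  unfolding mpow_def
proof (intro CollectI allI impI)
  fix p q assume "p + q < K"
  then have "(p, q) \<in> {..<K} \<times> {..<K}" by simp
  have "coeff2 (\<Sum>(i, j)\<in>{..<K} \<times> {..<K}. const2 (coeff2 f i j) * (fps_const (fps_X ^ i) * Y2 ^ j)) p q
      = (\<Sum>s\<in>{..<K} \<times> {..<K}. if s = (p, q) then coeff2 f p q else 0)"
    unfolding coeff2_sum
    by (rule sum.cong) (auto simp: coeff2_X_pow_Y_pow split: if_splits)
  also have "\<dots> = coeff2 f p q"
    using \<open>(p, q) \<in> _\<close> by (subst sum.delta) auto
  finally show "coeff2 (f - (\<Sum>(i, j)\<in>{..<K} \<times> {..<K}. const2 (coeff2 f i j) * (fps_const (fps_X ^ i) * Y2 ^ j))) p q = 0"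
    by simp
qed

text \<open>On the truncations, finite sums of monomials, multiplicativity is computed term by term.
  Replacing \<open>f\<close> and \<open>g\<close> by them changes both sides by elements of
  \<open>mpow K\<close>, and \<open>K\<close> is arbitrary.\<close>

lemma subst2_mult: "subst2 (f * g) a b = subst2 f a b * subst2 g a b"
proof (rule eq_mod_mpow)
  fix K
  define T where "T h = (\<Sum>(i, j)\<in>{..<K} \<times> {..<K}. const2 (coeff2 h i j) * (fps_const (fps_X ^ i) * Y2 ^ j))" for h :: ser2
  have T: "h - T h \<in> mpow K" for h unfolding T_def by (rule trunc_approx)
  have subst_diff: "subst2 h a b - subst2 h' a b \<in> mpow K" if "h - h' \<in> mpow K" for h h'
    using subst2_mpow[OF that] subst2_add[of "h - h'" h' a b] by simp
  have "f * g - T f * T g = (f - T f) * g + T f * (g - T g)" by (simp add: algebra_simps)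
  then have "f * g - T f * T g \<in> mpow K"
    using mpow_add[OF mpow_mult_right[OF T] mpow_mult_left[OF T]] by presburger
  then have 1: "subst2 (f * g) a b - subst2 (T f * T g) a b \<in> mpow K" by (rule subst_diff)
  have mm: "subst2 ((const2 z * (fps_const (fps_X ^ i) * Y2 ^ j)) * (const2 z' * (fps_const (fps_X ^ i') * Y2 ^ j'))) a b
    = (const2 z * (a ^ i * b ^ j)) * (const2 z' * (a ^ i' * b ^ j'))" for z z' i i' j j'
  proof -
    have "(const2 z * (fps_const (fps_X ^ i) * Y2 ^ j)) * (const2 z' * (fps_const (fps_X ^ i') * Y2 ^ j'))
      = const2 (z * z') * (fps_const (fps_X ^ (i + i')) * Y2 ^ (j + j'))"
      by (simp add: power_add mult_ac flip: fps_const_mult)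
    then have "subst2 ((const2 z * (fps_const (fps_X ^ i) * Y2 ^ j)) * (const2 z' * (fps_const (fps_X ^ i') * Y2 ^ j'))) a b
      = const2 (z * z') * (a ^ (i + i') * b ^ (j + j'))" by (simp only: subst2_monom)
    then show ?thesis by (simp add: power_add mult_ac flip: fps_const_mult)
  qed
  have sT: "subst2 (T h) a b = (\<Sum>(i, j)\<in>{..<K} \<times> {..<K}. const2 (coeff2 h i j) * (a ^ i * b ^ j))" for h
    unfolding T_def subst2_sum by (intro sum.cong) (auto simp: subst2_monom)
  have 2: "subst2 (T f * T g) a b = subst2 (T f) a b * subst2 (T g) a b"
    unfolding sT unfolding T_def sum_product subst2_sum
    by (intro sum.cong) (auto simp: mm)
  have "subst2 (T f) a b * subst2 (T g) a b - subst2 f a b * subst2 g a b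
     = subst2 (T f) a b * (subst2 (T g) a b - subst2 g a b) + (subst2 (T f) a b - subst2 f a b) * subst2 g a b"
    by (simp add: algebra_simps)
  moreover have "subst2 (T h) a b - subst2 h a b \<in> mpow K" for h
    using mpow_diff[OF zero_in_mpow subst_diff[OF T[of h]]] by simp
  ultimately have 3: "subst2 (T f) a b * subst2 (T g) a b - subst2 f a b * subst2 g a b \<in> mpow K"
    by (simp add: mpow_add mpow_mult_right mpow_mult_left)
  show "subst2 (f * g) a b - subst2 f a b * subst2 g a b \<in> mpow K"
    using mpow_add[OF 1 3[folded 2]] by simp
qed

lemma subst2_const: "subst2 (const2 z) a b = const2 z"
  using subst2_monom[of z 0 0] by simp

lemma subst2_X: "subst2 X2 a b = a"
  using subst2_monom[of 1 1 0] by simp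

lemma subst2_Y: "subst2 Y2 a b = b"
  using subst2_monom[of 1 0 1] by simp

lemma alg_hom_subst2: "alg_hom (\<lambda>f. subst2 f a b)"
  unfolding alg_hom_def using ab by (simp add: subst2_add subst2_mult subst2_const subst2_X subst2_Y)

end

text \<open>Both sides are local endomorphisms in \<open>f\<close> that agree on the variables.
  Composition of substitutions is the case where \<psi> is itself one.\<close>

lemma alg_hom_subst2_commute:
  assumes "a \<in> mpow (Suc 0)" "b \<in> mpow (Suc 0)" "alg_hom \<psi>"
  shows "\<psi> (subst2 f a b) = subst2 f (\<psi> a) (\<psi> b)"
proof -
  have *: "\<psi> a \<in> mpow (Suc 0)" "\<psi> b \<in> mpow (Suc 0)" using alg_hom_mpow[OF assms(3)] assms by auto
  show ?thesis
    by (rule alg_hom_eqI[OF alg_hom_compose[OF assms(3) alg_hom_subst2] alg_hom_subst2])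
       (use assms * in \<open>simp_all add: subst2_X subst2_Y\<close>)
qed

lemma subst2_ident: "subst2 f X2 Y2 = f"
  by (rule alg_hom_eqI[OF alg_hom_subst2 alg_hom_ident]) (simp_all add: subst2_X subst2_Y)

section \<open>Substitution of univariate series\<close>

lemma const_in_mpow_iff [simp]: "fps_const a \<in> mpow (Suc 0) \<longleftrightarrow> a $ 0 = 0"
  by (simp add: mpow_Suc_0_iff coeff2_def)

text \<open>This is f(a(t), b(t)). The substituted series do not involve the outer variable, so
  neither does the result, and its coefficient at 0 carries everything.\<close>

definition eval1 :: "ser2 \<Rightarrow> complex fps \<Rightarrow> complex fps \<Rightarrow> complex fps" where
  "eval1 f a b = subst2 f (fps_const a) (fps_const b) $ 0"

lemma subst2_const_const: "subst2 f (fps_const a) (fps_const b) = fps_const (eval1 f a b)"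
proof (rule coeff2_eqI)
  fix p q
  show "coeff2 (subst2 f (fps_const a) (fps_const b)) p q = coeff2 (fps_const (eval1 f a b)) p q"
  proof (cases "q = 0")
    case False
    have "coeff2 (fps_const a ^ i * fps_const b ^ j) p q = 0" for i j
      using False by (simp add: coeff2_def)
    then show ?thesis using False by (simp add: coeff2_subst2) (simp add: coeff2_def)
  qed (simp add: eval1_def coeff2_def)
qed

lemma subst2_const_left:
  assumes "a $ 0 = 0"
  shows "subst2 (fps_const h) (fps_const a) b = fps_const (h oo a)"
proof (rule coeff2_eqI)
  fix p q
  have "coeff2 (subst2 (fps_const h) (fps_const a) b) p q
     = (\<Sum>i\<le>p + q. \<Sum>j\<le>p + q. if j = 0 then h $ i * coeff2 (fps_const a ^ i) p q else 0)"
    unfolding coeff2_subst2 by (intro sum.cong refl) (auto simp: coeff2_def)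
  also have "\<dots> = (\<Sum>i\<le>p + q. h $ i * coeff2 (fps_const a ^ i) p q)"
    by (simp add: sum.delta)
  also have "\<dots> = coeff2 (fps_const (h oo a)) p q"
    by (cases "q = 0") (auto simp: coeff2_def fps_compose_nth atLeast0AtMost)
  finally show "coeff2 (subst2 (fps_const h) (fps_const a) b) p q = coeff2 (fps_const (h oo a)) p q" .
qed

lemma eval1_const: "a $ 0 = 0 \<Longrightarrow> eval1 (fps_const h) a b = h oo a"
  by (simp add: eval1_def subst2_const_left)

context
  fixes a b :: "complex fps"
  assumes ab: "a $ 0 = 0" "b $ 0 = 0"
begin

lemma alg_hom_eval: "alg_hom (\<lambda>f. subst2 f (fps_const a) (fps_const b))"
  by (rule alg_hom_subst2) (simp_all add: ab)

lemma eval1_simps: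
  "eval1 (f + g) a b = eval1 f a b + eval1 g a b"
  "eval1 (f - g) a b = eval1 f a b - eval1 g a b"
  "eval1 (f * g) a b = eval1 f a b * eval1 g a b"
  "eval1 (f ^ n) a b = eval1 f a b ^ n"
  "eval1 0 a b = 0" "eval1 1 a b = 1"
  "eval1 (const2 z) a b = fps_const z"
  "eval1 X2 a b = a" "eval1 Y2 a b = b"
  using ab by (simp_all add: eval1_def alg_homD[OF alg_hom_eval] subst2_X subst2_Y fps_power_zeroth)

lemma eval1_prod: "eval1 (prod f A) a b = (\<Prod>x\<in>A. eval1 (f x) a b)"
  by (induction A rule: infinite_finite_induct) (simp_all add: eval1_simps)

lemma eval1_nth_0: "eval1 f a b $ 0 = coeff2 f 0 0"
  using alg_hom_coeff2_00[OF alg_hom_eval, of f] by (simp add: coeff2_def eval1_def)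

lemma eval1_subst2:
  assumes "f \<in> mpow (Suc 0)" "g \<in> mpow (Suc 0)"
  shows "eval1 (subst2 h f g) a b = eval1 h (eval1 f a b) (eval1 g a b)"
  using alg_hom_subst2_commute[OF assms alg_hom_eval, of h]
  by (simp add: subst2_const_const)

lemma eval1_compose:
  assumes "s $ 0 = 0"
  shows "eval1 h a b oo s = eval1 h (a oo s) (b oo s)"
proof -
  have "alg_hom (\<lambda>f. subst2 f (fps_const s) Y2)" by (rule alg_hom_subst2) (simp_all add: assms)
  from alg_hom_subst2_commute[OF _ _ this, of "fps_const a" "fps_const b" h]
  have "fps_const (eval1 h a b oo s) = fps_const (eval1 h (a oo s) (b oo s))"
    by (simp add: ab subst2_const_const subst2_const_left assms)
  then show ?thesis by simp
qed

end

lemma subst2_X_0: "subst2 f X2 0 = fps_const (f $ 0)"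
proof -
  have "subst2 f X2 0 = subst2 (fps_const (f $ 0) + Y2 * fps_shift 1 f) X2 0"
    by (rule arg_cong[OF ser2_outer_decomp])
  also have "\<dots> = fps_const (f $ 0)"
    by (simp add: subst2_add subst2_mult subst2_Y subst2_const_left)
  finally show ?thesis .
qed

lemma eval1_X_0: "eval1 f fps_X 0 = f $ 0"
  using subst2_X_0[of f] by (simp add: eval1_def)

text \<open>After normalization \<open>f\<close> is 1 + g with \<open>g\<close> in the maximal
  ideal, and the one-variable inverse of 1 + X is evaluated at \<open>g\<close>.\<close>

lemma ser2_unit_iff: "(f :: ser2) dvd 1 \<longleftrightarrow> coeff2 f 0 0 \<noteq> 0"
proof
  assume "f dvd 1"
  then obtain g where "1 = f * g" by (elim dvdE)
  then have "coeff2 (f * g) 0 0 = 1" by (simp add: coeff2_def)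
  then show "coeff2 f 0 0 \<noteq> 0" by auto
next
  assume nz: "coeff2 f 0 0 \<noteq> 0"
  define z where "z = coeff2 f 0 0"
  define g where "g = const2 (1 / z) * f - 1"
  have z: "z \<noteq> 0" and g: "g \<in> mpow (Suc 0)" using nz by (simp_all add: g_def z_def mpow_Suc_0_iff)
  have "inverse (1 + fps_X :: complex fps) * (1 + fps_X) = 1" by (simp add: inverse_mult_eq_1)
  then have "subst2 (fps_const (inverse (1 + fps_X))) g 0 * subst2 (fps_const (1 + fps_X)) g 0 = 1"
    using g by (simp flip: subst2_mult) (use subst2_const[OF g, of 0 1] in simp)
  moreover have "subst2 (fps_const (1 + fps_X)) g 0 = 1 + g"
    using g subst2_const[OF g, of 0 1] by (simp add: subst2_add subst2_X flip: fps_const_add)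
  ultimately have "f * (const2 (1 / z) * subst2 (fps_const (inverse (1 + fps_X))) g 0) = 1"
    by (simp add: g_def mult_ac)
  then show "f dvd 1" by (metis dvdI)
qed

text \<open>The binomial series of exponent 1/n is evaluated at \<open>g\<close>, where h = z (1 +
  g); the prescribed root \<open>r\<close> of the constant term selects one of the \<open>n\<close>
  roots.\<close>

lemma ser2_nth_root:
  assumes "n > 0" "r ^ n = coeff2 h 0 0" "r \<noteq> 0"
  obtains \<eta> where "\<eta> ^ n = h" "coeff2 \<eta> 0 0 = r"
proof
  define z where "z = coeff2 h 0 0"
  define g where "g = const2 (1 / z) * h - 1"
  have z: "z \<noteq> 0" using assms by (metis power_not_zero z_def)
  then have g: "g \<in> mpow (Suc 0)" by (simp add: g_def z_def mpow_Suc_0_iff)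
  define \<eta> where "\<eta> = const2 r * subst2 (fps_const (fps_binomial (1 / of_nat n))) g 0"
  have hom: "alg_hom (\<lambda>f. subst2 f g 0)" using g by (intro alg_hom_subst2) auto
  have "fps_binomial (1 / of_nat n) ^ n = (1 + fps_X :: complex fps)"
    using assms(1) by (simp add: fps_binomial_power fps_binomial_1)
  then have "subst2 (fps_const (fps_binomial (1 / of_nat n))) g 0 ^ n = subst2 (fps_const (1 + fps_X)) g 0"
    by (simp flip: alg_homD(7)[OF hom])
  also have "\<dots> = 1 + g"
    using g subst2_const[OF g, of 0 1] by (simp add: subst2_add subst2_X flip: fps_const_add)
  finally show "\<eta> ^ n = h"
    using z assms(2) by (simp add: \<eta>_def power_mult_distrib g_def z_def mult.assoc[symmetric])
  show "coeff2 \<eta> 0 0 = r"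
    unfolding \<eta>_def by (simp add: alg_hom_coeff2_00[OF hom]) (simp add: coeff2_def)
qed

section \<open>Local coordinates\<close>

text \<open>Neumann series: D = id - \<sigma> raises the order by one, so the sum of the
  \<open>(D ^^ k) g\<close> is a preimage of \<open>g\<close>, and an element fixed by
  \<open>D\<close> is zero.\<close>

lemma bij_subst2_near_ident:
  assumes "x - X2 \<in> mpow 2" "y - Y2 \<in> mpow 2"
  shows "bij (\<lambda>f. subst2 f x y)"
proof -
  have xy: "x \<in> mpow (Suc 0)" "y \<in> mpow (Suc 0)"
    using mpow_add[OF mpow_antimono[OF assms(1), of "Suc 0"] X2_Y2_in_mpow(1)]
      mpow_add[OF mpow_antimono[OF assms(2), of "Suc 0"] X2_Y2_in_mpow(2)] by simp_all
  define \<sigma> where "\<sigma> f = subst2 f x y" for f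
  have \<sigma>: "alg_hom \<sigma>" unfolding \<sigma>_def using xy by (rule alg_hom_subst2)
  have \<sigma>X: "\<sigma> X2 = x" "\<sigma> Y2 = y" by (simp_all add: \<sigma>_def subst2_X subst2_Y xy)
  define D where "D f = f - \<sigma> f" for f
  have D: "D f \<in> mpow (Suc N)" if "f \<in> mpow N" for f N
    using that
  proof (induction N arbitrary: f)
    case 0
    then show ?case by (simp add: D_def mpow_Suc_0_iff alg_hom_coeff2_00[OF \<sigma>])
  next
    case (Suc K)
    obtain g h where gh: "f = X2 * g + Y2 * h" "g \<in> mpow K" "h \<in> mpow K"
      using mpow_Suc_decomp[OF Suc.prems] .
    have "D f = (X2 * D g + Y2 * D h) - ((x - X2) * \<sigma> g + (y - Y2) * \<sigma> h)"
      unfolding D_def gh(1) alg_homD[OF \<sigma>] \<sigma>X by (simp add: algebra_simps)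
    moreover have "X2 * D g \<in> mpow (Suc (Suc K))" "Y2 * D h \<in> mpow (Suc (Suc K))"
      using mpow_mult[OF X2_Y2_in_mpow(1) Suc.IH[OF gh(2)]] mpow_mult[OF X2_Y2_in_mpow(2) Suc.IH[OF gh(3)]]
      by simp_all
    moreover have "(x - X2) * \<sigma> g \<in> mpow (Suc (Suc K))" "(y - Y2) * \<sigma> h \<in> mpow (Suc (Suc K))"
      using mpow_mult[OF assms(1) alg_hom_mpow[OF \<sigma> gh(2)]] mpow_mult[OF assms(2) alg_hom_mpow[OF \<sigma> gh(3)]]
      by simp_all
    ultimately show ?case by (simp add: mpow_add mpow_diff)
  qed
  have inj: "inj \<sigma>"
  proof (rule injI)
    fix f g assume "\<sigma> f = \<sigma> g"
    then have *: "D (f - g) = f - g" by (simp add: D_def alg_homD[OF \<sigma>])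
    have "f - g \<in> mpow N" for N
    proof (induction N)
      case (Suc N)
      then show ?case using D[of "f - g" N] * by simp
    qed simp
    then show "f = g" by (rule eq_mod_mpow)
  qed
  have "\<exists>G. \<sigma> G = g" for g
  proof -
    define S where "S N = (\<Sum>k<N. (D ^^ k) g)" for N
    have Dk: "(D ^^ k) g \<in> mpow k" for k by (induction k) (auto intro: D)
    \<comment> \<open>The coefficient at (i, j) no longer changes after the partial sum
      \<open>S (Suc (i + j))\<close>, so \<open>G\<close> is the limit of the
      \<open>S N\<close>.\<close>
    define G where "G = Abs_fps (\<lambda>j. Abs_fps (\<lambda>i. coeff2 (S (Suc (i + j))) i j))"
    have G: "G - S N \<in> mpow N" for N
      unfolding mpow_def
    proof (intro CollectI allI impI)
      fix i j assume ij: "i + j < N"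
      have "S N = S (Suc (i + j)) + (\<Sum>k\<in>{Suc (i + j)..<N}. (D ^^ k) g)"
        unfolding S_def using ij
        by (subst sum.union_disjoint[symmetric]) (auto intro!: sum.cong)
      moreover have "(\<Sum>k\<in>{Suc (i + j)..<N}. (D ^^ k) g) \<in> mpow (Suc (i + j))"
        by (rule mpow_sum) (use Dk mpow_antimono in auto)
      ultimately have "coeff2 (S N) i j = coeff2 (S (Suc (i + j))) i j"
        by (simp add: mpow_def)
      then show "coeff2 (G - S N) i j = 0" by (simp add: G_def) (simp add: coeff2_def)
    qed
    have SN: "\<sigma> (S N) = g - (D ^^ N) g" for N
    proof (induction N)
      case 0
      then show ?case by (simp add: S_def alg_homD(4)[OF \<sigma>])
    next
      case (Suc N)
      have "\<sigma> (S (Suc N)) = \<sigma> (S N) + \<sigma> ((D ^^ N) g)" by (simp add: S_def alg_homD(1)[OF \<sigma>])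
      then show ?case unfolding Suc by (simp add: D_def[of "(D ^^ N) g"])
    qed
    have "\<sigma> G = g"
    proof (rule eq_mod_mpow)
      fix N
      have "\<sigma> G - g = \<sigma> (G - S N) - (D ^^ N) g" by (simp add: alg_homD[OF \<sigma>] SN)
      then show "\<sigma> G - g \<in> mpow N" using alg_hom_mpow[OF \<sigma> G] Dk by (simp add: mpow_diff)
    qed
    then show ?thesis ..
  qed
  then have "bij \<sigma>" using inj by (metis bijI surjI surj_def)
  then show ?thesis unfolding \<sigma>_def .
qed

text \<open>The Jacobian determinant at the origin.\<close>

definition jac :: "ser2 \<Rightarrow> ser2 \<Rightarrow> complex" where
  "jac x y = coeff2 x 1 0 * coeff2 y 0 1 - coeff2 x 0 1 * coeff2 y 1 0"

lemma mpow_2_iff: "f \<in> mpow 2 \<longleftrightarrow> coeff2 f 0 0 = 0 \<and> coeff2 f 1 0 = 0 \<and> coeff2 f 0 1 = 0"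
proof -
  have "i + j < 2 \<longleftrightarrow> (i = 0 \<and> j = 0) \<or> (i = 1 \<and> j = 0) \<or> (i = 0 \<and> j = 1)" for i j :: nat by auto
  then show ?thesis unfolding mpow_def by auto
qed

lemma bij_subst2:
  assumes xy: "x \<in> mpow (Suc 0)" "y \<in> mpow (Suc 0)" and "jac x y \<noteq> 0"
  shows "bij (\<lambda>f. subst2 f x y)"
proof -
  define a b c d where abcd: "a = coeff2 x 1 0" "b = coeff2 x 0 1" "c = coeff2 y 1 0" "d = coeff2 y 0 1"
  define e where "e = 1 / (a * d - b * c)"
  have e: "e * (a * d - b * c) = 1" using assms(3) by (simp add: e_def abcd jac_def)
  \<comment> \<open>\<open>(l1, l2)\<close> inverts the linear part \<open>(m1, m2)\<close> of
    \<open>(x, y)\<close>; composing with it leaves a substitution tangent to the identity.\<close>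
  define l1 l2 where l: "l1 = const2 (e * d) * X2 - const2 (e * b) * Y2" "l2 = const2 (e * a) * Y2 - const2 (e * c) * X2"
  define m1 m2 where m: "m1 = const2 a * X2 + const2 b * Y2" "m2 = const2 c * X2 + const2 d * Y2"
  have lm: "l1 \<in> mpow (Suc 0)" "l2 \<in> mpow (Suc 0)" "m1 \<in> mpow (Suc 0)" "m2 \<in> mpow (Suc 0)"
    by (simp_all add: l m mpow_Suc_0_iff del: fps_const_mult)
  have \<sigma>: "alg_hom (\<lambda>f. subst2 f x y)" and \<lambda>: "alg_hom (\<lambda>f. subst2 f l1 l2)"
    using xy lm by (auto intro: alg_hom_subst2)
  have "subst2 l1 x y = const2 (e * d) * x - const2 (e * b) * y"
    "subst2 l2 x y = const2 (e * a) * y - const2 (e * c) * x"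
    unfolding l by (simp_all add: alg_homD[OF \<sigma>] subst2_X subst2_Y xy del: fps_const_mult)
  moreover have "const2 (e * d) * x - const2 (e * b) * y - X2 \<in> mpow 2"
    "const2 (e * a) * y - const2 (e * c) * x - Y2 \<in> mpow 2"
    unfolding mpow_2_iff coeff2_simps abcd[symmetric]
    using e xy by (simp_all add: mpow_Suc_0_iff algebra_simps)
  ultimately have bij: "bij (\<lambda>f. subst2 f (subst2 l1 x y) (subst2 l2 x y))"
    by (simp add: bij_subst2_near_ident)
  have comp: "subst2 (subst2 f l1 l2) x y = subst2 f (subst2 l1 x y) (subst2 l2 x y)" for f
    by (rule alg_hom_subst2_commute[OF lm(1,2) \<sigma>])
  have "subst2 m1 l1 l2 = const2 a * l1 + const2 b * l2" "subst2 m2 l1 l2 = const2 c * l1 + const2 d * l2"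
    unfolding m by (simp_all add: alg_homD[OF \<lambda>] subst2_X subst2_Y lm del: fps_const_mult)
  moreover have "const2 a * l1 + const2 b * l2 = X2" "const2 c * l1 + const2 d * l2 = Y2"
    using e by (auto intro!: coeff2_eqI simp: l algebra_simps)
  ultimately have inv: "subst2 (subst2 f m1 m2) l1 l2 = f" for f
    using alg_hom_subst2_commute[OF lm(3,4) \<lambda>, of f] by (simp add: subst2_ident)
  show ?thesis
  proof (rule bijI)
    show "inj (\<lambda>f. subst2 f x y)"
    proof (rule injI)
      fix f g assume "subst2 f x y = subst2 g x y"
      then have "subst2 (subst2 (subst2 f m1 m2) l1 l2) x y = subst2 (subst2 (subst2 g m1 m2) l1 l2) x y"
        by (simp add: inv)
      then have "subst2 f m1 m2 = subst2 g m1 m2"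
        unfolding comp by (rule injD[OF bij_is_inj[OF bij]])
      then show "f = g" using inv by metis
    qed
    show "surj (\<lambda>f. subst2 f x y)"
      using bij_is_surj[OF bij] unfolding surj_def comp[symmetric] by metis
  qed
qed

lemma module_ser2: "module ((*) :: ser2 \<Rightarrow> ser2 \<Rightarrow> ser2)"
  by unfold_locales (auto simp: algebra_simps)

lemma ideal_gen_two: "f \<in> ideal_gen {x, y} \<longleftrightarrow> (\<exists>a b. f = a * x + b * y)"
proof -
  have "f \<in> ideal_gen {x, y} \<longleftrightarrow> (\<exists>a b. f - a * x - b * y = 0)"
    by (simp only: module.span_breakdown_eq[OF module_ser2] module.span_empty[OF module_ser2] singleton_iff)
  then show ?thesis by (simp add: algebra_simps)
qed

lemma local_coords_mpow: "local_coords x y \<Longrightarrow> x \<in> mpow (Suc 0) \<and> y \<in> mpow (Suc 0)"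
  using module.span_base[OF module_ser2, of _ "{x, y}"]
  by (auto simp: local_coords_def max_ideal_eq)

text \<open>Comparing linear terms when X and Y are written as combinations of \<open>x\<close> and
  \<open>y\<close> gives a product of two 2 by 2 matrices equal to the identity.\<close>

lemma local_coords_jac:
  assumes "local_coords x y"
  shows "jac x y \<noteq> 0"
proof -
  have xy: "coeff2 x 0 0 = 0" "coeff2 y 0 0 = 0" using local_coords_mpow[OF assms] by (auto simp: mpow_Suc_0_iff)
  have "X2 \<in> ideal_gen {x, y}" "Y2 \<in> ideal_gen {x, y}"
    using assms by (auto simp: local_coords_def max_ideal_eq)
  then obtain a b c d where *: "X2 = a * x + b * y" "Y2 = c * x + d * y" unfolding ideal_gen_two by blast
  have lin: "coeff2 (p * q) 1 0 = coeff2 p 0 0 * coeff2 q 1 0 + coeff2 p 1 0 * coeff2 q 0 0"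
    "coeff2 (p * q) 0 1 = coeff2 p 0 0 * coeff2 q 0 1 + coeff2 p 0 1 * coeff2 q 0 0" for p q
    by (simp_all add: coeff2_mult)
  have "coeff2 (a * x + b * y) 1 0 = 1" "coeff2 (a * x + b * y) 0 1 = 0"
    "coeff2 (c * x + d * y) 1 0 = 0" "coeff2 (c * x + d * y) 0 1 = 1"
    unfolding *[symmetric] by simp_all
  then have "coeff2 a 0 0 * coeff2 x 1 0 + coeff2 b 0 0 * coeff2 y 1 0 = 1"
    "coeff2 a 0 0 * coeff2 x 0 1 + coeff2 b 0 0 * coeff2 y 0 1 = 0"
    "coeff2 c 0 0 * coeff2 x 1 0 + coeff2 d 0 0 * coeff2 y 1 0 = 0"
    "coeff2 c 0 0 * coeff2 x 0 1 + coeff2 d 0 0 * coeff2 y 0 1 = 1"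
    unfolding coeff2_simps lin xy by simp_all
  then show ?thesis unfolding jac_def by algebra
qed

text \<open>Surjectivity of the substitution writes \<open>f\<close> as F(x, y), and splitting
  \<open>F\<close> along X and Y exhibits the combination of \<open>x\<close> and
  \<open>y\<close>.\<close>

lemma local_coordsI:
  assumes "x \<in> mpow (Suc 0)" "y \<in> mpow (Suc 0)" "jac x y \<noteq> 0"
  shows "local_coords x y"
proof -
  have \<sigma>: "alg_hom (\<lambda>f. subst2 f x y)" using assms by (intro alg_hom_subst2)
  have "f \<in> ideal_gen {x, y} \<longleftrightarrow> f \<in> mpow (Suc 0)" for f
  proof
    assume "f \<in> ideal_gen {x, y}"
    then show "f \<in> mpow (Suc 0)" using assms unfolding ideal_gen_two by (auto intro: mpow_add mpow_mult_left)
  next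
    assume f: "f \<in> mpow (Suc 0)"
    obtain F where F: "f = subst2 F x y" using bij_is_surj[OF bij_subst2[OF assms]] by (auto simp: surj_def)
    have "F \<in> mpow (Suc 0)" using f alg_hom_coeff2_00[OF \<sigma>, of F] by (simp add: F mpow_Suc_0_iff)
    then obtain g h where "F = X2 * g + Y2 * h" by (rule mpow_Suc_decomp)
    then have "f = subst2 g x y * x + subst2 h x y * y"
      by (simp add: F alg_homD[OF \<sigma>] subst2_X subst2_Y assms mult_ac)
    then show "f \<in> ideal_gen {x, y}" unfolding ideal_gen_two by blast
  qed
  then show ?thesis unfolding local_coords_def max_ideal_eq by auto
qed

context
  fixes x y :: ser2
  assumes xy: "local_coords x y"
begin

lemma bij_subst2_coords: "bij (\<lambda>f. subst2 f x y)"
  using bij_subst2 local_coords_mpow[OF xy] local_coords_jac[OF xy] by blast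

lemma alg_hom_subst2_coords: "alg_hom (\<lambda>f. subst2 f x y)"
  using local_coords_mpow[OF xy] alg_hom_subst2 by blast

lemma in_coords_subst2: "in_coords x y (subst2 f x y) = f"
  unfolding in_coords_def by (rule the_equality) (use injD[OF bij_is_inj[OF bij_subst2_coords]] in auto)

lemma subst2_in_coords: "subst2 (in_coords x y f) x y = f"
proof -
  obtain F where "f = subst2 F x y" using bij_is_surj[OF bij_subst2_coords] by (auto simp: surj_def)
  then show ?thesis by (simp add: in_coords_subst2)
qed

lemma alg_hom_in_coords: "alg_hom (in_coords x y)"
proof -
  have eqI: "in_coords x y f = g" if "f = subst2 g x y" for f g using that by (simp add: in_coords_subst2)
  have "in_coords x y f \<in> mpow (Suc 0)" if "f \<in> mpow (Suc 0)" for f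
    using that alg_hom_coeff2_00[OF alg_hom_subst2_coords, of "in_coords x y f"]
    by (simp add: subst2_in_coords mpow_Suc_0_iff)
  moreover have "in_coords x y (const2 z) = const2 z" for z
    by (rule eqI) (simp add: alg_homD(3)[OF alg_hom_subst2_coords])
  moreover have "in_coords x y (f + g) = in_coords x y f + in_coords x y g" for f g
    by (rule eqI) (simp add: alg_homD(1)[OF alg_hom_subst2_coords] subst2_in_coords)
  moreover have "in_coords x y (f * g) = in_coords x y f * in_coords x y g" for f g
    by (rule eqI) (simp add: alg_homD(2)[OF alg_hom_subst2_coords] subst2_in_coords)
  ultimately show ?thesis unfolding alg_hom_def by simp
qed

lemma in_coords_X_Y: "in_coords x y x = X2" "in_coords x y y = Y2"
  using in_coords_subst2[of X2] in_coords_subst2[of Y2] local_coords_mpow[OF xy]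
  by (auto simp: subst2_X subst2_Y)

lemma alg_hom_via_coords:
  assumes "alg_hom \<psi>"
  shows "\<psi> f = subst2 (in_coords x y f) (\<psi> x) (\<psi> y)"
  using alg_hom_subst2_commute[of x y \<psi> "in_coords x y f"] assms local_coords_mpow[OF xy]
  by (simp add: subst2_in_coords)

lemma in_coords_dvd_iff: "in_coords x y f dvd in_coords x y g \<longleftrightarrow> f dvd g"
  using alg_hom_dvd[OF alg_hom_in_coords, of f g]
    alg_hom_dvd[OF alg_hom_subst2_coords, of "in_coords x y f" "in_coords x y g"]
  by (auto simp: subst2_in_coords)

lemma in_coords_eq_iff: "in_coords x y f = in_coords x y g \<longleftrightarrow> f = g"
  using subst2_in_coords by metis

end

section \<open>The Newton-Puiseux theorem\<close>

text \<open>Translating Y by \<open>b\<close> moves the root to 0, and vanishing on Y = 0 means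
  divisibility by Y.\<close>

lemma linear_factor_dvd:
  assumes "b $ 0 = 0" "eval1 f fps_X b = 0"
  shows "Y2 - fps_const b dvd f"
proof -
  have b: "Y2 + fps_const b \<in> mpow (Suc 0)" "Y2 - fps_const b \<in> mpow (Suc 0)"
    using assms(1) by (simp_all add: mpow_add mpow_diff)
  define \<tau> \<tau>' where \<tau>: "\<tau> = (\<lambda>f. subst2 f X2 (Y2 + fps_const b))" "\<tau>' = (\<lambda>f. subst2 f X2 (Y2 - fps_const b))"
  have hom: "alg_hom \<tau>" "alg_hom \<tau>'" unfolding \<tau> using b by (auto intro!: alg_hom_subst2)
  have "\<tau>' (Y2 + fps_const b) = Y2"
    unfolding alg_homD[OF hom(2)] using b by (simp add: \<tau> subst2_Y subst2_const_left)
  moreover have "\<tau>' X2 = X2" using b by (simp add: \<tau> subst2_X)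
  ultimately have inv: "\<tau>' (\<tau> f) = f"
    unfolding \<tau>(1) using alg_hom_subst2_commute[OF _ b(1) hom(2), of X2 f] by (simp add: subst2_ident)
  have "\<tau> f $ 0 = eval1 (\<tau> f) fps_X 0" by (simp add: eval1_X_0)
  also have "\<dots> = 0"
    unfolding \<tau> using b assms by (simp add: eval1_subst2 eval1_simps eval1_const)
  finally have "\<tau> f $ 0 = 0" .
  then have "\<tau> f = Y2 * fps_shift 1 (\<tau> f)"
    using ser2_outer_decomp[of "\<tau> f"] by (simp only: fps_const_0_eq_0 add_0_left)
  then have "\<tau>' (\<tau> f) = \<tau>' (Y2 * fps_shift 1 (\<tau> f))" by (rule arg_cong)
  then have "f = (Y2 - fps_const b) * \<tau>' (fps_shift 1 (\<tau> f))"
    unfolding inv alg_homD[OF hom(2)] using b by (simp add: \<tau>(2) subst2_Y)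
  then show ?thesis by (rule dvdI)
qed

text \<open>A divided difference. Its constant term is the Y-derivative of \<open>f\<close> at the
  origin; when this is nonzero, the difference of values has exactly the order of b - b'.\<close>

lemma eval1_diff_factor:
  assumes "a $ 0 = 0" "b $ 0 = 0" "b' $ 0 = 0"
  obtains q where "eval1 f a b - eval1 f a b' = (b - b') * q" "q $ 0 = coeff2 f 0 1"
proof -
  define h where "h = subst2 f (fps_const a) Y2 - fps_const (eval1 f a b)"
  have ev: "eval1 h fps_X c = eval1 f a c - eval1 f a b" if "c $ 0 = 0" for c
    unfolding h_def using assms that by (simp add: eval1_simps eval1_subst2 eval1_const)
  have "eval1 h fps_X b = 0" using ev[OF assms(2)] by simp
  then obtain k where k: "h = (Y2 - fps_const b) * k"
    using linear_factor_dvd[OF assms(2)] by blast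
  have "eval1 h fps_X b' = (b' - b) * eval1 k fps_X b'"
    unfolding k using assms by (simp add: eval1_simps eval1_const)
  then have "eval1 f a b - eval1 f a b' = (b - b') * eval1 k fps_X b'"
    using ev[OF assms(3)] by (simp add: algebra_simps)
  moreover have "coeff2 k 0 0 = coeff2 f 0 1"
  proof -
    have "coeff2 h 0 1 = coeff2 k 0 0"
      unfolding k by (simp add: coeff2_mult) (simp add: coeff2_def assms)
    moreover have "coeff2 h 0 1 = coeff2 f 0 1"
      unfolding h_def by (simp add: coeff2_subst2) (simp add: coeff2_def assms)
    ultimately show ?thesis by simp
  qed
  ultimately show ?thesis using assms by (intro that) (auto simp: eval1_nth_0)
qed

text \<open>X and \<open>f\<close> are local coordinates by the Jacobian criterion. If Y = G(X, f),
  then Y = G(X, 0) is the zero locus of \<open>f\<close>.\<close>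

lemma implicit_function:
  assumes "f \<in> mpow (Suc 0)" "coeff2 f 0 1 \<noteq> 0"
  obtains e where "e $ 0 = 0" "eval1 f fps_X e = 0"
proof -
  have lc: "local_coords X2 f" using assms by (intro local_coordsI) (auto simp: jac_def)
  define G where "G = in_coords X2 f Y2"
  have hom: "alg_hom (in_coords X2 f)" by (rule alg_hom_in_coords[OF lc])
  have G: "G \<in> mpow (Suc 0)" unfolding G_def by (rule alg_hom_mpow[OF hom]) simp
  have "in_coords X2 f f = subst2 f X2 G"
    using alg_hom_subst2_commute[OF X2_Y2_in_mpow hom, of f]
    by (simp add: subst2_ident G_def in_coords_X_Y[OF lc])
  then have "subst2 f X2 G = Y2" by (simp add: in_coords_X_Y[OF lc])
  then have "eval1 (subst2 f X2 G) fps_X 0 = 0" by (simp add: eval1_simps)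
  moreover have "eval1 (subst2 f X2 G) fps_X 0 = eval1 f fps_X (G $ 0)"
    using eval1_subst2[OF _ _ X2_Y2_in_mpow(1) G, of fps_X 0 f] by (simp add: eval1_simps eval1_X_0)
  ultimately have "eval1 f fps_X (G $ 0) = 0" by simp
  moreover have "G $ 0 $ 0 = 0" using G by (simp add: mpow_Suc_0_iff coeff2_def)
  ultimately show ?thesis using that by blast
qed

section \<open>Restriction to X = 0 and translation in Y\<close>

definition at_X0 :: "ser2 \<Rightarrow> complex fps" where
  "at_X0 f = Abs_fps (coeff2 f 0)"

lemma at_X0_nth [simp]: "at_X0 f $ j = coeff2 f 0 j"
  by (simp add: at_X0_def)

lemma at_X0_simps [simp]:
  "at_X0 (f + g) = at_X0 f + at_X0 g" "at_X0 (f - g) = at_X0 f - at_X0 g"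
  "at_X0 (f * g) = at_X0 f * at_X0 g" "at_X0 0 = 0" "at_X0 1 = 1"
  "at_X0 (fps_const h) = fps_const (h $ 0)" "at_X0 Y2 = fps_X"
  by (auto simp: fps_eq_iff fps_mult_nth coeff2_mult atLeast0AtMost) (auto simp: coeff2_def)

lemma at_X0_power [simp]: "at_X0 (f ^ n) = at_X0 f ^ n"
  by (induction n) simp_all

lemma at_X0_sum [simp]: "at_X0 (sum f A) = (\<Sum>x\<in>A. at_X0 (f x))"
  by (induction A rule: infinite_finite_induct) simp_all

lemma at_X0_alg_hom:
  assumes "alg_hom \<psi>" "at_X0 (\<psi> X2) = 0" "at_X0 (\<psi> Y2) = fps_X"
  shows "at_X0 (\<psi> f) = at_X0 f"
proof (rule fps_ext)
  fix j
  show "at_X0 (\<psi> f) $ j = at_X0 f $ j"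
  proof (induction j arbitrary: f)
    case 0
    then show ?case by (simp add: alg_hom_coeff2_00[OF assms(1)])
  next
    case (Suc j)
    have *: "at_X0 (\<psi> f) = fps_const (coeff2 f 0 0) + fps_X * at_X0 (\<psi> (fps_shift 1 f))"
      by (subst alg_hom_decomp[OF assms(1)]) (simp add: assms(2,3))
    have "at_X0 (\<psi> f) $ Suc j = at_X0 (\<psi> (fps_shift 1 f)) $ j" unfolding * by simp
    also have "\<dots> = at_X0 (fps_shift 1 f) $ j" by (rule Suc.IH)
    also have "\<dots> = at_X0 f $ Suc j" by (simp add: coeff2_def)
    finally show ?case .
  qed
qed

text \<open>\<open>fps_deriv\<close> differentiates in the outer variable Y, for which
  \<open>e\<close> is a constant: this is the chain rule for a translation, checked modulo each
  \<open>mpow K\<close>.\<close>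

lemma fps_deriv_shift_subst:
  assumes "e $ 0 = 0"
  defines "\<tau> \<equiv> \<lambda>f. subst2 f X2 (Y2 + fps_const e)"
  shows "fps_deriv (\<tau> f) = \<tau> (fps_deriv f)"
proof -
  have b: "Y2 + fps_const e \<in> mpow (Suc 0)" using assms(1) by (simp add: mpow_add)
  have hom: "alg_hom \<tau>" unfolding \<tau>_def using b by (auto intro!: alg_hom_subst2)
  have \<tau>X: "\<tau> X2 = X2" "\<tau> Y2 = Y2 + fps_const e" using b by (simp_all add: \<tau>_def subst2_X subst2_Y)
  show ?thesis
  proof (rule eq_mod_mpow)
    fix K
    show "fps_deriv (\<tau> f) - \<tau> (fps_deriv f) \<in> mpow K"
    proof (induction K arbitrary: f)
      case (Suc K)
      define g h where gh: "g = fps_const (fps_shift 1 (f $ 0))" "h = fps_shift 1 f"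
      have f: "f = const2 (coeff2 f 0 0) + X2 * g + Y2 * h" unfolding gh by (rule ser2_decomp)
      have 1: "\<tau> f = const2 (coeff2 f 0 0) + X2 * \<tau> g + (Y2 + fps_const e) * \<tau> h"
        using arg_cong[OF f, of \<tau>] unfolding alg_homD[OF hom] \<tau>X .
      have 2: "fps_deriv f = X2 * fps_deriv g + h + Y2 * fps_deriv h"
        using arg_cong[OF f, of fps_deriv] by simp
      have 3: "fps_deriv (\<tau> f) = X2 * fps_deriv (\<tau> g) + \<tau> h + (Y2 + fps_const e) * fps_deriv (\<tau> h)"
        unfolding 1 by simp
      have "fps_deriv (\<tau> f) - \<tau> (fps_deriv f) = X2 * (fps_deriv (\<tau> g) - \<tau> (fps_deriv g))
          + (Y2 + fps_const e) * (fps_deriv (\<tau> h) - \<tau> (fps_deriv h))"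
        unfolding 3 unfolding 2 alg_homD[OF hom] \<tau>X by (simp add: algebra_simps)
      then show ?case
        using mpow_mult[OF X2_Y2_in_mpow(1) Suc.IH[of g]] mpow_mult[OF b Suc.IH[of h]]
        by (simp add: mpow_add)
    qed simp
  qed
qed

lemma fps_nth_deriv_shift_subst:
  assumes "e $ 0 = 0"
  shows "fps_nth_deriv k (subst2 f X2 (Y2 + fps_const e)) = subst2 (fps_nth_deriv k f) X2 (Y2 + fps_const e)"
  by (induction k arbitrary: f) (simp_all add: fps_deriv_shift_subst[OF assms])

lemma fps_taylor_shift: "f = (\<Sum>j<m. fps_const (f $ j) * fps_X ^ j) + fps_X ^ m * fps_shift m (f :: 'a :: comm_ring_1 fps)"
proof -
  have "(\<Sum>j<m. fps_const (f $ j) * fps_X ^ j) $ k = (if k < m then f $ k else 0)" for k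
  proof -
    have "(\<Sum>j<m. fps_const (f $ j) * fps_X ^ j) $ k = (\<Sum>j<m. if j = k then f $ j else 0)"
      unfolding fps_sum_nth by (intro sum.cong) auto
    then show ?thesis by (simp add: sum.delta)
  qed
  then show ?thesis by (intro fps_ext) (simp add: fps_X_power_mult_nth)
qed

lemma pcompose_power: "pcompose (p ^ n) r = pcompose p r ^ n" for p :: "'a :: comm_ring_1 poly"
  by (induction n) (simp_all add: pcompose_mult pcompose_1)

text \<open>
  Shifting by a root \<open>c\<close> lowers the order of vanishing as soon as the coefficient of degree \<open>m - 1\<close>
  vanishes and the polynomial is not a monomial: it cannot be \<open>\<alpha> (Y - c)\<^sup>m\<close>.
\<close>

lemma poly_shifted_root_order:
  fixes R :: "complex poly"
  assumes "degree R = m" "m \<ge> 2" "coeff R (m - 1) = 0" "j < m" "coeff R j \<noteq> 0"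
  obtains c k where "0 < k" "k < m" "coeff (pcompose R [:c, 1:]) k \<noteq> 0"
    "\<And>i. i < k \<Longrightarrow> coeff (pcompose R [:c, 1:]) i = 0"
proof -
  have "\<not> constant (poly R)" using assms constant_degree[of R] by simp
  then obtain c where c: "poly R c = 0" using fundamental_theorem_of_algebra by blast
  define P where "P = pcompose R [:c, 1:]"
  have R: "R = pcompose P [:-c, 1:]"
    unfolding P_def pcompose_assoc[symmetric] by (simp add: pcompose_pCons)
  have degP: "degree P = m" unfolding P_def using assms(1) by (simp add: degree_pcompose)
  then have "P \<noteq> 0" using assms by auto
  define k where "k = (LEAST k. coeff P k \<noteq> 0)"
  have k: "coeff P k \<noteq> 0" unfolding k_def
    by (rule LeastI_ex) (use \<open>P \<noteq> 0\<close> leading_coeff_neq_0 in blast)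
  have less: "coeff P i = 0" if "i < k" for i using not_less_Least that unfolding k_def by blast
  have "coeff P 0 = 0" using c by (simp add: P_def poly_0_coeff_0[symmetric] poly_pcompose)
  then have "k > 0" using k by (cases k) auto
  have "k \<le> m" using le_degree[OF k] degP by simp
  have "k \<noteq> m"
  proof
    assume "k = m"
    define \<alpha> where "\<alpha> = coeff P m"
    have "P = monom \<alpha> m"
    proof (rule poly_eqI)
      fix i
      show "coeff P i = coeff (monom \<alpha> m) i"
        using less[of i] \<open>k = m\<close> degP coeff_eq_0[of P i] by (cases i m rule: linorder_cases) (auto simp: \<alpha>_def)
    qed
    then have R': "R = smult \<alpha> ([:-c, 1:] ^ m)"
      using R by (simp add: monom_altdef pcompose_smult pcompose_power pcompose_pCons)
    \<comment> \<open>The coefficient of degree m - 1 is -m \<alpha> c. Its vanishing gives c = 0,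
      so \<open>R\<close> is a monomial of degree \<open>m\<close>, against the nonzero coefficient
      at \<open>j\<close>.\<close>
    have "m choose (m - 1) = m" using assms(2) by (subst binomial_symmetric) auto
    then have "coeff R (m - 1) = \<alpha> * of_nat m * (-c)"
      unfolding R' using assms(2) by (simp add: coeff_linear_poly_power)
    then have "c = 0" using assms(2,3) k \<open>k = m\<close> by (simp add: \<alpha>_def)
    then have "coeff R j = 0" using \<open>P = monom \<alpha> m\<close> assms(4) by (simp add: R pcompose_idR)
    then show False using assms(5) by simp
  qed
  then show ?thesis using that[of k c] \<open>k > 0\<close> \<open>k \<le> m\<close> k less unfolding P_def by auto
qed

text \<open>Selects the edge of the Newton polygon issuing from (0, m): the slope s j / (m - j) is
  minimal at \<open>j0\<close>. Cross-multiplication keeps the inequality in the natural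
  numbers.\<close>

lemma ex_minimal_slope:
  fixes s :: "nat \<Rightarrow> nat"
  assumes "finite J" "J \<noteq> {}" "\<And>j. j \<in> J \<Longrightarrow> j < m"
  obtains j0 where "j0 \<in> J" "\<And>j. j \<in> J \<Longrightarrow> s j0 * (m - j) \<le> s j * (m - j0)"
proof -
  define r where "r j = real (s j) / real (m - j)" for j
  define j0 where "j0 = arg_min_on r J"
  have j0: "j0 \<in> J" unfolding j0_def by (rule arg_min_if_finite(1)[OF assms(1,2)])
  moreover have "s j0 * (m - j) \<le> s j * (m - j0)" if "j \<in> J" for j
  proof -
    have "r j0 \<le> r j" unfolding j0_def by (rule arg_min_least[OF assms(1,2) that])
    then have "real (s j0) * real (m - j) \<le> real (s j) * real (m - j0)"
      using assms(3)[OF j0] assms(3)[OF that] by (simp add: r_def field_simps)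
    then show ?thesis by (simp flip: of_nat_mult)
  qed
  ultimately show ?thesis using that by blast
qed

text \<open>
  Induction on the order \<open>m\<close> of \<open>f(0, Y)\<close>. After the translation that kills the coefficient of
  degree \<open>m - 1\<close> (a root of the derivative of that order, given by the implicit function theorem),
  the substitution \<open>X = t\<^sup>q\<close>, \<open>Y = t\<^sup>p (c + Y')\<close> given by an edge \<open>p/q\<close> of the Newton polygon and a
  root \<open>c\<close> of its polynomial lowers the order.
\<close>

theorem newton_puiseux:
  assumes "0 < m" "coeff2 f 0 m \<noteq> 0" "\<And>j. j < m \<Longrightarrow> coeff2 f 0 j = 0"
  shows "\<exists>N>0. \<exists>e. e $ 0 = 0 \<and> eval1 f (fps_X ^ N) e = 0"
  using assms
proof (induction m arbitrary: f rule: less_induct)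
  case (less m)
  show ?case
  proof (cases "m = 1")
    case True
    then have "f \<in> mpow (Suc 0)" "coeff2 f 0 1 \<noteq> 0" using less.prems by (auto simp: mpow_Suc_0_iff)
    then obtain e where "e $ 0 = 0" "eval1 f fps_X e = 0" by (rule implicit_function)
    then show ?thesis by (intro exI[of _ 1]) auto
  next
    case False
    then have m: "m \<ge> 2" using less.prems(1) by simp
    define D where "D = fps_nth_deriv (m - 1) f"
    have "coeff2 D 0 0 = 0"
      using m less.prems(3)[of "m - 1"]
      by (simp add: D_def coeff2_def fps_deriv_maclauren_0 del: of_nat_fact flip: fps_of_nat)
    moreover have "coeff2 D 0 1 \<noteq> 0"
    proof -
      have "fps_deriv D = fps_nth_deriv m f"
        unfolding D_def fps_nth_deriv_commute[symmetric] using m by simp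
      then have "D $ 1 = (fps_nth_deriv m f) $ 0" by (metis fps_deriv_nth add_0 of_nat_1 mult_1)
      then show ?thesis
        using less.prems(2)
        by (simp add: coeff2_def fps_deriv_maclauren_0 del: of_nat_fact flip: fps_of_nat)
    qed
    ultimately obtain d where d: "d $ 0 = 0" "eval1 D fps_X d = 0"
      by (rule implicit_function[unfolded mpow_Suc_0_iff])
    define g where "g = subst2 f X2 (Y2 + fps_const d)"
    have shift: "Y2 + fps_const d \<in> mpow (Suc 0)" using d by (simp add: mpow_add)
    have root: "\<exists>N>0. \<exists>e. e $ 0 = 0 \<and> eval1 f (fps_X ^ N) e = 0"
      if "N > 0" "e $ 0 = 0" "eval1 g (fps_X ^ N) e = 0" for N e
    proof -
      have N: "(fps_X ^ N :: complex fps) $ 0 = 0" using \<open>N > 0\<close> by simp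
      have "eval1 f (fps_X ^ N) (e + (d oo fps_X ^ N)) = 0"
        using that(3) unfolding g_def using N that(2) shift
        by (simp add: eval1_subst2 eval1_simps eval1_const)
      then show ?thesis using \<open>N > 0\<close> that(2) d by (intro exI[of _ N] conjI exI[of _ "e + (d oo fps_X ^ N)"]) auto
    qed
    have "at_X0 g = at_X0 f"
      unfolding g_def using d shift
      by (intro at_X0_alg_hom[OF alg_hom_subst2]) (auto simp: subst2_X subst2_Y)
    then have g0: "coeff2 g 0 j = coeff2 f 0 j" for j by (metis at_X0_nth)
    \<comment> \<open>Taylor's formula: up to a factorial, the coefficient of degree m - 1 after
      translation is \<open>D\<close> evaluated at its root \<open>d\<close>.\<close>
    have "of_nat (fact (m - 1)) * g $ (m - 1) = fps_nth_deriv (m - 1) g $ 0"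
      by (simp add: fps_deriv_maclauren_0)
    also have "\<dots> = eval1 (subst2 D X2 (Y2 + fps_const d)) fps_X 0"
      unfolding g_def D_def fps_nth_deriv_shift_subst[OF d(1)] by (simp add: eval1_X_0)
    also have "\<dots> = 0"
      using d shift by (simp add: eval1_subst2[OF _ _ X2_Y2_in_mpow(1) shift] eval1_simps eval1_const)
    finally have gm1: "g $ (m - 1) = 0" by simp
    define J where "J = {j. j < m \<and> g $ j \<noteq> 0}"
    show ?thesis
    proof (cases "J = {}")
      case True
      \<comment> \<open>All coefficients below \<open>m\<close> vanish, in particular g(X, 0), and 0
        is a root.\<close>
      then have "g $ 0 = 0" using m by (auto simp: J_def)
      then have "eval1 g (fps_X ^ 1) 0 = 0" by (simp add: eval1_X_0)
      then show ?thesis using root[of 1 0] by simp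
    next
      case False
      have "finite J" "\<And>j. j \<in> J \<Longrightarrow> j < m" by (auto simp: J_def)
      then obtain j0 where j0: "j0 \<in> J"
        and slope: "\<And>j. j \<in> J \<Longrightarrow> subdegree (g $ j0) * (m - j) \<le> subdegree (g $ j) * (m - j0)"
        using ex_minimal_slope[OF _ False, of m "\<lambda>j. subdegree (g $ j)"] by metis
      define p q where pq: "p = subdegree (g $ j0)" "q = m - j0"
      have "q > 0" "j0 < m" "g $ j0 \<noteq> 0" using j0 by (auto simp: J_def pq)
      have "p > 0"
        using g0[of j0] less.prems(3)[of j0] \<open>j0 < m\<close> \<open>g $ j0 \<noteq> 0\<close> nth_subdegree_nonzero[of "g $ j0"]
        unfolding pq coeff2_def by (metis gr0I)
      define A where "A j = (g $ j) oo fps_X ^ q" for j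
      \<comment> \<open>By minimality of the slope, t^(p (m - j)) divides \<open>A j\<close>. With
        the t^(p j) contained in \<open>b ^ j\<close>, this makes t^(p m) a common factor.\<close>
      define B where "B j = fps_shift (p * (m - j)) (A j)" for j
      have Xq: "(fps_X ^ q :: complex fps) $ 0 = 0" using \<open>q > 0\<close> by simp
      have A: "A j = fps_X ^ (p * (m - j)) * B j" if "j < m" for j
      proof (rule fps_ext)
        fix k
        have "A j $ k = 0" if k: "k < p * (m - j)"
        proof (rule ccontr)
          assume nz: "A j $ k \<noteq> 0"
          then obtain i where i: "k = q * i" "g $ j $ i \<noteq> 0"
            using \<open>q > 0\<close> by (auto simp: A_def fps_nth_compose_X_power split: if_splits elim!: dvdE)
          then have "j \<in> J" using \<open>j < m\<close> by (auto simp: J_def)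
          have "subdegree (g $ j) \<le> i" using i(2) by (rule subdegree_leI)
          then have "q * subdegree (g $ j) \<le> k" using i by simp
          then show False using slope[OF \<open>j \<in> J\<close>] k by (simp add: pq mult_ac)
        qed
        then show "A j $ k = (fps_X ^ (p * (m - j)) * B j) $ k"
          by (simp add: fps_X_power_mult_nth B_def)
      qed
      have Bj0: "B j0 $ 0 \<noteq> 0"
        using \<open>q > 0\<close> \<open>g $ j0 \<noteq> 0\<close>
        by (simp add: B_def A_def fps_nth_compose_X_power pq[symmetric]) (simp add: pq(1))
      define \<alpha> where "\<alpha> = coeff2 g 0 m"
      have "\<alpha> \<noteq> 0" using less.prems(2) g0 by (simp add: \<alpha>_def)
      \<comment> \<open>The polynomial of the edge: a point strictly above the edge contributes
        \<open>B j $ 0 = 0\<close>.\<close>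
      define R where "R = (\<Sum>j<m. monom (B j $ 0) j) + monom \<alpha> m"
      have coeffR: "coeff R i = (if i < m then B i $ 0 else if i = m then \<alpha> else 0)" for i
      proof -
        have "coeff (\<Sum>j<m. monom (B j $ 0) j) i = (if i < m then B i $ 0 else 0)"
          by (simp add: coeff_sum coeff_monom sum.delta)
        then show ?thesis by (auto simp: R_def coeff_monom)
      qed
      have "degree R = m"
        by (rule antisym[OF degree_le le_degree]) (use \<open>\<alpha> \<noteq> 0\<close> in \<open>auto simp: coeffR\<close>)
      moreover have "coeff R (m - 1) = 0"
        using m gm1 by (simp add: coeffR B_def A_def)
      moreover have "coeff R j0 \<noteq> 0" using Bj0 \<open>j0 < m\<close> by (simp add: coeffR)
      ultimately obtain c k where k: "0 < k" "k < m" "coeff (pcompose R [:c, 1:]) k \<noteq> 0"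
        "\<And>i. i < k \<Longrightarrow> coeff (pcompose R [:c, 1:]) i = 0"
        using poly_shifted_root_order[OF _ m _ \<open>j0 < m\<close>] by blast
      define Yc where "Yc = Y2 + const2 c"
      define b where "b = fps_const (fps_X ^ p) * Yc"
      have b: "b \<in> mpow (Suc 0)" using \<open>p > 0\<close> by (simp add: b_def mpow_mult_right)
      define \<tau> where "\<tau> f = subst2 f (fps_const (fps_X ^ q)) b" for f
      have hom: "alg_hom \<tau>" unfolding \<tau>_def using b Xq by (intro alg_hom_subst2) auto
      have \<tau>X: "\<tau> Y2 = b" "\<tau> X2 = fps_const (fps_X ^ q)" "\<tau> (fps_const a) = fps_const (a oo fps_X ^ q)" for a
        unfolding \<tau>_def using b Xq by (simp_all add: subst2_X subst2_Y subst2_const_left del: fps_const_power)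
      define Q where "Q = \<tau> (fps_shift m g)"
      \<comment> \<open>The strict transform: it will satisfy \<tau> g = t^(p m) H and H(0, Y) = R(Y
        + c), whose order is \<open>k\<close>, smaller than \<open>m\<close>.\<close>
      define H where "H = (\<Sum>j<m. fps_const (B j) * Yc ^ j) + Yc ^ m * Q"
      have \<tau>sum: "\<tau> (sum F S) = (\<Sum>x\<in>S. \<tau> (F x))" for F and S :: "nat set"
        unfolding \<tau>_def by (rule subst2_sum)
      have "\<tau> g = \<tau> ((\<Sum>j<m. fps_const (g $ j) * Y2 ^ j) + Y2 ^ m * fps_shift m g)"
        by (rule arg_cong[OF fps_taylor_shift])
      also have "\<dots> = (\<Sum>j<m. fps_const (A j) * b ^ j) + b ^ m * Q"
        unfolding alg_homD[OF hom] \<tau>sum \<tau>X Q_def A_def ..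
      also have "(\<Sum>j<m. fps_const (A j) * b ^ j) = fps_const (fps_X ^ (p * m)) * (\<Sum>j<m. fps_const (B j) * Yc ^ j)"
        unfolding sum_distrib_left
      proof (rule sum.cong[OF refl])
        fix j assume "j \<in> {..<m}"
        then have j: "p * (m - j) + p * j = p * m" by (simp flip: distrib_left)
        have "fps_const (A j) * b ^ j = fps_const (fps_X ^ (p * (m - j)) * fps_X ^ (p * j)) * (fps_const (B j) * Yc ^ j)"
          using \<open>j \<in> {..<m}\<close> by (simp add: A b_def power_mult_distrib mult_ac flip: power_mult fps_const_mult)
        then show "fps_const (A j) * b ^ j = fps_const (fps_X ^ (p * m)) * (fps_const (B j) * Yc ^ j)"
          by (simp only: j flip: power_add)
      qed
      also have "b ^ m = fps_const (fps_X ^ (p * m)) * Yc ^ m"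
        by (simp add: b_def power_mult_distrib power_mult)
      finally have \<tau>g: "\<tau> g = fps_const (fps_X ^ (p * m)) * H"
        by (simp add: H_def algebra_simps)
      have "at_X0 Q = fps_const \<alpha>"
      proof -
        have "at_X0 (\<tau> X2) = 0" "at_X0 (\<tau> Y2) = 0"
          unfolding \<tau>X b_def using \<open>p > 0\<close> \<open>q > 0\<close> by simp_all
        then have "at_X0 Q = fps_const (coeff2 (fps_shift m g) 0 0)"
          unfolding Q_def by (subst alg_hom_decomp[OF hom]) simp
        then show ?thesis by (simp add: \<alpha>_def coeff2_def)
      qed
      moreover have "at_X0 Yc = fps_of_poly [:c, 1:]" by (simp add: Yc_def fps_of_poly_linear)
      ultimately have "at_X0 H = fps_of_poly (pcompose R [:c, 1:])"
        unfolding H_def R_def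
        by (simp add: pcompose_add pcompose_sum fps_of_poly_add fps_of_poly_sum monom_altdef pcompose_smult
            pcompose_power pcompose_pCons fps_of_poly_smult fps_of_poly_power mult_ac)
      then have H0: "coeff2 H 0 i = coeff (pcompose R [:c, 1:]) i" for i
        by (metis at_X0_nth fps_of_poly_nth)
      then obtain N e where Ne: "N > 0" "e $ 0 = 0" "eval1 H (fps_X ^ N) e = 0"
        using less.IH[OF k(2,1), of H] k(3,4) by auto
      have N: "(fps_X ^ N :: complex fps) $ 0 = 0" using \<open>N > 0\<close> by simp
      have "eval1 (\<tau> g) (fps_X ^ N) e = 0"
        unfolding \<tau>g using Ne N by (simp only: eval1_simps mult_zero_right)
      moreover have "eval1 (\<tau> g) (fps_X ^ N) e = eval1 g (fps_X ^ (N * q)) (fps_X ^ (N * p) * (e + fps_const c))"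
      proof -
        have "eval1 (\<tau> g) (fps_X ^ N) e = eval1 g (eval1 (fps_const (fps_X ^ q)) (fps_X ^ N) e) (eval1 b (fps_X ^ N) e)"
          unfolding \<tau>_def using Ne(2) N b Xq by (intro eval1_subst2) auto
        also have "eval1 (fps_const (fps_X ^ q)) (fps_X ^ N) e = fps_X ^ (N * q)"
          using N by (simp add: eval1_const fps_compose_power[symmetric] power_mult del: fps_const_power)
        also have "eval1 b (fps_X ^ N) e = fps_X ^ (N * p) * (e + fps_const c)"
          using N Ne(2) by (simp add: b_def Yc_def eval1_simps eval1_const fps_compose_power[symmetric] power_mult del: fps_const_power)
        finally show ?thesis .
      qed
      ultimately show ?thesis
        using \<open>N > 0\<close> \<open>p > 0\<close> \<open>q > 0\<close> by (intro root[of "N * q" "fps_X ^ (N * p) * (e + fps_const c)"]) auto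
    qed
  qed
qed

section \<open>Branches and their parametrizations\<close>

lemma complex_nth_root_exists:
  assumes "n > 0"
  obtains z :: complex where "z ^ n = w"
proof (cases "w = 0")
  case False
  then have "exp (Ln w / of_nat n) ^ n = w"
    using assms by (simp add: exp_of_nat_mult[symmetric])
  then show ?thesis using that by blast
qed (use that[of 0] assms in simp)

lemma primitive_root_of_unity:
  assumes "N > 0"
  obtains \<zeta> :: complex where "\<zeta> ^ N = 1" "\<And>i. \<zeta> ^ i = 1 \<longleftrightarrow> N dvd i"
proof
  define \<zeta> where "\<zeta> = exp (2 * of_real pi * \<i> * of_nat 1 / of_nat N)"
  have "\<zeta> ^ i = exp (2 * of_real pi * \<i> * of_nat i / of_nat N)" for i
    by (simp add: \<zeta>_def exp_of_nat_mult[symmetric] mult_ac)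
  then show *: "\<zeta> ^ i = 1 \<longleftrightarrow> N dvd i" for i
    using complex_root_unity_eq_1[of N i] assms by simp
  show "\<zeta> ^ N = 1" by (simp add: *)
qed

section \<open>Conjugation of univariate series by roots of unity\<close>

definition rot :: "complex \<Rightarrow> complex fps \<Rightarrow> complex fps" where
  "rot \<zeta> e = e oo (fps_const \<zeta> * fps_X)"

lemma rot_nth [simp]: "rot \<zeta> e $ n = \<zeta> ^ n * e $ n"
  by (simp add: rot_def)

lemma rot_rot: "rot \<zeta> (rot \<xi> e) = rot (\<zeta> * \<xi>) e"
  by (simp add: fps_eq_iff power_mult_distrib)

lemma rot_1 [simp]: "rot 1 e = e"
  by (simp add: fps_eq_iff)

lemma rot_diff: "rot \<zeta> (e - f) = rot \<zeta> e - rot \<zeta> f"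
  by (simp add: fps_eq_iff algebra_simps)

lemma rot_eq_0_iff: "\<zeta> \<noteq> 0 \<Longrightarrow> rot \<zeta> e = 0 \<longleftrightarrow> e = 0"
  by (simp add: fps_eq_iff)

lemma subdegree_rot: "\<zeta> \<noteq> 0 \<Longrightarrow> subdegree (rot \<zeta> e) = subdegree e"
  by (simp add: rot_def)

lemma root_of_unity_nonzero: "0 < N \<Longrightarrow> \<zeta> ^ N = (1 :: complex) \<Longrightarrow> \<zeta> \<noteq> 0"
  by (metis power_0_left not_gr0 zero_neq_one)

lemma rot_mult_X_power: "rot \<zeta> (fps_X ^ k * e) = fps_const (\<zeta> ^ k) * fps_X ^ k * rot \<zeta> e"
  by (rule fps_ext) (auto simp: fps_X_power_mult_nth mult.assoc simp flip: power_add)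

lemma rot_compose_X_power: "M > 0 \<Longrightarrow> \<xi> ^ M = \<zeta> \<Longrightarrow> rot \<zeta> e oo fps_X ^ M = rot \<xi> (e oo fps_X ^ M)"
  by (auto simp: fps_eq_iff fps_nth_compose_X_power power_mult[symmetric])

lemma X_power_compose_rot: "\<zeta> ^ N = 1 \<Longrightarrow> fps_X ^ N oo (fps_const \<zeta> * fps_X) = (fps_X ^ N :: complex fps)"
  by (simp add: fps_compose_power[symmetric] power_mult_distrib)

lemma compose_X_power_eq_0_iff: "N > 0 \<Longrightarrow> (e :: complex fps) oo fps_X ^ N = 0 \<longleftrightarrow> e = 0"
  by (subst fps_compose_eq_0_iff) auto

lemma compose_X_power_eq_iff: "N > 0 \<Longrightarrow> (e :: complex fps) oo fps_X ^ N = f oo fps_X ^ N \<longleftrightarrow> e = f"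
  using compose_X_power_eq_0_iff[of N "e - f"] by (simp add: fps_compose_sub_distrib)

lemma X_power_compose_X_power: "M > 0 \<Longrightarrow> N > 0 \<Longrightarrow> fps_X ^ M oo fps_X ^ N = (fps_X ^ (M * N) :: complex fps)"
  by (simp add: fps_compose_power[symmetric] power_mult[symmetric] mult.commute)

lemma subst2_const_Y_nth:
  assumes "a $ 0 = 0"
  shows "subst2 g (fps_const a) Y2 $ j = (g $ j) oo a"
proof (rule fps_ext)
  fix i
  have mono: "coeff2 (fps_const a ^ k * Y2 ^ l) i j = (if l = j then (a ^ k) $ i else 0)" for k l
    by (simp add: coeff2_def fps_X_power_mult_right_nth)
  have zero: "(a ^ k) $ i = 0" if "i < k" for k
    using that assms by (metis startsby_zero_power_prefix)
  have "subst2 g (fps_const a) Y2 $ j $ i = coeff2 (subst2 g (fps_const a) Y2) i j"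
    by (simp add: coeff2_def)
  also have "\<dots> = (\<Sum>k\<le>i + j. \<Sum>l\<le>i + j. if l = j then coeff2 g k l * (a ^ k) $ i else 0)"
    unfolding coeff2_subst2 mono by (intro sum.cong refl) auto
  also have "\<dots> = (\<Sum>k\<le>i + j. coeff2 g k j * (a ^ k) $ i)"
    by (simp add: sum.delta)
  also have "\<dots> = (\<Sum>k\<le>i. coeff2 g k j * (a ^ k) $ i)"
    using zero by (intro sum.mono_neutral_right) auto
  also have "\<dots> = ((g $ j) oo a) $ i"
    by (simp add: fps_compose_nth coeff2_def atLeast0AtMost)
  finally show "subst2 g (fps_const a) Y2 $ j $ i = ((g $ j) oo a) $ i" .
qed

section \<open>Galois descent along the base change X = t^N\<close>

definition ramify :: "nat \<Rightarrow> ser2 \<Rightarrow> ser2" where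
  "ramify N g = subst2 g (fps_const (fps_X ^ N)) Y2"

lemma alg_hom_ramify: "N > 0 \<Longrightarrow> alg_hom (ramify N)"
  unfolding ramify_def by (rule alg_hom_subst2) (auto simp del: fps_const_power)

lemma ramify_nth: "N > 0 \<Longrightarrow> ramify N g $ j = (g $ j) oo fps_X ^ N"
  by (simp add: ramify_def subst2_const_Y_nth del: fps_const_power)

lemma ramify_inject: "N > 0 \<Longrightarrow> ramify N g = ramify N h \<Longrightarrow> g = h"
  by (rule fps_ext) (metis ramify_nth compose_X_power_eq_iff)

lemma eval1_ramify:
  assumes "N > 0" "a $ 0 = 0" "e $ 0 = 0"
  shows "eval1 (ramify N g) a e = eval1 g (a ^ N) e"
proof -
  have "eval1 (fps_const (fps_X ^ N)) a e = a ^ N"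
    using assms by (simp add: eval1_const fps_compose_power[symmetric] del: fps_const_power)
  then show ?thesis
    unfolding ramify_def using assms by (subst eval1_subst2) (simp_all add: eval1_simps del: fps_const_power)
qed

definition rotX :: "complex \<Rightarrow> ser2 \<Rightarrow> ser2" where
  "rotX \<zeta> g = subst2 g (fps_const (fps_const \<zeta> * fps_X)) Y2"

lemma alg_hom_rotX: "alg_hom (rotX \<zeta>)"
  unfolding rotX_def by (rule alg_hom_subst2) (auto simp del: fps_const_mult)

lemma rotX_nth: "rotX \<zeta> g $ j = rot \<zeta> (g $ j)"
  by (simp add: rotX_def subst2_const_Y_nth rot_def del: fps_const_mult)

lemma rotX_const: "rotX \<zeta> (fps_const a) = fps_const (rot \<zeta> a)"
  by (rule fps_ext) (auto simp: rotX_nth rot_def)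

lemma rotX_Y: "rotX \<zeta> Y2 = Y2"
  by (rule fps_ext) (auto simp: rotX_nth rot_def)

lemma rotX_ramify: "N > 0 \<Longrightarrow> \<zeta> ^ N = 1 \<Longrightarrow> rotX \<zeta> (ramify N g) = ramify N g"
  by (rule fps_ext) (auto simp: rotX_nth ramify_nth fps_eq_iff fps_nth_compose_X_power power_mult)

text \<open>Invariance under a primitive N-th root of unity kills every coefficient whose X-exponent
  is not a multiple of \<open>N\<close>.\<close>

lemma rotX_invariant_ramify:
  assumes "N > 0" "\<And>i. \<zeta> ^ i = 1 \<longleftrightarrow> N dvd i" "rotX \<zeta> g = g"
  obtains h where "g = ramify N h"
proof
  define h where "h = Abs_fps (\<lambda>j. Abs_fps (\<lambda>i. g $ j $ (N * i)))"
  have *: "\<zeta> ^ i * g $ j $ i = g $ j $ i" for i j using assms(3) rotX_nth[of \<zeta> g j] rot_nth by metis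
  have "g $ j $ i = 0" if "\<not> N dvd i" for i j using that assms(2)[of i] *[of i j] by simp
  then have "g $ j $ i = ramify N h $ j $ i" for i j
    using assms(1) by (auto simp: ramify_nth fps_nth_compose_X_power h_def)
  then show "g = ramify N h" by (simp add: fps_eq_iff)
qed

section \<open>Ideals of curves parametrized by (t^N, e(t))\<close>

definition pker :: "nat \<Rightarrow> complex fps \<Rightarrow> ser2 set" where
  "pker N e = {g. eval1 g (fps_X ^ N) e = 0}"

text \<open>Replacing \<open>t\<close> by t^M does not change the ideal; this is how different
  denominators are made equal.\<close>

lemma pker_compose:
  assumes "N > 0" "M > 0" "e $ 0 = 0"
  shows "pker (N * M) (e oo fps_X ^ M) = pker N e"
proof -
  have "eval1 g (fps_X ^ (N * M)) (e oo fps_X ^ M) = eval1 g (fps_X ^ N) e oo fps_X ^ M" for g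
    using assms by (simp add: eval1_compose X_power_compose_X_power)
  then show ?thesis using assms by (simp add: pker_def compose_X_power_eq_0_iff)
qed

lemma pker_rot:
  assumes "N > 0" "\<zeta> ^ N = 1" "e $ 0 = 0"
  shows "pker N (rot \<zeta> e) = pker N e"
proof -
  have "eval1 g (fps_X ^ N) (rot \<zeta> e) = rot \<zeta> (eval1 g (fps_X ^ N) e)" for g
    unfolding rot_def using assms by (simp add: eval1_compose X_power_compose_rot)
  then show ?thesis using root_of_unity_nonzero[OF assms(1,2)] by (simp add: pker_def rot_eq_0_iff)
qed

text \<open>Taken as a set, so that coinciding conjugates count once and the product over it in
  \<open>pker_principal\<close> has distinct factors even when \<open>N\<close> is not
  minimal.\<close>

definition conjugates :: "nat \<Rightarrow> complex fps \<Rightarrow> complex fps set" where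
  "conjugates N e = (\<lambda>\<zeta>. rot \<zeta> e) ` {\<zeta>. \<zeta> ^ N = 1}"

lemma finite_roots_of_unity: "N > 0 \<Longrightarrow> finite {\<zeta> :: complex. \<zeta> ^ N = 1}"
  using finite_nth_roots[of N 1] by simp

lemma finite_conjugates: "N > 0 \<Longrightarrow> finite (conjugates N e)"
  unfolding conjugates_def by (intro finite_imageI finite_roots_of_unity)

lemma conjugates_nth_0: "e $ 0 = 0 \<Longrightarrow> f \<in> conjugates N e \<Longrightarrow> f $ 0 = 0"
  by (auto simp: conjugates_def)

lemma bij_betw_rot_conjugates:
  assumes "N > 0" "\<zeta> ^ N = 1"
  shows "bij_betw (rot \<zeta>) (conjugates N e) (conjugates N e)"
proof -
  have "\<zeta> \<noteq> 0" using root_of_unity_nonzero assms by blast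
  have "inj_on (rot \<zeta>) (conjugates N e)"
    by (rule inj_onI) (metis \<open>\<zeta> \<noteq> 0\<close> rot_diff rot_eq_0_iff right_minus_eq)
  moreover have "rot \<zeta> ` conjugates N e \<subseteq> conjugates N e"
  proof
    fix f assume "f \<in> rot \<zeta> ` conjugates N e"
    then obtain \<xi> where "\<xi> ^ N = 1" "f = rot (\<zeta> * \<xi>) e" by (auto simp: conjugates_def rot_rot)
    moreover have "(\<zeta> * \<xi>) ^ N = 1" using assms calculation by (simp add: power_mult_distrib)
    ultimately show "f \<in> conjugates N e" by (auto simp: conjugates_def)
  qed
  ultimately show ?thesis
    using finite_conjugates[OF assms(1)] by (simp add: bij_betw_def endo_inj_surj)
qed

lemma prod_linear_factors_dvd:
  assumes "finite S" "\<And>f. f \<in> S \<Longrightarrow> f $ 0 = 0 \<and> eval1 g fps_X f = 0"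
  shows "(\<Prod>f\<in>S. Y2 - fps_const f) dvd g"
  using assms
proof (induction S arbitrary: g rule: finite_induct)
  case (insert f S)
  obtain h where h: "g = (Y2 - fps_const f) * h"
    using linear_factor_dvd[of f g] insert.prems by auto
  have "eval1 h fps_X f' = 0" if "f' \<in> S" for f'
  proof -
    have "(f' - f) * eval1 h fps_X f' = eval1 g fps_X f'"
      unfolding h using insert.prems that by (simp add: eval1_simps eval1_const)
    then show ?thesis using insert.prems insert.hyps that by auto
  qed
  then have "(\<Prod>f\<in>S. Y2 - fps_const f) dvd h" using insert.prems by (intro insert.IH) auto
  then show ?case using insert.hyps by (simp add: h mult_dvd_mono)
qed simp

lemma linear_factor_nonzero: "Y2 - fps_const f \<noteq> 0"
proof
  assume "Y2 - fps_const f = 0"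
  then have "(Y2 - fps_const f) $ 1 = 0" by simp
  then show False by simp
qed

text \<open>The product over the conjugates is fixed by the Galois action, hence comes from some
  \<open>P\<close>. An element of the kernel vanishes at all conjugates, so the product divides it
  after base change; the quotient is again fixed and descends.\<close>

lemma pker_principal:
  assumes N: "N > 0" and e: "e $ 0 = 0"
  obtains P where "pker N e = Z P" "ramify N P = (\<Prod>f\<in>conjugates N e. Y2 - fps_const f)"
proof -
  define T where "T = (\<Prod>f\<in>conjugates N e. Y2 - fps_const f)"
  obtain \<zeta> :: complex where \<zeta>: "\<zeta> ^ N = 1" "\<And>i. \<zeta> ^ i = 1 \<longleftrightarrow> N dvd i"
    using primitive_root_of_unity[OF N] by blast
  note hom = alg_hom_rotX[of \<zeta>]
  have "rotX \<zeta> T = (\<Prod>f\<in>conjugates N e. rotX \<zeta> (Y2 - fps_const f))"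
    unfolding T_def by (rule alg_hom_prod[OF hom])
  also have "\<dots> = (\<Prod>f\<in>conjugates N e. Y2 - fps_const (rot \<zeta> f))"
    by (simp add: alg_homD[OF hom] rotX_Y rotX_const)
  also have "\<dots> = T"
    unfolding T_def by (rule prod.reindex_bij_betw[OF bij_betw_rot_conjugates[OF N \<zeta>(1)]])
  finally have rotT: "rotX \<zeta> T = T" .
  then obtain P where P: "T = ramify N P" using rotX_invariant_ramify[OF N \<zeta>(2)] by blast
  have T0: "T \<noteq> 0"
    unfolding T_def by (simp add: finite_conjugates[OF N] linear_factor_nonzero)
  have "g \<in> pker N e \<longleftrightarrow> P dvd g" for g
  proof
    assume "P dvd g"
    have "eval1 P (fps_X ^ N) e = eval1 T fps_X e"
      unfolding P using N e by (simp add: eval1_ramify)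
    also have "\<dots> = (\<Prod>f\<in>conjugates N e. e - f)"
      unfolding T_def using e conjugates_nth_0[OF e]
      by (simp add: eval1_prod) (intro prod.cong refl, simp add: eval1_simps eval1_const)
    also have "\<dots> = 0"
      using finite_conjugates[OF N] by (auto simp: conjugates_def intro!: bexI[of _ 1] image_eqI[of _ _ 1])
    finally have "eval1 P (fps_X ^ N) e = 0" .
    then show "g \<in> pker N e" using \<open>P dvd g\<close> N e by (auto simp: pker_def eval1_simps elim!: dvdE)
  next
    assume g: "g \<in> pker N e"
    have "T dvd ramify N g"
      unfolding T_def
    proof (rule prod_linear_factors_dvd[OF finite_conjugates[OF N]])
      fix f assume f: "f \<in> conjugates N e"
      then obtain \<xi> where "\<xi> ^ N = 1" "f = rot \<xi> e" by (auto simp: conjugates_def)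
      then have "g \<in> pker N f" using g pker_rot[OF N _ e] by simp
      then show "f $ 0 = 0 \<and> eval1 (ramify N g) fps_X f = 0"
        using conjugates_nth_0[OF e f] N by (simp add: eval1_ramify pker_def)
    qed
    then obtain h where h: "ramify N g = T * h" by (elim dvdE)
    have "T * h = rotX \<zeta> (T * h)" unfolding h[symmetric] by (simp add: rotX_ramify N \<zeta>)
    also have "\<dots> = T * rotX \<zeta> h" by (simp add: alg_homD[OF hom] rotT)
    finally have "rotX \<zeta> h = h" using T0 by simp
    then obtain k where k: "h = ramify N k" using rotX_invariant_ramify[OF N \<zeta>(2)] by blast
    have "ramify N g = ramify N (P * k)"
      unfolding h P k by (simp add: alg_homD[OF alg_hom_ramify[OF N]])
    then have "g = P * k" by (rule ramify_inject[OF N])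
    then show "P dvd g" by simp
  qed
  then show ?thesis using that[of P] P T_def by (auto simp: Z_def)
qed

text \<open>A nonzero generator of the kernel of a homomorphism to the domain of univariate series
  is prime.\<close>

lemma pker_prime:
  assumes "N > 0" "e $ 0 = 0"
  obtains P where "pker N e = Z P" "prime_elem P"
proof -
  obtain P where P: "pker N e = Z P" "ramify N P = (\<Prod>f\<in>conjugates N e. Y2 - fps_const f)"
    using pker_principal[OF assms] .
  have mem: "P dvd g \<longleftrightarrow> eval1 g (fps_X ^ N) e = 0" for g using P(1) by (auto simp: Z_def pker_def)
  have "P \<noteq> 0"
  proof
    assume "P = 0"
    then have "ramify N P = 0" using alg_homD(4)[OF alg_hom_ramify[OF assms(1)]] by simp
    then show False unfolding P(2) by (simp add: finite_conjugates[OF assms(1)] linear_factor_nonzero)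
  qed
  moreover have "\<not> P dvd 1" unfolding mem using assms by (simp add: eval1_simps)
  moreover have "P dvd a \<or> P dvd b" if "P dvd a * b" for a b
    using that unfolding mem using assms by (simp add: eval1_simps)
  ultimately have "prime_elem P" by (simp add: prime_elem_def)
  then show ?thesis using that P by blast
qed

text \<open>The generator of the smaller ideal vanishes on the other parametrization. Over a common
  denominator its value is a product of differences with the conjugates of \<open>e\<close>, so one
  of them is zero.\<close>

lemma pker_subset_conjugate:
  assumes "N > 0" "e $ 0 = 0" "M > 0" "f $ 0 = 0" "pker N e \<subseteq> pker M f"
  obtains \<xi> where "\<xi> ^ (N * M) = 1" "f oo fps_X ^ N = rot \<xi> (e oo fps_X ^ M)"
proof -
  obtain P where P: "pker N e = Z P" "ramify N P = (\<Prod>f\<in>conjugates N e. Y2 - fps_const f)"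
    using pker_principal[OF assms(1,2)] .
  have "P \<in> pker M f" using P(1) assms(5) by (auto simp: Z_def)
  then have "eval1 P (fps_X ^ M) f oo fps_X ^ N = 0" by (simp add: pker_def)
  then have "eval1 P ((fps_X ^ M) ^ N) (f oo fps_X ^ N) = 0"
    using assms by (simp add: eval1_compose X_power_compose_X_power power_mult)
  then have "eval1 (ramify N P) (fps_X ^ M) (f oo fps_X ^ N) = 0"
    using assms by (simp add: eval1_ramify)
  moreover have "eval1 (ramify N P) (fps_X ^ M) (f oo fps_X ^ N)
      = (\<Prod>g\<in>conjugates N e. (f oo fps_X ^ N) - (g oo fps_X ^ M))"
    unfolding P(2) using assms by (simp add: eval1_prod eval1_simps eval1_const)
  ultimately obtain g where "g \<in> conjugates N e" "f oo fps_X ^ N = g oo fps_X ^ M"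
    using finite_conjugates[OF assms(1)] by auto
  then obtain \<zeta> where \<zeta>: "\<zeta> ^ N = 1" "f oo fps_X ^ N = rot \<zeta> e oo fps_X ^ M"
    by (auto simp: conjugates_def)
  \<comment> \<open>The substitution of t^M for \<open>t\<close> turns the rotation by \<zeta> into
    a rotation by any M-th root of \<zeta>.\<close>
  obtain \<xi> where \<xi>: "\<xi> ^ M = \<zeta>" using complex_nth_root_exists[OF assms(3)] by blast
  have "\<xi> ^ (N * M) = 1" using \<zeta> \<xi> by (simp add: mult.commute[of N M] power_mult)
  moreover have "f oo fps_X ^ N = rot \<xi> (e oo fps_X ^ M)"
    using \<zeta>(2) rot_compose_X_power[OF assms(3) \<xi>] by simp
  ultimately show ?thesis using that by blast
qed

lemma X2_dvd_iff: "X2 dvd f \<longleftrightarrow> at_X0 f = 0"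
proof
  assume "at_X0 f = 0"
  then have "f $ j $ 0 = 0" for j by (metis at_X0_nth coeff2_def fps_zero_nth)
  then have "f = X2 * Abs_fps (\<lambda>j. fps_shift 1 (f $ j))"
    by (auto simp: fps_eq_iff fps_X_mult_nth)
  then show "X2 dvd f" by (rule dvdI)
qed (auto elim!: dvdE)

lemma X2_prime: "prime_elem X2"
  by (auto simp: prime_elem_def X2_dvd_iff ser2_unit_iff)

lemma irreducible_dvd_imp_Z_eq:
  assumes "irreducible (f :: ser2)" "P dvd f" "\<not> P dvd 1"
  shows "Z f = Z P"
proof -
  obtain u where u: "f = P * u" using assms(2) by (elim dvdE)
  then have "u dvd 1" using irreducibleD[OF assms(1) u] assms(3) by blast
  then obtain v where v: "1 = u * v" by (elim dvdE)
  have "f dvd h" if hP: "P dvd h" for h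
  proof -
    obtain k where "h = P * k" using hP by (elim dvdE)
    then have "h = P * k * (u * v)" by (simp flip: v)
    then have "h = f * (v * k)" by (simp add: u mult_ac)
    then show ?thesis by simp
  qed
  then show ?thesis using assms(2) dvd_trans unfolding Z_def by blast
qed

lemma ex_root:
  assumes "at_X0 f \<noteq> 0" "\<not> f dvd 1"
  obtains N e where "N > 0" "e $ 0 = 0" "f \<in> pker N e"
proof -
  define m where "m = subdegree (at_X0 f)"
  have "coeff2 f 0 0 = 0" using assms(2) by (simp add: ser2_unit_iff)
  moreover have "coeff2 f 0 m \<noteq> 0" using assms(1) unfolding m_def by (metis at_X0_nth nth_subdegree_nonzero)
  moreover have "coeff2 f 0 j = 0" if "j < m" for j
    using that unfolding m_def by (metis at_X0_nth nth_less_subdegree_zero)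
  ultimately have "m > 0" by (metis gr0I)
  then show ?thesis using newton_puiseux[of m f] \<open>coeff2 f 0 m \<noteq> 0\<close> \<open>\<And>j. j < m \<Longrightarrow> _ j\<close> that
    by (auto simp: pker_def)
qed

lemma irreducible_cases:
  assumes "irreducible f" "\<not> X2 dvd f"
  obtains N e where "N > 0" "e $ 0 = 0" "Z f = pker N e"
proof -
  obtain N e where Ne: "N > 0" "e $ 0 = 0" "f \<in> pker N e"
    using ex_root[of f] assms irreducible_not_unit by (metis X2_dvd_iff)
  obtain P where P: "pker N e = Z P" "prime_elem P" using pker_prime[OF Ne(1,2)] .
  have "Z f = Z P" using assms(1) P Ne(3) by (intro irreducible_dvd_imp_Z_eq) (auto simp: Z_def dest: prime_elem_not_unit)
  then show ?thesis using that Ne P by blast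
qed

text \<open>A root given by Newton-Puiseux yields a prime factor \<open>P\<close> of any non-unit.
  Since P(0, Y) has positive order, the order of f(0, Y) drops in the quotient.\<close>

lemma prime_factorization_exists:
  assumes "\<not> X2 dvd f"
  shows "\<exists>w ps. f = w * prod_list ps \<and> w dvd 1 \<and> (\<forall>p\<in>set ps. prime_elem p)"
  using assms
proof (induction "subdegree (at_X0 f)" arbitrary: f rule: less_induct)
  case less
  show ?case
  proof (cases "f dvd 1")
    case True
    then show ?thesis by (intro exI[of _ f] exI[of _ "[]"]) simp
  next
    case False
    then obtain N e where Ne: "N > 0" "e $ 0 = 0" "f \<in> pker N e"
      using ex_root[of f] less.prems by (auto simp: X2_dvd_iff)
    obtain P where P: "pker N e = Z P" "prime_elem P" using pker_prime[OF Ne(1,2)] .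
    then obtain g where g: "f = P * g" using Ne(3) by (auto simp: Z_def elim!: dvdE)
    have nz: "at_X0 P \<noteq> 0" "at_X0 g \<noteq> 0" using less.prems by (auto simp: g X2_dvd_iff)
    have "at_X0 P $ 0 = 0" using prime_elem_not_unit[OF P(2)] by (simp add: ser2_unit_iff)
    then have "subdegree (at_X0 P) > 0" using nz(1) by (metis gr0I nth_subdegree_nonzero)
    then have "subdegree (at_X0 g) < subdegree (at_X0 f)" using nz by (simp add: g)
    then obtain w ps where "g = w * prod_list ps" "w dvd 1" "\<forall>p\<in>set ps. prime_elem p"
      using less.hyps[of g] nz(2) by (auto simp: X2_dvd_iff)
    then show ?thesis using P(2) by (intro exI[of _ w] exI[of _ "P # ps"]) (simp add: g mult_ac)
  qed
qed

section \<open>Newton-Puiseux roots of branches\<close>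

definition bker :: "ser2 \<Rightarrow> ser2 \<Rightarrow> nat \<Rightarrow> complex fps \<Rightarrow> curve" where
  "bker x y N e = {g. in_coords x y g \<in> pker N e}"

lemma np_roots_eq:
  "np_roots x y D = {puiseux n e | n e. n > 0 \<and> e $ 0 = 0 \<and> D \<subseteq> bker x y n e}"
proof -
  have "(\<forall>g\<in>D. subst2 (in_coords x y g) (fps_const (fps_X ^ n)) (fps_const e) = 0) \<longleftrightarrow> D \<subseteq> bker x y n e" for n e
    unfolding subst2_const_const by (auto simp: bker_def pker_def)
  then show ?thesis unfolding np_roots_def by simp
qed

lemma np_rootsE:
  assumes "\<xi> \<in> np_roots x y D"
  obtains n e where "\<xi> = puiseux n e" "n > 0" "e $ 0 = 0" "D \<subseteq> bker x y n e"
  using assms unfolding np_roots_eq by blast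

lemma bker_compose:
  "N > 0 \<Longrightarrow> M > 0 \<Longrightarrow> e $ 0 = 0 \<Longrightarrow> bker x y (N * M) (e oo fps_X ^ M) = bker x y N e"
  by (simp add: bker_def pker_compose)

lemma bker_conjugate:
  "N > 0 \<Longrightarrow> e $ 0 = 0 \<Longrightarrow> f \<in> conjugates N e \<Longrightarrow> bker x y N f = bker x y N e"
  by (auto simp: bker_def conjugates_def pker_rot)

lemma self_in_conjugates: "e \<in> conjugates N e"
  unfolding conjugates_def by (rule image_eqI[of _ _ 1]) simp_all

lemma prime_elem_imp_irreducible_idom:
  fixes p :: "'a :: idom"
  assumes "prime_elem p"
  shows "irreducible p"
proof (rule irreducibleI)
  show "p \<noteq> 0" "\<not> p dvd 1" using assms by (auto simp: prime_elem_def)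
  have unit: "b dvd 1" if pab: "p = a * b" "p dvd a" for a b
  proof -
    obtain k where k: "a = p * k" using pab(2) by (elim dvdE)
    have "p * (k * b) = p * 1"
      unfolding mult.assoc[symmetric] k[symmetric] mult_1_right by (rule pab(1)[symmetric])
    then have "k * b = 1" using \<open>p \<noteq> 0\<close> mult_left_cancel by blast
    then have "1 = b * k" by (simp add: mult.commute)
    then show ?thesis by (rule dvdI)
  qed
  fix a b assume ab: "p = a * b"
  then have "p dvd a \<or> p dvd b" using assms by (metis dvd_refl prime_elem_def)
  then show "a dvd 1 \<or> b dvd 1" using unit[OF ab] unit[of b a] ab by (auto simp: mult.commute)
qed

context
  fixes x y :: ser2
  assumes xy: "local_coords x y"
begin

lemma subst2_dvd_iff: "subst2 P x y dvd g \<longleftrightarrow> P dvd in_coords x y g"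
  using in_coords_dvd_iff[OF xy, of "subst2 P x y" g] by (simp add: in_coords_subst2[OF xy])

lemma prime_elem_subst2:
  assumes "prime_elem P"
  shows "prime_elem (subst2 P x y)"
proof -
  note hom = alg_hom_in_coords[OF xy]
  have "subst2 P x y \<noteq> 0"
  proof
    assume "subst2 P x y = 0"
    then have "in_coords x y (subst2 P x y) = 0" by (simp add: alg_homD(4)[OF hom])
    then show False using assms by (simp add: in_coords_subst2[OF xy])
  qed
  then show ?thesis
    using assms unfolding prime_elem_def subst2_dvd_iff alg_homD[OF hom] by blast
qed

lemma coord_not_unit: "\<not> x dvd 1"
  using local_coords_mpow[OF xy] by (simp add: ser2_unit_iff mpow_Suc_0_iff)

lemma bker_branch:
  assumes "N > 0" "e $ 0 = 0"
  shows "branch (bker x y N e)" "bker x y N e \<noteq> Z x"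
proof -
  obtain P where P: "pker N e = Z P" "prime_elem P" using pker_prime[OF assms] .
  have "bker x y N e = Z (subst2 P x y)"
    unfolding bker_def P(1) by (auto simp: Z_def subst2_dvd_iff)
  then show "branch (bker x y N e)"
    unfolding branch_def using prime_elem_imp_irreducible_idom[OF prime_elem_subst2[OF P(2)]] by blast
  have "x \<notin> bker x y N e"
    using assms by (simp add: bker_def pker_def in_coords_X_Y[OF xy] eval1_simps)
  moreover have "x \<in> Z x" by (simp add: Z_def)
  ultimately show "bker x y N e \<noteq> Z x" by metis
qed

lemma irreducible_in_coords:
  assumes "irreducible f"
  shows "irreducible (in_coords x y f)"
proof (rule irreducibleI)
  note hom = alg_hom_in_coords[OF xy]
  have unit: "in_coords x y g dvd 1 \<longleftrightarrow> g dvd 1" for g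
    using in_coords_dvd_iff[OF xy, of g 1] by (simp add: alg_homD(5)[OF hom])
  show "in_coords x y f \<noteq> 0"
    using assms in_coords_eq_iff[OF xy, of f 0] by (auto simp: alg_homD(4)[OF hom])
  show "\<not> in_coords x y f dvd 1" using assms by (simp add: unit irreducible_not_unit)
  fix a b assume ab: "in_coords x y f = a * b"
  have "f = subst2 a x y * subst2 b x y"
    using arg_cong[OF ab, of "\<lambda>h. subst2 h x y"]
    by (simp add: subst2_in_coords[OF xy] alg_homD(2)[OF alg_hom_subst2_coords[OF xy]])
  then have "subst2 a x y dvd 1 \<or> subst2 b x y dvd 1" using assms irreducibleD by blast
  then show "a dvd 1 \<or> b dvd 1"
    unfolding subst2_dvd_iff by (simp add: alg_homD(5)[OF hom])
qed

text \<open>An equation of \<open>A\<close> is not divisible by \<open>x\<close>, so it has finite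
  order on x = 0, as \<open>newton_puiseux\<close> requires.\<close>

lemma branch_cases:
  assumes "branch A" "A \<noteq> Z x"
  obtains N e where "N > 0" "e $ 0 = 0" "A = bker x y N e"
proof -
  obtain f where f: "irreducible f" "A = Z f" using assms(1) by (auto simp: branch_def)
  have "\<not> x dvd f" using irreducible_dvd_imp_Z_eq[OF f(1) _ coord_not_unit] assms(2) f(2) by auto
  then have "\<not> X2 dvd in_coords x y f"
    using in_coords_dvd_iff[OF xy, of x f] by (simp add: in_coords_X_Y[OF xy])
  then obtain N e where Ne: "N > 0" "e $ 0 = 0" "Z (in_coords x y f) = pker N e"
    using irreducible_cases[OF irreducible_in_coords[OF f(1)]] by blast
  have "A = bker x y N e"
    unfolding f(2) bker_def Ne(3)[symmetric] by (auto simp: Z_def in_coords_dvd_iff[OF xy])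
  then show ?thesis using that Ne by blast
qed

lemma two_branches_cases:
  assumes "branch A" "A \<noteq> Z x" "branch B" "B \<noteq> Z x"
  obtains N e f where "N > 0" "e $ 0 = 0" "f $ 0 = 0" "A = bker x y N e" "B = bker x y N f"
proof -
  obtain N e where e: "N > 0" "e $ 0 = 0" "A = bker x y N e" using branch_cases[OF assms(1,2)] .
  obtain M f where f: "M > 0" "f $ 0 = 0" "B = bker x y M f" using branch_cases[OF assms(3,4)] .
  show ?thesis
  proof (rule that)
    show "N * M > 0" using e f by simp
    show "(e oo fps_X ^ M) $ 0 = 0" "(f oo fps_X ^ N) $ 0 = 0" using e f by auto
    show "A = bker x y (N * M) (e oo fps_X ^ M)" using e f by (simp add: bker_compose)
    show "B = bker x y (N * M) (f oo fps_X ^ N)"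
      using e f bker_compose[of M N f x y] by (simp add: mult.commute)
  qed
qed

lemma bker_subset_iff: "bker x y N e \<subseteq> bker x y M f \<longleftrightarrow> pker N e \<subseteq> pker M f"
proof
  assume *: "bker x y N e \<subseteq> bker x y M f"
  show "pker N e \<subseteq> pker M f"
  proof
    fix g assume "g \<in> pker N e"
    then have "subst2 g x y \<in> bker x y N e" by (simp add: bker_def in_coords_subst2[OF xy])
    then have "subst2 g x y \<in> bker x y M f" using * by blast
    then show "g \<in> pker M f" by (simp add: bker_def in_coords_subst2[OF xy])
  qed
qed (auto simp: bker_def)

end

section \<open>Puiseux series and the orders of their differences\<close>

lemma puiseux_of_nat_div: "N > 0 \<Longrightarrow> puiseux N e (of_nat k / of_nat N) = e $ k"
  by (simp add: puiseux_def)

lemma puiseux_cases: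
  assumes "N > 0"
  shows "(\<exists>k. r = of_nat k / of_nat N) \<or> (\<forall>e. puiseux N e r = 0)"
proof (cases "r * of_nat N \<in> \<nat>")
  case True
  then obtain k where "r * of_nat N = of_nat k" by (elim Nats_cases)
  then have "r = of_nat k / of_nat N" using assms by (simp add: field_simps)
  then show ?thesis by blast
qed (simp add: puiseux_def)

lemma puiseux_inject:
  assumes "N > 0"
  shows "puiseux N e = puiseux N f \<longleftrightarrow> e = f"
  using puiseux_of_nat_div[OF assms] by (metis fps_ext)

lemma puiseux_compose:
  assumes "N > 0" "M > 0"
  shows "puiseux (N * M) (e oo fps_X ^ M) = puiseux N e"
proof
  fix r :: rat
  have NM: "N * M > 0" using assms by simp
  show "puiseux (N * M) (e oo fps_X ^ M) r = puiseux N e r"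
  proof (cases "\<exists>k. r = of_nat k / of_nat (N * M)")
    case True
    then obtain k where nat: "r = of_nat k / of_nat (N * M)" by blast
    show ?thesis
    proof (cases "M dvd k")
      case True
      then obtain l where l: "k = M * l" by (elim dvdE)
      then have "r = of_nat l / of_nat N" using nat assms by (simp add: field_simps)
      then have "puiseux N e r = e $ l" using assms by (simp add: puiseux_of_nat_div)
      moreover have "puiseux (N * M) (e oo fps_X ^ M) r = (e oo fps_X ^ M) $ k"
        using nat puiseux_of_nat_div[of "N * M" _ k] assms by simp
      ultimately show ?thesis using assms by (simp add: fps_nth_compose_X_power l)
    next
      case False
      have "r * of_nat N \<notin> \<nat>"
      proof
        assume "r * of_nat N \<in> \<nat>"
        then obtain l where "r * of_nat N = of_nat l" by (elim Nats_cases)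
        then have "(of_nat k :: rat) = of_nat (M * l)" using nat assms by (simp add: field_simps)
        then have "k = M * l" using of_nat_eq_iff by blast
        then show False using False by simp
      qed
      then have "puiseux N e r = 0" by (simp add: puiseux_def)
      moreover have "puiseux (N * M) (e oo fps_X ^ M) r = (e oo fps_X ^ M) $ k"
        using nat puiseux_of_nat_div[of "N * M" _ k] assms by simp
      ultimately show ?thesis using False by (simp add: fps_nth_compose_X_power)
    qed
  next
    case False
    then have zero: "puiseux (N * M) e r = 0" for e
      using puiseux_cases[OF NM, of r] by blast
    have "puiseux N e r = 0"
    proof (cases "\<exists>k. r = of_nat k / of_nat N")
      case True
      then obtain k where nat: "r = of_nat k / of_nat N" by blast
      then have "r = of_nat (k * M) / of_nat (N * M)" using assms by (simp add: field_simps)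
      then have "(e oo fps_X ^ M) $ (k * M) = 0"
        using zero[of "e oo fps_X ^ M"] puiseux_of_nat_div[of "N * M" _ "k * M"] assms by simp
      then have "e $ k = 0" using assms by (simp add: fps_nth_compose_X_power)
      then show ?thesis using nat assms by (simp add: puiseux_of_nat_div)
    next
      case False
      then show ?thesis using puiseux_cases[OF assms(1), of r] by blast
    qed
    then show ?thesis using zero by simp
  qed
qed

lemma diff_order_puiseux:
  assumes "N > 0" "e \<noteq> f"
  shows "diff_order (puiseux N e) (puiseux N f) = of_nat (subdegree (e - f)) / of_nat N"
  unfolding diff_order_def
proof (rule Least_equality)
  have "(e - f) $ subdegree (e - f) \<noteq> 0" using assms by (intro nth_subdegree_nonzero) auto
  then show "puiseux N e (of_nat (subdegree (e - f)) / of_nat N) -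
      puiseux N f (of_nat (subdegree (e - f)) / of_nat N) \<noteq> 0"
    using assms by (simp add: puiseux_of_nat_div)
  fix r assume r: "puiseux N e r - puiseux N f r \<noteq> 0"
  then obtain k where k: "r = of_nat k / of_nat N"
    using puiseux_cases[OF assms(1), of r] by auto
  then have "(e - f) $ k \<noteq> 0" using r assms by (simp add: puiseux_of_nat_div)
  then have "subdegree (e - f) \<le> k" by (rule subdegree_leI)
  then show "of_nat (subdegree (e - f)) / of_nat N \<le> r"
    unfolding k by (intro divide_right_mono) auto
qed

text \<open>For A = B these are the characteristic exponents; for distinct branches, the orders
  whose maximum is the coincidence. Both cases are treated at once.\<close>

definition contacts :: "ser2 \<Rightarrow> ser2 \<Rightarrow> curve \<Rightarrow> curve \<Rightarrow> rat set" where
  "contacts x y A B =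
     {diff_order \<xi> \<xi>' | \<xi> \<xi>'. \<xi> \<in> np_roots x y A \<and> \<xi>' \<in> np_roots x y B \<and> \<xi> \<noteq> \<xi>'}"

lemma char_exponents_eq: "char_exponents x y A = contacts x y A A"
  by (simp add: char_exponents_def contacts_def)

context
  fixes x y :: ser2
  assumes xy: "local_coords x y"
begin

lemma np_roots_bker:
  assumes "N > 0" "e $ 0 = 0"
  shows "np_roots x y (bker x y N e) = puiseux N ` conjugates N e"
proof (intro equalityI subsetI)
  fix \<xi> assume "\<xi> \<in> np_roots x y (bker x y N e)"
  then obtain M f where f: "\<xi> = puiseux M f" "M > 0" "f $ 0 = 0" "bker x y N e \<subseteq> bker x y M f"
    by (elim np_rootsE)
  then have "pker N e \<subseteq> pker M f" by (simp add: bker_subset_iff[OF xy])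
  then obtain z where z: "z ^ (N * M) = 1" "f oo fps_X ^ N = rot z (e oo fps_X ^ M)"
    using pker_subset_conjugate[OF assms f(2,3)] by blast
  have "\<xi> = puiseux (N * M) (f oo fps_X ^ N)"
    using puiseux_compose[of M N f] f assms by (simp add: mult.commute)
  also have "\<dots> = puiseux (N * M) (rot (z ^ M) e oo fps_X ^ M)"
    unfolding z(2) using rot_compose_X_power[OF f(2) refl] by simp
  also have "\<dots> = puiseux N (rot (z ^ M) e)"
    using assms f by (simp add: puiseux_compose)
  finally have "\<xi> = puiseux N (rot (z ^ M) e)" .
  moreover have "(z ^ M) ^ N = 1" using z(1) by (simp add: power_mult[symmetric] mult.commute)
  ultimately show "\<xi> \<in> puiseux N ` conjugates N e" by (auto simp: conjugates_def)
next
  fix \<xi> assume "\<xi> \<in> puiseux N ` conjugates N e"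
  then obtain f where f: "f \<in> conjugates N e" "\<xi> = puiseux N f" by blast
  then show "\<xi> \<in> np_roots x y (bker x y N e)"
    unfolding np_roots_eq using assms conjugates_nth_0[OF assms(2)] bker_conjugate[OF assms f(1)] by blast
qed

text \<open>Rotating both roots by the same root of unity keeps the order of their difference, so
  the root of the first branch can be fixed to be \<open>e\<close>.\<close>

lemma contacts_bker:
  assumes "N > 0" "e $ 0 = 0" "f $ 0 = 0"
  shows "contacts x y (bker x y N e) (bker x y N f) =
    {of_nat (subdegree (e - g)) / of_nat N | g. g \<in> conjugates N f \<and> g \<noteq> e}"
proof (intro equalityI subsetI)
  fix r assume "r \<in> contacts x y (bker x y N e) (bker x y N f)"
  then obtain a b where ab: "a ^ N = 1" "b ^ N = 1" "puiseux N (rot a e) \<noteq> puiseux N (rot b f)"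
    "r = diff_order (puiseux N (rot a e)) (puiseux N (rot b f))"
    unfolding contacts_def np_roots_bker[OF assms(1,2)] np_roots_bker[OF assms(1,3)]
    by (auto simp: conjugates_def)
  have "a \<noteq> 0" using root_of_unity_nonzero[OF assms(1) ab(1)] .
  define g where "g = rot (b / a) f"
  have g: "g \<in> conjugates N f" using ab by (auto simp: g_def conjugates_def power_divide)
  have "rot a e - rot b f = rot a (e - g)"
    using \<open>a \<noteq> 0\<close> by (simp add: g_def rot_diff rot_rot)
  then have "r = of_nat (subdegree (e - g)) / of_nat N" "g \<noteq> e"
    using ab \<open>a \<noteq> 0\<close> assms by (auto simp: puiseux_inject diff_order_puiseux subdegree_rot g_def rot_rot)
  then show "r \<in> {of_nat (subdegree (e - g)) / of_nat N | g. g \<in> conjugates N f \<and> g \<noteq> e}"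
    using g by blast
next
  fix r :: rat assume "r \<in> {of_nat (subdegree (e - g)) / of_nat N | g. g \<in> conjugates N f \<and> g \<noteq> e}"
  then obtain g where g: "r = of_nat (subdegree (e - g)) / of_nat N" "g \<in> conjugates N f" "g \<noteq> e" by blast
  have "puiseux N e \<in> np_roots x y (bker x y N e)" "puiseux N g \<in> np_roots x y (bker x y N f)"
    unfolding np_roots_bker[OF assms(1,2)] np_roots_bker[OF assms(1,3)]
    using g self_in_conjugates by auto
  moreover have "puiseux N e \<noteq> puiseux N g" "r = diff_order (puiseux N e) (puiseux N g)"
    using g assms by (auto simp: puiseux_inject diff_order_puiseux)
  ultimately show "r \<in> contacts x y (bker x y N e) (bker x y N f)" unfolding contacts_def by blast
qed

text \<open>Conjugate series define the same ideal, so a common root would identify the two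
  branches.\<close>

lemma np_roots_disjoint:
  assumes "branch A" "A \<noteq> Z x" "branch B" "B \<noteq> Z x" "A \<noteq> B"
  shows "np_roots x y A \<inter> np_roots x y B = {}"
proof -
  obtain N e f where *: "N > 0" "e $ 0 = 0" "f $ 0 = 0" "A = bker x y N e" "B = bker x y N f"
    using two_branches_cases[OF xy assms(1-4)] by blast
  have "conjugates N e \<inter> conjugates N f = {}"
    using assms(5) bker_conjugate[OF *(1,2), of _ x y] bker_conjugate[OF *(1,3), of _ x y] by (auto simp: *(4,5))
  then show ?thesis
    using *(1) by (auto simp: *(4,5) np_roots_bker[OF *(1,2)] np_roots_bker[OF *(1,3)] puiseux_inject)
qed

lemma contacts_finite_pos:
  assumes "branch A" "A \<noteq> Z x" "branch B" "B \<noteq> Z x"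
  shows "finite (contacts x y A B)" "\<And>r. r \<in> contacts x y A B \<Longrightarrow> r > 0"
    "A \<noteq> B \<Longrightarrow> contacts x y A B \<noteq> {}"
proof -
  obtain N e f where *: "N > 0" "e $ 0 = 0" "f $ 0 = 0" "A = bker x y N e" "B = bker x y N f"
    using two_branches_cases[OF xy assms(1-4)] by blast
  note eq = contacts_bker[OF *(1-3), folded *(4,5)]
  show "finite (contacts x y A B)" unfolding eq using finite_conjugates[OF *(1), of f] by simp
  show "r > 0" if r: "r \<in> contacts x y A B" for r
  proof -
    obtain g where g: "r = of_nat (subdegree (e - g)) / of_nat N" "g \<in> conjugates N f" "g \<noteq> e"
      using r unfolding eq by blast
    have "(e - g) $ 0 = 0" using * conjugates_nth_0[OF *(3) g(2)] by simp
    then have "subdegree (e - g) > 0" using g(3) by (metis gr0I nth_subdegree_nonzero right_minus_eq)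
    then show ?thesis using *(1) by (simp add: g(1))
  qed
  show "contacts x y A B \<noteq> {}" if "A \<noteq> B"
  proof -
    have "f \<noteq> e" using that * by auto
    then show ?thesis unfolding eq using self_in_conjugates[of f N] by blast
  qed
qed

lemma coincidence_eq:
  assumes "branch A" "A \<noteq> Z x" "branch B" "B \<noteq> Z x" "A \<noteq> B"
  shows "coincidence x y A B = Max (contacts x y A B)"
proof -
  have "{diff_order \<xi> \<xi>' | \<xi> \<xi>'. \<xi> \<in> np_roots x y A \<and> \<xi>' \<in> np_roots x y B} = contacts x y A B"
    unfolding contacts_def using np_roots_disjoint[OF assms] by blast
  then show ?thesis by (simp add: coincidence_def)
qed

end

subsection \<open>Independence of the coordinates\<close>

lemma fps_compose_diff_factor:
  assumes "a $ 0 = 0" "b $ 0 = (0 :: complex)"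
  obtains q where "(h oo a) - (h oo b) = (a - b) * q"
proof -
  define G where "G = subst2 (fps_const h) Y2 0"
  have "eval1 G 0 c = h oo c" if "c $ 0 = 0" for c
    unfolding G_def using that by (simp add: eval1_subst2 eval1_simps eval1_const)
  then show ?thesis using eval1_diff_factor[of 0 a b G] assms that by auto
qed

text \<open>The new parameter s = t \<eta> satisfies: s^N is the new first coordinate X \<eta>^N
  along the curve. As \<open>s\<close> has order one, it is invertible for composition, and the
  second coordinate \<open>V\<close> becomes a series \<open>e'\<close> in \<open>s\<close>.\<close>

lemma reparametrize:
  assumes "N > 0" "coeff2 \<eta> 0 0 \<noteq> 0" "V \<in> mpow (Suc 0)" "e $ 0 = 0"
  obtains e' where "e' $ 0 = 0" "e' oo (fps_X * eval1 \<eta> (fps_X ^ N) e) = eval1 V (fps_X ^ N) e"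
    "\<And>g. eval1 (subst2 g (X2 * \<eta> ^ N) V) (fps_X ^ N) e = 0 \<longleftrightarrow> eval1 g (fps_X ^ N) e' = 0"
proof -
  define s where "s = fps_X * eval1 \<eta> (fps_X ^ N) e"
  have N: "(fps_X ^ N :: complex fps) $ 0 = 0" using assms(1) by simp
  have s: "s $ 0 = 0" "s $ 1 \<noteq> 0" using assms N by (simp_all add: s_def eval1_nth_0)
  define e' where "e' = eval1 V (fps_X ^ N) e oo fps_inv s"
  have e's: "e' oo s = eval1 V (fps_X ^ N) e"
  proof -
    have "e' oo s = eval1 V (fps_X ^ N) e oo (fps_inv s oo s)"
      unfolding e'_def by (rule fps_compose_assoc[symmetric]) (simp_all add: s fps_inv_def)
    then show ?thesis using fps_inv[OF s] by simp
  qed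
  show ?thesis
  proof (rule that)
    show "e' oo (fps_X * eval1 \<eta> (fps_X ^ N) e) = eval1 V (fps_X ^ N) e" using e's by (simp add: s_def)
    show e'0: "e' $ 0 = 0" using assms N by (simp add: e'_def eval1_nth_0 mpow_Suc_0_iff)
    fix g
    have "X2 * \<eta> ^ N \<in> mpow (Suc 0)" by (simp add: mpow_mult_right)
    then have "eval1 (subst2 g (X2 * \<eta> ^ N) V) (fps_X ^ N) e
      = eval1 g (fps_X ^ N * eval1 \<eta> (fps_X ^ N) e ^ N) (eval1 V (fps_X ^ N) e)"
      using assms N by (simp add: eval1_subst2 eval1_simps)
    also have "fps_X ^ N * eval1 \<eta> (fps_X ^ N) e ^ N = fps_X ^ N oo s"
      using s by (simp add: fps_compose_power[symmetric] s_def power_mult_distrib)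
    also have "eval1 g (fps_X ^ N oo s) (eval1 V (fps_X ^ N) e) = eval1 g (fps_X ^ N) e' oo s"
      unfolding e's[symmetric] using N e'0 s by (simp add: eval1_compose)
    finally have "eval1 (subst2 g (X2 * \<eta> ^ N) V) (fps_X ^ N) e = eval1 g (fps_X ^ N) e' oo s" .
    moreover have "s \<noteq> 0" using s by auto
    ultimately show "eval1 (subst2 g (X2 * \<eta> ^ N) V) (fps_X ^ N) e = 0 \<longleftrightarrow> eval1 g (fps_X ^ N) e' = 0"
      using s by (simp add: fps_compose_eq_0_iff)
  qed
qed

text \<open>
  \<open>(e' - f') (s\<^sub>e) = (V\<^sub>e - V\<^sub>f) + (f' (s\<^sub>f) - f' (s\<^sub>e))\<close>, where the order of the last term exceeds that of
  \<open>e - f\<close>, since \<open>s\<^sub>e - s\<^sub>f\<close> is divisible by \<open>t (e - f)\<close>.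
\<close>

lemma subdegree_reparametrize:
  assumes "N > 0" "coeff2 \<eta> 0 0 \<noteq> 0" "coeff2 V 0 1 \<noteq> 0" "e $ 0 = 0" "f $ 0 = 0" "e \<noteq> f"
    and "e' oo (fps_X * eval1 \<eta> (fps_X ^ N) e) = eval1 V (fps_X ^ N) e"
    and "f' oo (fps_X * eval1 \<eta> (fps_X ^ N) f) = eval1 V (fps_X ^ N) f"
  shows "e' \<noteq> f'" "subdegree (e' - f') = subdegree (e - f)"
proof -
  have N: "(fps_X ^ N :: complex fps) $ 0 = 0" using assms(1) by simp
  define s where "s h = fps_X * eval1 \<eta> (fps_X ^ N) h" for h
  have s0: "s e $ 0 = 0" "s f $ 0 = 0" by (simp_all add: s_def)
  have s1: "s e $ 1 \<noteq> 0" using assms N by (simp add: s_def eval1_nth_0)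
  have sub_s: "subdegree (s e) = 1" by (rule subdegreeI) (use s0 s1 in auto)
  obtain q1 where q1: "eval1 V (fps_X ^ N) e - eval1 V (fps_X ^ N) f = (e - f) * q1" "q1 $ 0 = coeff2 V 0 1"
    using eval1_diff_factor[OF N assms(4,5)] by blast
  obtain q2 where q2: "eval1 \<eta> (fps_X ^ N) e - eval1 \<eta> (fps_X ^ N) f = (e - f) * q2"
    using eval1_diff_factor[OF N assms(4,5)] by blast
  obtain q3 where q3: "(f' oo s f) - (f' oo s e) = (s f - s e) * q3"
    using fps_compose_diff_factor[OF s0(2,1)] by blast
  have "s f - s e = - fps_X * ((e - f) * q2)" unfolding q2[symmetric] by (simp add: s_def algebra_simps)
  then have "(f' oo s f) - (f' oo s e) = - fps_X * ((e - f) * q2) * q3" using q3 by simp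
  moreover have "(e' - f') oo s e = ((e' oo s e) - (f' oo s f)) + ((f' oo s f) - (f' oo s e))"
    by (simp add: fps_compose_sub_distrib)
  moreover have "(e' oo s e) - (f' oo s f) = (e - f) * q1"
    using assms(7,8) q1(1) by (simp add: s_def)
  ultimately have "(e' - f') oo s e = (e - f) * q1 + - fps_X * ((e - f) * q2) * q3" by simp
  also have "\<dots> = (e - f) * (q1 - fps_X * q2 * q3)" by (simp add: algebra_simps)
  finally have eq: "(e' - f') oo s e = (e - f) * (q1 - fps_X * q2 * q3)" .
  \<comment> \<open>The correction carries a factor \<open>t\<close>, so the constant term is that
    of \<open>q1\<close>, the coefficient of Y in \<open>V\<close>.\<close>
  have u: "(q1 - fps_X * q2 * q3) $ 0 \<noteq> 0" using q1(2) assms(3) by (simp add: mult.assoc)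
  then have nz: "q1 - fps_X * q2 * q3 \<noteq> 0" by auto
  have "(e' - f') oo s e \<noteq> 0" unfolding eq using nz assms(6) by simp
  then show "e' \<noteq> f'" by auto
  have "subdegree ((e' - f') oo s e) = subdegree (e' - f')"
    using s0 sub_s by simp
  moreover have "subdegree ((e - f) * (q1 - fps_X * q2 * q3)) = subdegree (e - f)"
    using nz assms(6) u by (simp add: subdegree_eq_0)
  ultimately show "subdegree (e' - f') = subdegree (e - f)" using eq by simp
qed

lemma Z_eq_imp_unit:
  assumes "Z x = Z x'" "x \<noteq> 0"
  obtains u where "x' = x * u" "u dvd 1"
proof -
  have "x' \<in> Z x'" "x \<in> Z x" by (simp_all add: Z_def)
  then have "x' \<in> Z x" "x \<in> Z x'" by (simp_all only: assms(1))
  then have "x dvd x'" "x' dvd x" by (simp_all add: Z_def)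
  then obtain u v where uv: "x' = x * u" "x = x' * v" by (elim dvdE)
  have "x * (u * v) = x * 1"
    unfolding mult.assoc[symmetric] uv(1)[symmetric] mult_1_right by (rule uv(2)[symmetric])
  then have "1 = u * v" using mult_left_cancel[OF assms(2)] by metis
  then have "u dvd 1" by (rule dvdI)
  then show ?thesis using that uv(1) by blast
qed

text \<open>The first coordinates differ by a unit, of which an N-th root supplies the \<eta> of
  \<open>reparametrize\<close>. Being a series in two variables, it serves both curves at once, so
  the new roots can be compared.\<close>

lemma contacts_subset_coords:
  assumes xy: "local_coords x y" and xy': "local_coords x' y'" and Z: "Z x = Z x'"
    and A: "branch A" "A \<noteq> Z x" and B: "branch B" "B \<noteq> Z x"
  shows "contacts x y A B \<subseteq> contacts x' y' A B"
proof
  fix r assume r: "r \<in> contacts x y A B"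
  note hom = alg_hom_in_coords[OF xy]
  have "x \<noteq> 0" using in_coords_X_Y(1)[OF xy] alg_homD(4)[OF hom] by auto
  then obtain u where u: "x' = x * u" "u dvd 1" using Z_eq_imp_unit[OF Z] by blast
  define U where "U = in_coords x y u"
  define V where "V = in_coords x y y'"
  have Cx': "in_coords x y x' = X2 * U"
    by (simp add: u U_def alg_homD[OF hom] in_coords_X_Y[OF xy])
  have U0: "coeff2 U 0 0 \<noteq> 0" using u(2) by (simp add: U_def alg_hom_coeff2_00[OF hom] ser2_unit_iff)
  have V0: "V \<in> mpow (Suc 0)"
    unfolding V_def using local_coords_mpow[OF xy'] by (intro alg_hom_mpow[OF hom]) auto
  \<comment> \<open>Modulo X, the variable Y is a multiple of \<open>V\<close>; hence
    \<open>V\<close> has a nonzero term in Y.\<close>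
  have V1: "coeff2 V 0 1 \<noteq> 0"
  proof -
    have "y \<in> ideal_gen {x', y'}"
      using xy' local_coords_mpow[OF xy] by (simp add: local_coords_def max_ideal_eq)
    then obtain a b where ab: "y = a * x' + b * y'" unfolding ideal_gen_two by blast
    have "Y2 = in_coords x y a * (X2 * U) + in_coords x y b * V"
      using arg_cong[OF ab, of "in_coords x y"] by (simp add: alg_homD[OF hom] in_coords_X_Y[OF xy] Cx' V_def)
    then have "coeff2 Y2 0 1 = coeff2 (in_coords x y a * (X2 * U) + in_coords x y b * V) 0 1" by simp
    then have "1 = coeff2 (in_coords x y b) 0 0 * coeff2 V 0 1"
      using V0 by (simp add: coeff2_mult mpow_Suc_0_iff)
    then show ?thesis by auto
  qed
  obtain N e f where *: "N > 0" "e $ 0 = 0" "f $ 0 = 0" "A = bker x y N e" "B = bker x y N f"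
    using two_branches_cases[OF xy A B] by blast
  obtain g where g: "r = of_nat (subdegree (e - g)) / of_nat N" "g \<in> conjugates N f" "g \<noteq> e"
    using r unfolding *(4,5) contacts_bker[OF xy *(1-3)] by blast
  have g0: "g $ 0 = 0" using conjugates_nth_0[OF *(3) g(2)] .
  have Bg: "B = bker x y N g" using bker_conjugate[OF *(1,3) g(2)] *(5) by simp
  obtain z where z: "z ^ N = coeff2 U 0 0" using complex_nth_root_exists[OF *(1)] by blast
  then have "z \<noteq> 0" using U0 *(1) by (metis power_0_left not_gr0)
  obtain \<eta> where \<eta>: "\<eta> ^ N = U" "coeff2 \<eta> 0 0 = z" using ser2_nth_root[OF *(1) z \<open>z \<noteq> 0\<close>] .
  have \<eta>0: "coeff2 \<eta> 0 0 \<noteq> 0" using \<eta>(2) \<open>z \<noteq> 0\<close> by simp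
  have conv: "in_coords x y h = subst2 (in_coords x' y' h) (X2 * \<eta> ^ N) V" for h
    using alg_hom_via_coords[OF xy' hom, of h] by (simp add: Cx' V_def \<eta>)
  have trans: "bker x y N a = bker x' y' N a'"
    if "\<And>h. eval1 (subst2 h (X2 * \<eta> ^ N) V) (fps_X ^ N) a = 0 \<longleftrightarrow> eval1 h (fps_X ^ N) a' = 0" for a a'
    using that by (simp add: bker_def pker_def conv)
  obtain e' where e': "e' $ 0 = 0" "e' oo (fps_X * eval1 \<eta> (fps_X ^ N) e) = eval1 V (fps_X ^ N) e"
    "bker x y N e = bker x' y' N e'"
    using reparametrize[OF *(1) \<eta>0 V0 *(2)] trans by metis
  obtain g' where g': "g' $ 0 = 0" "g' oo (fps_X * eval1 \<eta> (fps_X ^ N) g) = eval1 V (fps_X ^ N) g"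
    "bker x y N g = bker x' y' N g'"
    using reparametrize[OF *(1) \<eta>0 V0 g0] trans by metis
  have "e' \<noteq> g'" "subdegree (e' - g') = subdegree (e - g)"
    using subdegree_reparametrize[OF *(1) \<eta>0 V1 *(2) g0 _ e'(2) g'(2)] g(3) by auto
  then have "r = of_nat (subdegree (e' - g')) / of_nat N" "g' \<noteq> e'" using g(1) by auto
  then show "r \<in> contacts x' y' A B"
    unfolding *(4) Bg e'(3) g'(3) contacts_bker[OF xy' *(1) e'(1) g'(1)]
    using self_in_conjugates[of g' N] by blast
qed

lemma contacts_coords:
  assumes "local_coords x y" "local_coords x' y'" "Z x = Z x'"
    "branch A" "A \<noteq> Z x" "branch B" "B \<noteq> Z x"
  shows "contacts x y A B = contacts x' y' A B"
  using contacts_subset_coords[OF assms] contacts_subset_coords[of x' y' x y A B] assms by auto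

section \<open>The toric modification\<close>

lemma diff_dvd_power_diff: "(x - y :: 'a :: comm_ring_1) dvd x ^ n - y ^ n"
  unfolding power_diff_sumr2[of x n y] by simp

lemma diff_mult_expand: "(y - k) * (- r * x) = - r * (x * y) + k * r * x" for x y k r :: "'a :: comm_ring_1"
  by (simp add: algebra_simps)

lemma ideal_gen_scale: "g \<in> ideal_gen S \<Longrightarrow> f * g \<in> ideal_gen S"
  by (rule module.span_scale[OF module_ser2])

lemma ideal_gen_minimal:
  assumes "S \<subseteq> I" "0 \<in> I" "\<And>f g. f \<in> I \<Longrightarrow> g \<in> I \<Longrightarrow> f + g \<in> I" "\<And>f g. g \<in> I \<Longrightarrow> f * g \<in> I"
  shows "ideal_gen S \<subseteq> I"
proof (rule module.span_minimal[OF module_ser2 assms(1)])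
  show "module.subspace (*) I" unfolding module.subspace_def[OF module_ser2] using assms(2-4) by blast
qed

lemma Z_unit_mult:
  assumes "u * v = 1"
  shows "Z (f * u) = Z f"
proof -
  have "f * u dvd g \<longleftrightarrow> f dvd g" for g
  proof
    assume "f dvd g"
    then obtain k where "g = f * k" by (elim dvdE)
    then have "g = f * u * (v * k)" using assms by (metis mult.assoc mult_1_right)
    then show "f * u dvd g" by (rule dvdI)
  qed (auto elim: dvd_mult_left)
  then show ?thesis by (simp add: Z_def)
qed

lemma bezout_weights:
  assumes "coprime c d" "(d :: nat) > 0"
  obtains a b :: nat where "d * b = c * a + 1"
  using bezout_nat[of d c] assms by (metis coprime_iff_gcd_eq_1 gcd.commute neq0_conv)

text \<open>
  With \<open>d b - c a = 1\<close>, the monomial \<open>u\<^sub>0 = x\<^sup>-\<^sup>a y\<^sup>b\<close> has weight one and \<open>h = x\<^sup>d y\<^sup>-\<^sup>c\<close> has weight zero;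
  all monomials of nonnegative weight are products of powers of \<open>u\<^sub>0\<close> and \<open>h\<^sup>\<plusminus>\<^sup>1\<close>. A \<open>c\<close>-th root \<open>\<eta>\<close> of
  \<open>h\<close> gives \<open>u = u\<^sub>0 \<eta>\<^sup>b\<close> and \<open>\<mu> + v = \<eta>\<^sup>-\<^sup>1\<close>.
\<close>

lemma toric_normal_form:
  assumes cd: "c > 0" "d > 0" "coprime c d"
    and \<gamma>: "point_of_exc c d \<gamma>" and \<phi>: "completion_at c d \<gamma> \<phi>"
  obtains u v \<mu> where "local_coords u v" "Z u = exc_divisor c d \<phi>" "\<mu> \<noteq> 0"
    "\<phi> 1 0 = u ^ c" "\<phi> 0 1 = u ^ d * (const2 \<mu> + v)"
proof -
  obtain a b :: nat where ab: "d * b = c * a + 1" using bezout_weights cd by blast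
  have ab': "int d * int b = int c * int a + 1" using ab by (metis of_nat_1 of_nat_add of_nat_mult)
  have mult: "\<phi> (p + p') (q + q') = \<phi> p q * \<phi> p' q'" if "weight c d p q \<ge> 0" "weight c d p' q' \<ge> 0" for p q p' q'
    using \<phi> that by (simp add: completion_at_def)
  have one: "\<phi> 0 0 = 1" using \<phi> by (simp add: completion_at_def)
  have coeff: "coeff2 (\<phi> p q) 0 0 = \<gamma> p q" if "weight c d p q \<ge> 0" for p q
    using \<phi> that by (simp add: completion_at_def)
  have gen: "ideal_gen {\<phi> p q - const2 (\<gamma> p q) | p q. weight c d p q \<ge> 0} = max_ideal"
    using \<phi> by (simp add: completion_at_def)
  have pow: "\<phi> (int n * p) (int n * q) = \<phi> p q ^ n" if "weight c d p q \<ge> 0" for n p q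
  proof (induction n)
    case (Suc n)
    have "weight c d (int n * p) (int n * q) = int n * weight c d p q"
      by (simp add: weight_def algebra_simps)
    then have "weight c d (int n * p) (int n * q) \<ge> 0" using that by simp
    then have "\<phi> (p + int n * p) (q + int n * q) = \<phi> p q * \<phi> (int n * p) (int n * q)"
      using mult[OF that] by blast
    moreover have "p + int n * p = int (Suc n) * p" "q + int n * q = int (Suc n) * q"
      by (simp_all add: algebra_simps)
    ultimately show ?case by (simp add: Suc)
  qed (simp add: one)
  define u0 where "u0 = \<phi> (- int a) (int b)"
  define h where "h = \<phi> (int d) (- int c)"
  define hi where "hi = \<phi> (- int d) (int c)"
  have w0: "weight c d (- int a) (int b) = 1" using ab' by (simp add: weight_def algebra_simps)
  have wh: "weight c d (int d) (- int c) = 0" "weight c d (- int d) (int c) = 0"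
    by (simp_all add: weight_def)
  have hhi: "h * hi = 1"
    using mult[of "int d" "- int c" "- int d" "int c"] by (simp add: wh one h_def hi_def)
  \<comment> \<open>The exponent vector is its weight times (-a, b) plus \<open>j\<close> times (d,
    -c); these two vectors form a lattice basis because d b - c a = 1.\<close>
  have monom: "\<phi> s r = u0 ^ nat (weight c d s r) * \<phi> (j * int d) (- j * int c)"
    if w: "weight c d s r \<ge> 0" and j: "j = int a * r + int b * s" for s r j
  proof -
    define k where "k = weight c d s r"
    have "\<phi> (int (nat k) * (- int a)) (int (nat k) * int b) = u0 ^ nat k"
      unfolding u0_def by (rule pow) (simp add: w0)
    then have 1: "\<phi> (k * (- int a)) (k * int b) = u0 ^ nat k" using w by (simp add: k_def)
    have "weight c d (k * (- int a)) (k * int b) = k * weight c d (- int a) (int b)"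
      by (simp add: weight_def algebra_simps)
    then have 2: "weight c d (k * (- int a)) (k * int b) \<ge> 0" using w by (simp add: w0 k_def)
    have 3: "weight c d (j * int d) (- j * int c) = 0" by (simp add: weight_def)
    have "s = k * (- int a) + j * int d"
    proof -
      have "k * (- int a) + j * int d = s * (int d * int b - int c * int a)"
        by (simp add: k_def j weight_def algebra_simps)
      then show ?thesis by (simp add: ab')
    qed
    moreover have "r = k * int b + - j * int c"
    proof -
      have "k * int b + - j * int c = r * (int d * int b - int c * int a)"
        by (simp add: k_def j weight_def algebra_simps)
      then show ?thesis by (simp add: ab')
    qed
    ultimately have "\<phi> s r = \<phi> (k * (- int a)) (k * int b) * \<phi> (j * int d) (- j * int c)"
      using mult[OF 2, of "j * int d" "- j * int c"] 3 by simp
    then show ?thesis unfolding 1 unfolding k_def .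
  qed
  have hpow: "\<phi> (int n * int d) (- int n * int c) = h ^ n" "\<phi> (- int n * int d) (int n * int c) = hi ^ n" for n
    using pow[of "int d" "- int c" n] pow[of "- int d" "int c" n] by (simp_all add: wh h_def hi_def)
  define h0 where "h0 = coeff2 h 0 0"
  have *: "h0 * coeff2 hi 0 0 = 1" unfolding h0_def coeff2_mult_00[symmetric] hhi by simp
  then have "h0 \<noteq> 0" by auto
  then have h0: "h0 \<noteq> 0" "coeff2 hi 0 0 = 1 / h0" using * by (auto simp: field_simps)
  have u00: "coeff2 u0 0 0 = 0"
    unfolding u0_def using coeff[of "- int a" "int b"] \<gamma> w0 by (simp add: point_of_exc_def)
  obtain r where r: "r ^ c = h0" using complex_nth_root_exists[OF cd(1)] .
  then have r0: "r \<noteq> 0" using h0(1) cd(1) by (metis power_0_left not_gr0)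
  obtain \<eta> where \<eta>: "\<eta> ^ c = h" "coeff2 \<eta> 0 0 = r"
    using ser2_nth_root[OF cd(1), of r h] r r0 by (auto simp: h0_def)
  have "\<eta> dvd 1" using \<eta>(2) r0 by (simp add: ser2_unit_iff)
  then obtain \<eta>i where \<eta>i: "\<eta> * \<eta>i = 1" by (metis dvdE)
  have "r * coeff2 \<eta>i 0 0 = 1" unfolding \<eta>(2)[symmetric] coeff2_mult_00[symmetric] \<eta>i by simp
  then have \<eta>i0: "coeff2 \<eta>i 0 0 = 1 / r" using r0 by (simp add: field_simps)
  have powi: "\<eta> ^ n * \<eta>i ^ n = 1" for n by (simp add: power_mult_distrib[symmetric] \<eta>i)
  define u where "u = u0 * \<eta> ^ b"
  define v where "v = \<eta>i - const2 (1 / r)"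
  have uv: "u \<in> mpow (Suc 0)" "v \<in> mpow (Suc 0)"
    by (simp_all add: u_def v_def mpow_Suc_0_iff u00 \<eta>i0)
  have u0u: "u0 = u * \<eta>i ^ b" by (simp add: u_def mult.assoc powi)
  \<comment> \<open>\<eta> - r is a unit multiple of the difference of inverses \<open>v\<close>,
    and it divides \<eta>^c - r^c = h - h0.\<close>
  have vdvd: "v dvd h - const2 h0"
  proof -
    have "\<eta> - const2 r = v * (- const2 r * \<eta>)"
    proof -
      have "v * (- const2 r * \<eta>) = - const2 r * (\<eta> * \<eta>i) + const2 (1 / r * r) * \<eta>"
        unfolding fps_const_mult[symmetric] v_def by (rule diff_mult_expand)
      then show ?thesis using r0 by (simp add: \<eta>i)
    qed
    then have "v dvd \<eta> - const2 r" by (rule dvdI)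
    also have "\<dots> dvd \<eta> ^ c - const2 r ^ c" by (rule diff_dvd_power_diff)
    finally show ?thesis by (simp add: \<eta> r)
  qed
  have vdvd': "v dvd hi - const2 (1 / h0)"
  proof -
    have "hi - const2 (1 / h0) = (h - const2 h0) * (- const2 (1 / h0) * hi)"
    proof -
      have "(h - const2 h0) * (- const2 (1 / h0) * hi) = - const2 (1 / h0) * (hi * h) + const2 (h0 * (1 / h0)) * hi"
        unfolding fps_const_mult[symmetric] by (rule diff_mult_expand)
      then show ?thesis using h0(1) by (simp add: hhi mult.commute[of hi h])
    qed
    then show ?thesis using vdvd by simp
  qed
  define I where "I = ideal_gen {u, v}"
  have mem_I: "f \<in> I" if "u dvd f \<or> v dvd f" for f
    using that unfolding I_def ideal_gen_two
    by (metis add.right_neutral add.left_neutral dvdE mult.commute mult_zero_left)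
  \<comment> \<open>Monomials of positive weight are multiples of \<open>u0\<close>, hence of
    \<open>u\<close>. Those of weight zero are powers of \<open>h\<close> or of its inverse, and
    differ from their values by multiples of \<open>v\<close>.\<close>
  have "ideal_gen {\<phi> p q - const2 (\<gamma> p q) | p q. weight c d p q \<ge> 0} \<subseteq> I"
  proof (rule ideal_gen_minimal)
    show "f + g \<in> I" if "f \<in> I" "g \<in> I" for f g
      using module.span_add[OF module_ser2] that by (auto simp: I_def)
    show "0 \<in> I" using module.span_zero[OF module_ser2] by (auto simp: I_def)
    show "f * g \<in> I" if "g \<in> I" for f g using that unfolding I_def by (rule ideal_gen_scale)
    show "{\<phi> p q - const2 (\<gamma> p q) | p q. weight c d p q \<ge> 0} \<subseteq> I"
    proof clarify
      fix s t assume w: "weight c d s t \<ge> 0"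
      define j where "j = int a * t + int b * s"
      have eq: "\<phi> s t = u0 ^ nat (weight c d s t) * \<phi> (j * int d) (- j * int c)"
        using monom[OF w j_def] .
      show "\<phi> s t - const2 (\<gamma> s t) \<in> I"
      proof (cases "weight c d s t = 0")
        case False
        then have "weight c d s t > 0" using w by simp
        then have "\<gamma> s t = 0" using \<gamma> w unfolding point_of_exc_def by blast
        have "u dvd u0" unfolding u0u by simp
        then have "u dvd u0 ^ nat (weight c d s t)" using \<open>weight c d s t > 0\<close> by (simp add: dvd_power_le[of u u0 1, simplified])
        then have "u dvd \<phi> s t" unfolding eq by simp
        then show ?thesis using mem_I by (simp add: \<open>\<gamma> s t = 0\<close>)
      next
        case True
        have "v dvd \<phi> s t - const2 (\<gamma> s t)"
        proof (cases "j \<ge> 0")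
          case j: True
          then have "\<phi> s t = h ^ nat j" using eq hpow(1)[of "nat j"] True by simp
          moreover have "h ^ nat j - const2 h0 ^ nat j = \<phi> s t - const2 (\<gamma> s t)"
            using coeff[OF w] calculation by (simp add: h0_def)
          ultimately show ?thesis using dvd_trans[OF vdvd diff_dvd_power_diff[of h "const2 h0" "nat j"]] by simp
        next
          case j: False
          then have "\<phi> s t = hi ^ nat (- j)" using eq hpow(2)[of "nat (- j)"] True by simp
          moreover have "hi ^ nat (- j) - const2 (1 / h0) ^ nat (- j) = \<phi> s t - const2 (\<gamma> s t)"
            using coeff[OF w] calculation by (simp add: h0(2))
          ultimately show ?thesis
            using dvd_trans[OF vdvd' diff_dvd_power_diff[of hi "const2 (1 / h0)" "nat (- j)"]] by simp
        qed
        then show ?thesis using mem_I by blast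
      qed
    qed
  qed
  then have "max_ideal \<subseteq> I" by (simp add: gen)
  moreover have "I \<subseteq> max_ideal"
    unfolding I_def max_ideal_eq by (rule ideal_gen_minimal) (use uv in \<open>auto intro: mpow_add mpow_mult_left\<close>)
  ultimately have "local_coords u v" by (simp add: local_coords_def I_def)
  moreover have "Z u = exc_divisor c d \<phi>"
  proof -
    have "Z u = Z u0" unfolding u_def by (rule Z_unit_mult[OF powi])
    also have "\<dots> = exc_divisor c d \<phi>"
    proof
      show "exc_divisor c d \<phi> \<subseteq> Z u0"
        unfolding exc_divisor_def
      proof (rule ideal_gen_minimal)
        show "{\<phi> p q |p q. 0 < weight c d p q} \<subseteq> Z u0"
        proof clarify
          fix s t assume w: "weight c d s t > 0"
          then have "u0 dvd u0 ^ nat (weight c d s t)" by (simp add: dvd_power)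
          then show "\<phi> s t \<in> Z u0" using monom[of s t] w by (simp add: Z_def)
        qed
      qed (auto simp: Z_def)
      have "u0 \<in> exc_divisor c d \<phi>"
        unfolding exc_divisor_def u0_def using w0 by (intro module.span_base[OF module_ser2]) force
      then show "Z u0 \<subseteq> exc_divisor c d \<phi>"
        unfolding exc_divisor_def Z_def
        by (auto elim!: dvdE simp: mult.commute[of u0] intro: ideal_gen_scale)
    qed
    finally show ?thesis .
  qed
  moreover have "\<phi> 1 0 = u ^ c"
  proof -
    \<comment> \<open>The exponent (1, 0) has weight \<open>c\<close> and j = b; likewise (0, 1)
      below has weight \<open>d\<close> and j = a.\<close>
    have "\<phi> 1 0 = u0 ^ c * h ^ b"
      using monom[of 1 0 "int b"] hpow(1)[of b] by (simp add: weight_def)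
    also have "\<dots> = u ^ c" by (simp add: u_def power_mult_distrib \<eta>(1)[symmetric] power_mult[symmetric] mult.commute)
    finally show ?thesis .
  qed
  moreover have "\<phi> 0 1 = u ^ d * (const2 (1 / r) + v)"
  proof -
    have "\<phi> 0 1 = u0 ^ d * h ^ a"
      using monom[of 0 1 "int a"] hpow(1)[of a] by (simp add: weight_def)
    \<comment> \<open>The inserted factor 1 raises the exponent of \<eta> from c a to c a + 1 = d b,
      which completes u0^d to u^d.\<close>
    also have "\<dots> = u0 ^ d * (\<eta> ^ (c * a) * (\<eta> * \<eta>i))"
      by (simp add: \<eta>i \<eta>(1)[symmetric] power_mult)
    also have "\<dots> = u0 ^ d * \<eta> ^ (d * b) * \<eta>i" by (simp only: ab power_add power_one_right mult.assoc)
    also have "\<dots> = u ^ d * (const2 (1 / r) + v)"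
      by (simp add: u_def v_def power_mult_distrib power_mult[symmetric] mult.commute[of b d])
    finally show ?thesis .
  qed
  ultimately show ?thesis using that[of u v "1 / r"] r0 by simp
qed


lemma rot_const_plus: "rot \<zeta> (fps_const \<mu> + e) = fps_const \<mu> + rot \<zeta> e"
  by (rule fps_ext) (auto simp: algebra_simps)

section \<open>The modification in a monomial chart\<close>

locale toric_chart =
  fixes x y u v :: ser2 and c d :: nat and \<phi> :: "int \<Rightarrow> int \<Rightarrow> ser2" and \<mu> :: complex
  assumes xy: "local_coords x y" and uv: "local_coords u v"
    and c: "c > 0" and d: "d > 0" and cd: "coprime c d" and \<mu>: "\<mu> \<noteq> 0"
    and \<phi>x: "\<phi> 1 0 = u ^ c" and \<phi>y: "\<phi> 0 1 = u ^ d * (const2 \<mu> + v)"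
begin

abbreviation image :: "curve \<Rightarrow> curve" where "image \<equiv> image_curve x y \<phi>"

text \<open>The value of y = u^d (\<mu> + v) along u = t^N, v = e(t), where x = t^(N c).\<close>

definition push :: "nat \<Rightarrow> complex fps \<Rightarrow> complex fps" where
  "push N e = fps_X ^ (N * d) * (fps_const \<mu> + e)"

lemma push_nth_0: "N > 0 \<Longrightarrow> push N e $ 0 = 0"
  using d by (simp add: push_def)

lemma eval1_toric_pullback:
  assumes "N > 0" "e $ 0 = 0"
  shows "eval1 (in_coords u v (toric_pullback x y \<phi> g)) (fps_X ^ N) e
    = eval1 (in_coords x y g) (fps_X ^ (N * c)) (push N e)"
proof -
  note hom = alg_hom_in_coords[OF uv]
  have m: "u ^ c \<in> mpow (Suc 0)" "u ^ d * (const2 \<mu> + v) \<in> mpow (Suc 0)"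
    using local_coords_mpow[OF uv] c d by (auto simp: mpow_Suc_0_iff)
  have "in_coords u v (toric_pullback x y \<phi> g) = subst2 (in_coords x y g) (X2 ^ c) (X2 ^ d * (const2 \<mu> + Y2))"
    unfolding toric_pullback_def \<phi>x \<phi>y alg_hom_subst2_commute[OF m hom]
    unfolding alg_homD[OF hom] in_coords_X_Y[OF uv] ..
  moreover have "X2 ^ c \<in> mpow (Suc 0)" "X2 ^ d * (const2 \<mu> + Y2) \<in> mpow (Suc 0)"
    using c d by (auto simp: mpow_Suc_0_iff simp del: fps_const_power)
  ultimately show ?thesis
    using assms by (simp add: eval1_subst2 eval1_simps power_mult push_def del: fps_const_power)
qed

lemma image_bker:
  assumes "N > 0" "e $ 0 = 0"
  shows "image (bker u v N e) = bker x y (N * c) (push N e)"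
  unfolding image_curve_def bker_def pker_def using eval1_toric_pullback[OF assms] by auto

lemma image_branch:
  assumes "branch A" "A \<noteq> Z u"
  shows "branch (image A)" "image A \<noteq> Z x"
proof -
  obtain N e where Ne: "N > 0" "e $ 0 = 0" "A = bker u v N e" using branch_cases[OF uv assms] .
  have "N * c > 0" using Ne c by simp
  then show "branch (image A)" "image A \<noteq> Z x"
    unfolding Ne(3) image_bker[OF Ne(1,2)] using bker_branch[OF xy _ push_nth_0[OF Ne(1)]] by auto
qed

text \<open>Conjugates of the image are given by \<zeta> with \<zeta>^(N c) = 1. If (\<zeta>^N)^d =
  1, Bezout forces \<zeta>^N = 1 and the difference is t^(N d) times a difference of old roots.
  Otherwise the leading terms \<mu> and \<mu> (\<zeta>^N)^d differ and the order is d/c, even for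
  two distinct branches.\<close>

lemma image_contacts:
  assumes "branch A" "A \<noteq> Z u" "branch B" "B \<noteq> Z u"
  shows "contacts x y (image A) (image B) =
    {r. r = of_nat d / of_nat c \<and> c > 1} \<union> (\<lambda>k. of_nat d / of_nat c + k / of_nat c) ` contacts u v A B"
proof -
  obtain N e f where *: "N > 0" "e $ 0 = 0" "f $ 0 = 0" "A = bker u v N e" "B = bker u v N f"
    using two_branches_cases[OF uv assms] by blast
  have Nc: "N * c > 0" using *(1) c by simp
  obtain a b :: nat where ab: "d * b = c * a + 1" using bezout_weights cd d by blast
  have rot_push: "rot \<zeta> (push N f) = fps_const ((\<zeta> ^ N) ^ d) * (fps_X ^ (N * d) * (fps_const \<mu> + rot \<zeta> f))" for \<zeta>
    unfolding push_def rot_mult_X_power rot_const_plus mult.assoc unfolding power_mult ..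
  have same: "push N e - rot \<zeta> (push N f) = fps_X ^ (N * d) * (e - rot \<zeta> f)" if "\<zeta> ^ N = 1" for \<zeta>
    unfolding rot_push that by (simp add: push_def algebra_simps)
  have sub_same: "of_nat (subdegree (push N e - rot \<zeta> (push N f))) / of_nat (N * c)
      = of_nat d / of_nat c + (of_nat (subdegree (e - rot \<zeta> f)) / of_nat N) / (of_nat c :: rat)"
    if "\<zeta> ^ N = 1" "rot \<zeta> f \<noteq> e" for \<zeta>
  proof -
    have "subdegree (push N e - rot \<zeta> (push N f)) = N * d + subdegree (e - rot \<zeta> f)"
      unfolding same[OF that(1)] using that(2) by simp
    then show ?thesis using *(1) c by (simp add: field_simps)
  qed
  have diff: "subdegree (push N e - rot \<zeta> (push N f)) = N * d" "rot \<zeta> (push N f) \<noteq> push N e"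
    if "(\<zeta> ^ N) ^ d \<noteq> 1" for \<zeta>
  proof -
    define g where "g = fps_const \<mu> + e - fps_const ((\<zeta> ^ N) ^ d) * (fps_const \<mu> + rot \<zeta> f)"
    have eq: "push N e - rot \<zeta> (push N f) = fps_X ^ (N * d) * g"
      unfolding rot_push by (simp add: push_def g_def algebra_simps)
    have "g $ 0 = \<mu> * (1 - (\<zeta> ^ N) ^ d)" using * by (simp add: g_def algebra_simps)
    then have g0: "g $ 0 \<noteq> 0" using that \<mu> by simp
    then have "g \<noteq> 0" by auto
    then show "subdegree (push N e - rot \<zeta> (push N f)) = N * d"
      unfolding eq using g0 by (simp add: subdegree_eq_0)
    have "push N e - rot \<zeta> (push N f) \<noteq> 0" unfolding eq using \<open>g \<noteq> 0\<close> by simp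
    then show "rot \<zeta> (push N f) \<noteq> push N e" by auto
  qed
  have L: "contacts x y (image A) (image B) =
      {of_nat (subdegree (push N e - g)) / of_nat (N * c) | g. g \<in> conjugates (N * c) (push N f) \<and> g \<noteq> push N e}"
    unfolding *(4,5) image_bker[OF *(1,2)] image_bker[OF *(1,3)]
    by (rule contacts_bker[OF xy Nc push_nth_0[OF *(1)] push_nth_0[OF *(1)]])
  have R: "contacts u v A B = {of_nat (subdegree (e - g)) / of_nat N | g. g \<in> conjugates N f \<and> g \<noteq> e}"
    unfolding *(4,5) by (rule contacts_bker[OF uv *(1-3)])
  show ?thesis
  proof (intro equalityI subsetI)
    fix r assume "r \<in> contacts x y (image A) (image B)"
    then obtain \<zeta> where \<zeta>: "\<zeta> ^ (N * c) = 1" "rot \<zeta> (push N f) \<noteq> push N e"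
      "r = of_nat (subdegree (push N e - rot \<zeta> (push N f))) / of_nat (N * c)"
      unfolding L conjugates_def by blast
    show "r \<in> {r. r = of_nat d / of_nat c \<and> c > 1} \<union> (\<lambda>k. of_nat d / of_nat c + k / of_nat c) ` contacts u v A B"
    proof (cases "(\<zeta> ^ N) ^ d = 1")
      case True
      have "(\<zeta> ^ N) ^ c = 1" using \<zeta>(1) by (simp add: power_mult)
      then have "\<zeta> ^ N = (\<zeta> ^ N) ^ (c * a + 1)" by (simp add: power_mult)
      also have "\<dots> = 1" unfolding ab[symmetric] using True by (simp add: power_mult)
      finally have one: "\<zeta> ^ N = 1" .
      have "rot \<zeta> f \<noteq> e" using same[OF one] \<zeta>(2) by auto
      then have "of_nat (subdegree (e - rot \<zeta> f)) / of_nat N \<in> contacts u v A B"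
        unfolding R conjugates_def using one by blast
      then show ?thesis unfolding \<zeta>(3) sub_same[OF one \<open>rot \<zeta> f \<noteq> e\<close>] by blast
    next
      case False
      have "c \<noteq> 1" using False \<zeta>(1) by auto
      moreover have "r = of_nat d / of_nat c" unfolding \<zeta>(3) diff(1)[OF False] using *(1) by simp
      ultimately show ?thesis using c by auto
    qed
  next
    fix r assume "r \<in> {r. r = of_nat d / of_nat c \<and> c > 1} \<union> (\<lambda>k. of_nat d / of_nat c + k / of_nat c) ` contacts u v A B"
    then consider "r = of_nat d / of_nat c" "c > 1"
      | k where "r = of_nat d / of_nat c + k / of_nat c" "k \<in> contacts u v A B" by blast
    then show "r \<in> contacts x y (image A) (image B)"
    proof cases
      case 1
      \<comment> \<open>A primitive c-th root of unity has a nontrivial d-th power, as c > 1 is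
        prime to \<open>d\<close>; this realizes the order d/c.\<close>
      obtain \<omega> :: complex where \<omega>: "\<omega> ^ c = 1" "\<And>i. \<omega> ^ i = 1 \<longleftrightarrow> c dvd i"
        using primitive_root_of_unity[OF c] by blast
      have "\<not> c dvd d" using cd 1(2) by (metis coprime_absorb_left nat_neq_iff nat_dvd_1_iff_1)
      obtain \<zeta> where \<zeta>: "\<zeta> ^ N = \<omega>" using complex_nth_root_exists[OF *(1)] by blast
      have ne: "(\<zeta> ^ N) ^ d \<noteq> 1" using \<zeta> \<omega>(2) \<open>\<not> c dvd d\<close> by simp
      have "\<zeta> ^ (N * c) = 1" using \<zeta> \<omega>(1) by (simp add: power_mult)
      then have "of_nat (subdegree (push N e - rot \<zeta> (push N f))) / of_nat (N * c) \<in> contacts x y (image A) (image B)"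
        unfolding L conjugates_def using diff(2)[OF ne] by blast
      then show ?thesis unfolding diff(1)[OF ne] 1(1) using *(1) by simp
    next
      case 2
      then obtain \<zeta> where \<zeta>: "\<zeta> ^ N = 1" "rot \<zeta> f \<noteq> e" "k = of_nat (subdegree (e - rot \<zeta> f)) / of_nat N"
        unfolding R conjugates_def by blast
      have "\<zeta> ^ (N * c) = 1" using \<zeta>(1) by (simp add: power_mult)
      moreover have "rot \<zeta> (push N f) \<noteq> push N e"
      proof
        assume "rot \<zeta> (push N f) = push N e"
        then have "fps_X ^ (N * d) * (e - rot \<zeta> f) = 0" using same[OF \<zeta>(1)] by simp
        then show False using \<zeta>(2) by simp
      qed
      ultimately have "of_nat (subdegree (push N e - rot \<zeta> (push N f))) / of_nat (N * c) \<in> contacts x y (image A) (image B)"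
        unfolding L conjugates_def by blast
      then show ?thesis unfolding sub_same[OF \<zeta>(1,2)] 2(1) \<zeta>(3) .
    qed
  qed
qed

text \<open>\<open>g\<close> is an equation of the image of the branch defined by \<open>p\<close>.
  It is not divisible by \<open>x\<close>, since x = t^(N c) does not vanish on that image.\<close>

lemma prime_pullback_witness:
  assumes "prime_elem p" "\<not> X2 dvd p"
  obtains g where "\<not> x dvd g" "p dvd in_coords u v (toric_pullback x y \<phi> g)"
proof -
  obtain N e where Ne: "N > 0" "e $ 0 = 0" "Z p = pker N e"
    using irreducible_cases[OF prime_elem_imp_irreducible_idom[OF assms(1)] assms(2)] .
  have Nc: "N * c > 0" using Ne(1) c by simp
  obtain P where P: "pker (N * c) (push N e) = Z P" "prime_elem P"
    using pker_prime[OF Nc push_nth_0[OF Ne(1)]] .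
  have "X2 \<notin> pker (N * c) (push N e)"
    using Nc push_nth_0[OF Ne(1)] by (simp add: pker_def eval1_simps)
  then have nd: "\<not> P dvd X2" using P(1) by (simp add: Z_def)
  have "\<not> X2 dvd P"
  proof
    assume "X2 dvd P"
    then have "Z P = Z X2"
      using irreducible_dvd_imp_Z_eq prime_elem_imp_irreducible_idom[OF P(2)] prime_elem_not_unit[OF X2_prime] by blast
    moreover have "X2 \<in> Z X2" by (simp add: Z_def)
    ultimately have "X2 \<in> Z P" by (simp only:)
    then show False using nd by (simp add: Z_def)
  qed
  then have "\<not> x dvd subst2 P x y"
    using in_coords_dvd_iff[OF xy, of x "subst2 P x y"] by (simp add: in_coords_X_Y[OF xy] in_coords_subst2[OF xy])
  moreover have "p dvd in_coords u v (toric_pullback x y \<phi> (subst2 P x y))"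
  proof -
    have "P \<in> pker (N * c) (push N e)" unfolding P(1) by (simp add: Z_def)
    then have "in_coords u v (toric_pullback x y \<phi> (subst2 P x y)) \<in> pker N e"
      unfolding pker_def using eval1_toric_pullback[OF Ne(1,2)] by (simp add: in_coords_subst2[OF xy])
    then show ?thesis unfolding Ne(3)[symmetric] by (simp add: Z_def)
  qed
  ultimately show ?thesis using that by blast
qed

text \<open>The product of the witnesses for the prime factors of an equation of \<open>D\<close>
  lies in the contracted ideal and is not divisible by the prime \<open>x\<close>. Thus every branch
  of the image has Newton-Puiseux roots, which the lemmas on trees rely on.\<close>

lemma root_not_branch_of_image:
  assumes "reduced_curve D" "Z u \<notin> branches_of D"
  shows "Z x \<notin> branches_of (image D)"
proof
  assume "Z x \<in> branches_of (image D)"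
  then have sub: "image D \<subseteq> Z x" by (simp add: branches_of_def)
  obtain f where f: "D = Z f" using assms(1) by (auto simp: reduced_curve_def)
  have "prime_elem u" "prime_elem x"
    using prime_elem_subst2[OF uv X2_prime] prime_elem_subst2[OF xy X2_prime]
      local_coords_mpow[OF uv] local_coords_mpow[OF xy] by (simp_all add: subst2_X)
  then have "branch (Z u)" unfolding branch_def using prime_elem_imp_irreducible_idom by blast
  then have "\<not> u dvd f" using assms(2) f dvd_trans by (auto simp: branches_of_def Z_def)
  then have "\<not> X2 dvd in_coords u v f"
    using in_coords_dvd_iff[OF uv, of u f] by (simp add: in_coords_X_Y[OF uv])
  then obtain w ps where wps: "in_coords u v f = w * prod_list ps" "w dvd 1" "\<forall>p\<in>set ps. prime_elem p"
    using prime_factorization_exists[of "in_coords u v f"] by metis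
  have "p dvd prod_list ps" if "p \<in> set ps" for p using that by (induction ps) auto
  then have "p dvd in_coords u v f" if "p \<in> set ps" for p using that unfolding wps(1) by (intro dvd_mult) auto
  then have np: "\<forall>p\<in>set ps. \<not> X2 dvd p"
    using \<open>\<not> X2 dvd in_coords u v f\<close> dvd_trans by blast
  have hom: "toric_pullback x y \<phi> (g * h) = toric_pullback x y \<phi> g * toric_pullback x y \<phi> h"
    "toric_pullback x y \<phi> 1 = 1" for g h
  proof -
    have m: "\<phi> 1 0 \<in> mpow (Suc 0)" "\<phi> 0 1 \<in> mpow (Suc 0)"
      unfolding \<phi>x \<phi>y using local_coords_mpow[OF uv] c d by (auto simp: mpow_Suc_0_iff)
    show "toric_pullback x y \<phi> (g * h) = toric_pullback x y \<phi> g * toric_pullback x y \<phi> h"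
      by (simp add: toric_pullback_def alg_homD[OF alg_hom_in_coords[OF xy]] subst2_mult[OF m])
    show "toric_pullback x y \<phi> 1 = 1"
      by (simp add: toric_pullback_def alg_homD[OF alg_hom_in_coords[OF xy]] alg_homD(5)[OF alg_hom_subst2[OF m]])
  qed
  have "\<exists>g. \<not> x dvd g \<and> prod_list ps dvd in_coords u v (toric_pullback x y \<phi> g)"
    using wps(3) np
  proof (induction ps)
    case Nil
    have "\<not> x dvd 1" by (rule coord_not_unit[OF xy])
    then show ?case by (intro exI[of _ 1]) simp
  next
    case (Cons p ps)
    obtain g where g: "\<not> x dvd g" "prod_list ps dvd in_coords u v (toric_pullback x y \<phi> g)"
      using Cons by auto
    obtain h where h: "\<not> x dvd h" "p dvd in_coords u v (toric_pullback x y \<phi> h)"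
      using prime_pullback_witness[of p] Cons.prems by auto
    have "\<not> x dvd h * g" using \<open>prime_elem x\<close> g(1) h(1) by (auto simp: prime_elem_def)
    moreover have "prod_list (p # ps) dvd in_coords u v (toric_pullback x y \<phi> (h * g))"
      using g(2) h(2) by (simp add: hom alg_homD[OF alg_hom_in_coords[OF uv]] mult_dvd_mono)
    ultimately show ?case by blast
  qed
  then obtain g where g: "\<not> x dvd g" "prod_list ps dvd in_coords u v (toric_pullback x y \<phi> g)" by blast
  obtain w' where w': "1 = w * w'" using wps(2) by (elim dvdE)
  have "in_coords u v f dvd in_coords u v (toric_pullback x y \<phi> g)"
  proof -
    obtain k where "in_coords u v (toric_pullback x y \<phi> g) = prod_list ps * k" using g(2) by (elim dvdE)
    then have "in_coords u v (toric_pullback x y \<phi> g) = prod_list ps * k * (w * w')" by (simp flip: w')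
    then have "in_coords u v (toric_pullback x y \<phi> g) = in_coords u v f * (w' * k)"
      by (simp add: wps(1) mult_ac)
    then show ?thesis by (rule dvdI)
  qed
  then have "g \<in> image D" by (simp add: image_curve_def f Z_def in_coords_dvd_iff[OF uv])
  then show False using sub g(1) by (auto simp: Z_def)
qed

lemma image_in_branches_of:
  assumes "A \<in> branches_of D" "A \<noteq> Z u"
  shows "image A \<in> branches_of (image D)"
proof -
  have "image D \<subseteq> image A" using assms(1) by (auto simp: branches_of_def image_curve_def)
  then show ?thesis using assms image_branch(1)[of A] by (simp add: branches_of_def)
qed

end

section \<open>Index and contact complexity\<close>

definition den :: "rat \<Rightarrow> nat" where
  "den r = nat (snd (quotient_of r))"

lemma den_pos: "den r > 0"
  using quotient_of_denom_pos'[of r] by (simp add: den_def)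

lemma den_nonzero [simp]: "den r \<noteq> 0"
  using den_pos[of r] by simp

text \<open>Turns divisibility by a denominator into integrality, so that an \<open>Lcm\<close> of
  denominators can be recognized by its multiples.\<close>

lemma den_dvd_iff: "den r dvd n \<longleftrightarrow> of_nat n * r \<in> \<int>"
proof -
  obtain p q where pq: "quotient_of r = (p, q)" by (cases "quotient_of r")
  have q: "q > 0" "coprime p q" "r = of_int p / of_int q"
    using pq quotient_of_denom_pos quotient_of_coprime quotient_of_div by blast+
  have "of_nat n * r \<in> \<int> \<longleftrightarrow> q dvd int n * p"
  proof
    assume "of_nat n * r \<in> \<int>"
    then obtain m where "of_nat n * r = of_int m" by (elim Ints_cases)
    then have "(of_int (int n * p) :: rat) = of_int (q * m)" using q by (simp add: field_simps)
    then have "int n * p = q * m" using of_int_eq_iff by blast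
    then show "q dvd int n * p" by simp
  next
    assume "q dvd int n * p"
    then obtain m where "int n * p = q * m" by (elim dvdE)
    then have "(of_int (int n * p) :: rat) = of_int (q * m)" by simp
    moreover have "of_nat n * r = of_int (int n * p) / of_int q" using q(3) by simp
    ultimately have "of_nat n * r = of_int m" using q(1) by simp
    then show "of_nat n * r \<in> \<int>" by simp
  qed
  also have "\<dots> \<longleftrightarrow> q dvd int n" using q(2) by (simp add: coprime_dvd_mult_left_iff coprime_commute)
  also have "\<dots> \<longleftrightarrow> den r dvd n" using q(1) by (simp add: den_def pq nat_dvd_iff)
  finally show ?thesis by simp
qed

text \<open>The index as a function of a set of exponents, so that the effect of the modification is
  computed without reference to curves.\<close>

definition index_below :: "rat set \<Rightarrow> ennreal \<Rightarrow> nat" where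
  "index_below S e = Lcm (den ` {r \<in> S. ennreal (of_rat r) < e})"

lemma index_at_eq: "index_at x y A = index_below (char_exponents x y A)"
  unfolding index_at_def index_below_def den_def by (rule ext, rule arg_cong[of _ _ Lcm]) auto

lemma index_below_pos: "finite S \<Longrightarrow> index_below S e > 0"
  unfolding index_below_def by (rule gr0I) (auto dest: sym)

lemma index_below_le: "finite S \<Longrightarrow> index_below S e \<le> index_below S top"
proof (rule dvd_imp_le)
  show "index_below S e dvd index_below S top"
    unfolding index_below_def by (rule Lcm_subset) (auto simp: less_top[symmetric])
qed (rule index_below_pos)

definition shift_exps :: "nat \<Rightarrow> nat \<Rightarrow> rat set \<Rightarrow> rat set" where
  "shift_exps c d S = {r. r = of_nat d / of_nat c \<and> c > 1} \<union> (\<lambda>k. of_nat d / of_nat c + k / of_nat c) ` S"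

definition shift_exponent :: "nat \<Rightarrow> nat \<Rightarrow> ennreal \<Rightarrow> ennreal" where
  "shift_exponent c d e = 1 / of_nat c * e + of_nat d / of_nat c"

lemma of_nat_div_ennreal: "c > 0 \<Longrightarrow> (of_nat d / of_nat c :: ennreal) = ennreal (real d / real c)"
  by (simp add: ennreal_of_nat_eq_real_of_nat divide_ennreal)

lemma shift_exponent_ennreal:
  assumes "c > 0" "t \<ge> 0"
  shows "shift_exponent c d (ennreal t) = ennreal (real d / real c + t / real c)"
proof -
  have "shift_exponent c d (ennreal t) = ennreal (real 1 / real c) * ennreal t + ennreal (real d / real c)"
    unfolding shift_exponent_def using of_nat_div_ennreal[OF assms(1), of 1] of_nat_div_ennreal[OF assms(1), of d] by simp
  also have "\<dots> = ennreal (real 1 / real c * t + real d / real c)"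
    using assms by (simp add: ennreal_mult[symmetric] ennreal_plus[symmetric] del: ennreal_plus)
  finally show ?thesis by (simp add: add.commute)
qed

lemma shift_exponent_top: "c > 0 \<Longrightarrow> shift_exponent c d top = top"
  using of_nat_div_ennreal[of c 1] by (simp add: shift_exponent_def ennreal_mult_top)

lemma ennreal_cases_top:
  obtains "e = top" | t where "t \<ge> 0" "e = ennreal t"
  by (cases e) auto

lemma shift_less_iff:
  assumes "c > 0" "k \<ge> (0 :: rat)"
  shows "ennreal (of_rat (of_nat d / of_nat c + k / of_nat c)) < shift_exponent c d e \<longleftrightarrow> ennreal (of_rat k) < e"
proof (cases e rule: ennreal_cases_top)
  case 1
  then show ?thesis using shift_exponent_top[OF assms(1)] by simp
next
  case (2 t)
  have k: "(of_rat k :: real) \<ge> 0" using assms by simp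
  have "(of_rat (of_nat d / of_nat c + k / of_nat c) :: real) = real d / real c + of_rat k / real c"
    by (simp add: of_rat_add of_rat_divide)
  then show ?thesis
    using 2 k assms(1) by (simp add: shift_exponent_ennreal ennreal_less_iff divide_less_cancel)
qed

lemma shift_less_iff_0:
  assumes "c > 0"
  shows "ennreal (of_rat (of_nat d / of_nat c)) < shift_exponent c d e \<longleftrightarrow> e > 0"
  using shift_less_iff[OF assms, of 0 d e] by simp

text \<open>Both sides have the same multiples \<open>m\<close>. The exponent d/c forces
  \<open>c\<close> to divide \<open>m\<close>; with m = c m', the number m (d + k)/c = m' d + m' k
  is an integer iff m' k is. At e = 0 the exponent d/c is not strictly below the shifted point, so
  for c > 1 the factor \<open>c\<close> would be missing.\<close>

lemma index_below_shift:
  assumes "c > 0" "coprime c d" "\<And>k. k \<in> S \<Longrightarrow> k > 0" "e > 0 \<or> c = 1"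
  shows "index_below (shift_exps c d S) (shift_exponent c d e) = c * index_below S e"
proof -
  define S' where "S' = {r \<in> S. ennreal (of_rat r) < e}"
  have T: "{r \<in> shift_exps c d S. ennreal (of_rat r) < shift_exponent c d e} =
     {r. r = of_nat d / of_nat c \<and> c > 1} \<union> (\<lambda>k. of_nat d / of_nat c + k / of_nat c) ` S'"
    using assms(3,4) shift_less_iff[OF assms(1)] shift_less_iff_0[OF assms(1), of d e]
    unfolding shift_exps_def S'_def by (auto simp: less_imp_le)
  have "index_below (shift_exps c d S) (shift_exponent c d e) dvd m \<longleftrightarrow> c * index_below S e dvd m" for m
  proof -
    have L: "index_below (shift_exps c d S) (shift_exponent c d e) dvd m \<longleftrightarrow>
      (c > 1 \<longrightarrow> of_nat m * (of_nat d / of_nat c :: rat) \<in> \<int>) \<and>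
      (\<forall>k\<in>S'. of_nat m * (of_nat d / of_nat c + k / of_nat c) \<in> \<int>)"
      unfolding index_below_def T Lcm_dvd_iff by (auto simp: den_dvd_iff)
    have c1: "(c > 1 \<longrightarrow> of_nat m * (of_nat d / of_nat c :: rat) \<in> \<int>) \<longleftrightarrow> c dvd m"
    proof (cases "c = 1")
      case False
      have "of_nat m * (of_nat d / of_nat c :: rat) = of_nat (m * d) / of_nat c" by simp
      then have "of_nat m * (of_nat d / of_nat c :: rat) \<in> \<int> \<longleftrightarrow> c dvd m * d"
        using of_int_div_of_int_in_Ints_iff[of "int (m * d)" "int c", where 'a = rat] assms(1)
        by (simp del: of_nat_mult flip: of_nat_mult)
      then show ?thesis using False assms(1,2) by (simp add: coprime_dvd_mult_left_iff)
    qed simp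
    show ?thesis
    proof (cases "c dvd m")
      case True
      then obtain m' where m': "m = c * m'" by (elim dvdE)
      have "of_nat m * (of_nat d / of_nat c + k / of_nat c) \<in> \<int> \<longleftrightarrow> den k dvd m'" for k :: rat
      proof -
        have "of_nat m * (of_nat d / of_nat c + k / of_nat c) = of_int (int (m' * d)) + of_nat m' * k"
          using assms(1) by (simp add: m' field_simps)
        then show ?thesis unfolding den_dvd_iff by (metis Ints_add Ints_diff Ints_of_int add_diff_cancel_left')
      qed
      then show ?thesis
        unfolding L c1 using True assms(1) by (simp add: m' index_below_def Lcm_dvd_iff S'_def)
    next
      case False
      then show ?thesis unfolding L c1 using dvd_mult_left by blast
    qed
  qed
  then show ?thesis by (meson dvd_antisym dvd_refl)
qed

text \<open>Shifted exponents are at least d/c, and the index only sees those strictly below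
  \<open>t\<close>, so it is 1 up to and including the image of the root.\<close>

lemma index_below_shift_initial:
  assumes "c > 0" "\<And>k. k \<in> S \<Longrightarrow> k > 0" "t \<le> real d / real c"
  shows "index_below (shift_exps c d S) (ennreal t) = 1"
proof -
  have "\<not> ennreal (of_rat r) < ennreal t" if "r \<in> shift_exps c d S" for r
  proof -
    have "r \<ge> of_nat d / of_nat c" using that assms(1,2) by (auto simp: shift_exps_def intro: less_imp_le)
    then have "(of_rat r :: real) \<ge> of_rat (of_nat d / of_nat c)" by (simp add: of_rat_less_eq)
    then have "(of_rat r :: real) \<ge> t" using assms(3) by (simp add: of_rat_divide)
    then show ?thesis by (simp add: not_less ennreal_leI)
  qed
  then have "{r \<in> shift_exps c d S. ennreal (of_rat r) < ennreal t} = {}" by blast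
  then show ?thesis by (simp only: index_below_def image_empty Lcm_empty)
qed

section \<open>Contact complexity as an integral\<close>

definition contact_below :: "rat set \<Rightarrow> ennreal \<Rightarrow> ennreal" where
  "contact_below S e =
     (\<integral>\<^sup>+ t. indicator {t. 0 \<le> t \<and> ennreal t \<le> e} t / of_nat (index_below S (ennreal t)) \<partial>lborel)"

lemma contact_at_eq: "contact_at x y A = contact_below (char_exponents x y A)"
  by (rule ext) (simp add: contact_at_def contact_below_def index_at_eq)

definition contact_density :: "rat set \<Rightarrow> real \<Rightarrow> ennreal" where
  "contact_density S t = ennreal (1 / real (index_below S (ennreal t)))"

text \<open>One more exponent changes the index only on a half line, by an lcm.\<close>

lemma measurable_index_below:
  assumes "finite S"
  shows "(\<lambda>t. index_below S (ennreal t)) \<in> measurable borel (count_space UNIV)"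
  using assms
proof (induction S rule: finite_induct)
  case empty
  then show ?case by (simp add: index_below_def)
next
  case (insert r S)
  have "index_below (insert r S) (ennreal t) =
      (if ennreal (of_rat r) < ennreal t then lcm (den r) (index_below S (ennreal t)) else index_below S (ennreal t))" for t
  proof -
    have "{s \<in> insert r S. ennreal (of_rat s) < ennreal t} =
      (if ennreal (of_rat r) < ennreal t then insert r {s \<in> S. ennreal (of_rat s) < ennreal t}
       else {s \<in> S. ennreal (of_rat s) < ennreal t})" by auto
    then show ?thesis by (simp add: index_below_def)
  qed
  moreover have "(\<lambda>t. lcm (den r) (index_below S (ennreal t))) \<in> measurable borel (count_space UNIV)"
    by (rule measurable_compose[OF insert.IH]) simp
  ultimately show ?case using insert.IH by (simp add: measurable_If)
qed

lemma measurable_contact_density [measurable]: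
  assumes "finite S"
  shows "contact_density S \<in> borel_measurable borel"
proof -
  have "(\<lambda>n. ennreal (1 / real n)) \<in> measurable (count_space UNIV) borel" by simp
  from measurable_compose[OF measurable_index_below[OF assms] this] show ?thesis
    unfolding contact_density_def[abs_def] .
qed

lemma contact_below_eq:
  assumes "finite S"
  shows "contact_below S e = (\<integral>\<^sup>+ t. contact_density S t * indicator {t. 0 \<le> t \<and> ennreal t \<le> e} t \<partial>lborel)"
proof -
  have "1 / (of_nat n :: ennreal) = ennreal (1 / real n)" if "n > 0" for n
    using of_nat_div_ennreal[OF that, of 1] by simp
  then show ?thesis
    unfolding contact_below_def contact_density_def using index_below_pos[OF assms]
    by (intro nn_integral_cong) (auto simp: indicator_def)
qed

lemma contact_density_bounds:
  assumes "finite S"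
  shows "contact_density S t \<le> 1" "contact_density S t \<ge> ennreal (1 / real (index_below S top))"
proof -
  have "0 < index_below S (ennreal t)" "index_below S (ennreal t) \<le> index_below S top"
    using index_below_pos[OF assms] index_below_le[OF assms] by blast+
  then show "contact_density S t \<le> 1" "contact_density S t \<ge> ennreal (1 / real (index_below S top))"
    unfolding contact_density_def by (auto intro!: ennreal_leI frac_le simp: ennreal_le_1)
qed

text \<open>The density is at least \<delta>, the inverse of the index at infinity, so an interval
  of length b - a adds at least \<delta> (b - a). Strictness also uses that the smaller integral is
  finite.\<close>

lemma contact_below_strict_mono:
  assumes "finite S" "e < e'"
  shows "contact_below S e < contact_below S e'"
proof -
  obtain a where a: "a \<ge> 0" "e = ennreal a" using assms(2) by (cases e rule: ennreal_cases_top) auto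
  obtain b where b: "a < b" "ennreal b \<le> e'"
  proof (cases e' rule: ennreal_cases_top)
    case 1
    then show ?thesis using that[of "a + 1"] by simp
  next
    case (2 t)
    then show ?thesis using that[of t] a assms(2) by (simp add: ennreal_less_iff)
  qed
  define \<delta> where "\<delta> = 1 / real (index_below S top)"
  have "\<delta> > 0" using index_below_pos[OF assms(1), of top] by (simp add: \<delta>_def)
  have "contact_below S e \<le> (\<integral>\<^sup>+ t. indicator {0..a} t \<partial>lborel)"
    unfolding contact_below_eq[OF assms(1)]
    using contact_density_bounds(1)[OF assms(1)] a by (intro nn_integral_mono) (auto simp: indicator_def)
  also have "\<dots> = ennreal a" using a by simp
  finally have fin: "contact_below S e < top" by (rule le_less_trans) simp
  have eq: "contact_density S t * indicator {t. 0 \<le> t \<and> ennreal t \<le> e} t = contact_density S t * indicator {0..a} t" for t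
    using a by (auto simp: indicator_def)
  have "contact_below S e + ennreal (\<delta> * (b - a)) =
      (\<integral>\<^sup>+ t. contact_density S t * indicator {0..a} t \<partial>lborel) + (\<integral>\<^sup>+ t. ennreal \<delta> * indicator {a<..b} t \<partial>lborel)"
    unfolding contact_below_eq[OF assms(1)] eq
    using b \<open>\<delta> > 0\<close> by (simp add: nn_integral_cmult ennreal_mult)
  also have "\<dots> = (\<integral>\<^sup>+ t. contact_density S t * indicator {0..a} t + ennreal \<delta> * indicator {a<..b} t \<partial>lborel)"
    using measurable_contact_density[OF assms(1)] by (intro nn_integral_add[symmetric]) simp_all
  also have "\<dots> \<le> contact_below S e'"
    unfolding contact_below_eq[OF assms(1)]
  proof (rule nn_integral_mono)
    fix t :: real
    have "ennreal t \<le> e'" if "t \<le> b" using that b(2) ennreal_leI order_trans by blast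
    then show "contact_density S t * indicator {0..a} t + ennreal \<delta> * indicator {a<..b} t
      \<le> contact_density S t * indicator {t. 0 \<le> t \<and> ennreal t \<le> e'} t"
      using contact_density_bounds(2)[OF assms(1), of t] a b by (auto simp: indicator_def \<delta>_def)
  qed
  finally have le: "contact_below S e + ennreal (\<delta> * (b - a)) \<le> contact_below S e'" .
  have "contact_below S e + 0 < contact_below S e + ennreal (\<delta> * (b - a))"
    unfolding ennreal_add_left_cancel_less using fin b \<open>\<delta> > 0\<close> by (simp add: ennreal_less_zero_iff less_top[symmetric])
  then have "contact_below S e < contact_below S e + ennreal (\<delta> * (b - a))" by (simp only: add_0_right)
  then show ?thesis using le by (rule less_le_trans)
qed

lemma contact_below_inject:
  "finite S \<Longrightarrow> contact_below S e = contact_below S e' \<longleftrightarrow> e = e'"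
  using contact_below_strict_mono[of S e e'] contact_below_strict_mono[of S e' e] by (metis linorder_less_linear less_irrefl)

lemma finite_shift_exps: "finite S \<Longrightarrow> finite (shift_exps c d S)"
  by (simp add: shift_exps_def)

lemma contact_density_shift:
  assumes "c > 0" "coprime c d" "\<And>k. k \<in> S \<Longrightarrow> k > 0" "t > 0"
  shows "contact_density (shift_exps c d S) (real d / real c + 1 / real c * t) = ennreal (1 / real c) * contact_density S t"
proof -
  have "index_below (shift_exps c d S) (ennreal (real d / real c + t / real c)) = c * index_below S (ennreal t)"
    using index_below_shift[of c d S "ennreal t"] assms shift_exponent_ennreal[of c t d]
    by (simp add: ennreal_less_zero_iff)
  then show ?thesis
    unfolding contact_density_def by (simp add: ennreal_mult[symmetric])
qed

text \<open>The integral is split at d/c, the image of the root: before it the index is 1, beyond it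
  an affine substitution leads back to the integral for \<open>S\<close>.\<close>

lemma contact_below_shift:
  assumes c: "c > 0" and cd: "coprime c d" and S: "finite S" "\<And>k. k \<in> S \<Longrightarrow> k > 0"
  shows "contact_below (shift_exps c d S) (shift_exponent c d e)
    = 1 / of_nat c ^ 2 * contact_below S e + of_nat d / of_nat c"
proof -
  define T where "T = shift_exps c d S"
  define b where "b = real d / real c"
  define E where "E = shift_exponent c d e"
  have T: "finite T" unfolding T_def by (rule finite_shift_exps[OF S(1)])
  note [measurable] = measurable_contact_density[OF T] measurable_contact_density[OF S(1)]
  have b0: "b \<ge> 0" by (simp add: b_def)
  have E_iff: "ennreal (b + 1 / real c * t) \<le> E \<longleftrightarrow> ennreal t \<le> e" if "t \<ge> 0" for t
  proof (cases e rule: ennreal_cases_top)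
    case 1
    then show ?thesis using shift_exponent_top[OF c] by (simp add: E_def)
  next
    case (2 s)
    then show ?thesis using that c b0
      by (simp add: E_def shift_exponent_ennreal b_def ennreal_le_iff divide_le_cancel)
  qed
  have bE: "ennreal t \<le> E" if "t \<le> b" for t
  proof -
    have "ennreal (b + 1 / real c * 0) \<le> E" using E_iff[of 0] by simp
    then show ?thesis using that ennreal_leI order_trans by (metis add.right_neutral mult_zero_right)
  qed
  have "contact_below T E = (\<integral>\<^sup>+ t. contact_density T t * indicator {t. 0 \<le> t \<and> ennreal t \<le> E} t \<partial>lborel)"
    by (rule contact_below_eq[OF T])
  also have "\<dots> = (\<integral>\<^sup>+ t. indicator {0..b} t + contact_density T t * indicator {t. b < t \<and> ennreal t \<le> E} t \<partial>lborel)"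
  proof (rule nn_integral_cong)
    fix t :: real
    have "contact_density T t = 1" if "t \<le> b"
      using index_below_shift_initial[of c S t d] c S(2) that by (simp add: contact_density_def T_def b_def)
    then show "contact_density T t * indicator {t. 0 \<le> t \<and> ennreal t \<le> E} t
      = indicator {0..b} t + contact_density T t * indicator {t. b < t \<and> ennreal t \<le> E} t"
      using b0 bE by (cases "t \<le> b") (auto simp: indicator_def)
  qed
  also have "\<dots> = (\<integral>\<^sup>+ t. indicator {0..b} t \<partial>lborel) + (\<integral>\<^sup>+ t. contact_density T t * indicator {t. b < t \<and> ennreal t \<le> E} t \<partial>lborel)"
    by (intro nn_integral_add) simp_all
  also have "(\<integral>\<^sup>+ t. indicator {0..b} t \<partial>lborel) = ennreal b" using b0 by simp
  also have "(\<integral>\<^sup>+ t. contact_density T t * indicator {t. b < t \<and> ennreal t \<le> E} t \<partial>lborel)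
     = ennreal \<bar>1 / real c\<bar> * (\<integral>\<^sup>+ t. contact_density T (b + 1 / real c * t) * indicator {t. b < t \<and> ennreal t \<le> E} (b + 1 / real c * t) \<partial>lborel)"
    by (rule nn_integral_real_affine) (use c in simp_all)
  also have "(\<integral>\<^sup>+ t. contact_density T (b + 1 / real c * t) * indicator {t. b < t \<and> ennreal t \<le> E} (b + 1 / real c * t) \<partial>lborel)
     = (\<integral>\<^sup>+ t. ennreal (1 / real c) * (contact_density S t * indicator {t. 0 \<le> t \<and> ennreal t \<le> e} t) \<partial>lborel)"
  \<comment> \<open>The integrands differ at t = 0: the left indicator excludes the image of the
    root, the right one includes 0.\<close>
  proof (rule nn_integral_cong_AE)
    have "contact_density T (b + 1 / real c * t) * indicator {t. b < t \<and> ennreal t \<le> E} (b + 1 / real c * t)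
      = ennreal (1 / real c) * (contact_density S t * indicator {t. 0 \<le> t \<and> ennreal t \<le> e} t)" if "t \<noteq> 0" for t
    proof (cases "t > 0")
      case True
      have "contact_density T (b + 1 / real c * t) = ennreal (1 / real c) * contact_density S t"
        unfolding T_def b_def using contact_density_shift[of c d S t] c cd S(2) True by blast
      moreover have "indicator {t. b < t \<and> ennreal t \<le> E} (b + 1 / real c * t)
         = (indicator {t. 0 \<le> t \<and> ennreal t \<le> e} t :: ennreal)"
        using True c E_iff[of t] by (simp add: indicator_def)
      ultimately show ?thesis by (simp only: mult.assoc)
    next
      case False
      then have "t < 0" using that by simp
      then have "t / real c < 0" using c by (simp add: divide_neg_pos)
      then show ?thesis using \<open>t < 0\<close> by (simp add: indicator_def)
    qed
    then show "AE t in lborel. contact_density T (b + 1 / real c * t) * indicator {t. b < t \<and> ennreal t \<le> E} (b + 1 / real c * t)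
      = ennreal (1 / real c) * (contact_density S t * indicator {t. 0 \<le> t \<and> ennreal t \<le> e} t)"
      using AE_lborel_singleton[of "0 :: real"] by (auto elim!: eventually_mono)
  qed
  also have "\<dots> = ennreal (1 / real c) * contact_below S e"
    unfolding contact_below_eq[OF S(1)] by (rule nn_integral_cmult) simp
  finally have "contact_below T E = ennreal b + ennreal (1 / real c) * (ennreal (1 / real c) * contact_below S e)"
    using c by simp
  moreover have "1 / (of_nat c ^ 2 :: ennreal) = ennreal (1 / real c) * ennreal (1 / real c)"
  proof -
    have "1 / (of_nat c ^ 2 :: ennreal) = ennreal (real 1 / real (c ^ 2))"
      using of_nat_div_ennreal[of "c ^ 2" 1] c by simp
    then show ?thesis using c by (simp add: ennreal_mult[symmetric] power2_eq_square)
  qed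
  ultimately show ?thesis
    unfolding T_def E_def b_def using of_nat_div_ennreal[OF c, of d] by (simp add: mult.assoc add.commute)
qed

section \<open>Eggers-Wall trees\<close>

lemma image_eq_singleton: "a \<in> S \<Longrightarrow> (\<And>s. s \<in> S \<Longrightarrow> f s = c) \<Longrightarrow> f ` S = {c}"
  by auto

lemma diff_order_commute: "diff_order \<xi> \<xi>' = diff_order \<xi>' \<xi>"
proof -
  have "\<xi> r - \<xi>' r \<noteq> 0 \<longleftrightarrow> \<xi>' r - \<xi> r \<noteq> 0" for r by auto
  then show ?thesis by (simp add: diff_order_def)
qed

lemma contacts_commute: "contacts x y A B = contacts x y B A"
proof -
  have "contacts x y A B \<subseteq> contacts x y B A" for A B
  proof
    fix r assume "r \<in> contacts x y A B"
    then obtain \<xi> \<xi>' where "\<xi> \<in> np_roots x y A" "\<xi>' \<in> np_roots x y B" "\<xi> \<noteq> \<xi>'" "r = diff_order \<xi> \<xi>'"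
      unfolding contacts_def by blast
    then show "r \<in> contacts x y B A" unfolding contacts_def diff_order_commute[of \<xi>] by blast
  qed
  then show ?thesis by blast
qed

context
  fixes x y :: ser2
  assumes xy: "local_coords x y"
begin

lemma coincidence_contact:
  assumes "branch A" "A \<noteq> Z x" "branch B" "B \<noteq> Z x" "A \<noteq> B"
  shows "coincidence x y A B \<in> contacts x y A B" "\<And>r. r \<in> contacts x y A B \<Longrightarrow> r \<le> coincidence x y A B"
  using contacts_finite_pos[OF xy assms(1-4)] assms(5) by (simp_all add: coincidence_eq[OF xy assms])

lemma coincidence_commute:
  assumes "branch A" "A \<noteq> Z x" "branch B" "B \<noteq> Z x" "A \<noteq> B"
  shows "coincidence x y A B = coincidence x y B A"
  using coincidence_eq[OF xy assms] coincidence_eq[OF xy assms(3,4,1,2) not_sym[OF assms(5)]] contacts_commute by simp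

text \<open>From a root \<open>e\<close> of \<open>A\<close>, choose \<open>f1\<close> of
  \<open>B\<close> and then \<open>g1\<close> of \<open>C\<close> realizing the two coincidences: e
  - g1 is the sum of the two differences.\<close>

lemma coincidence_ultrametric:
  assumes A: "branch A" "A \<noteq> Z x" and B: "branch B" "B \<noteq> Z x" and C: "branch C" "C \<noteq> Z x"
    and "A \<noteq> B" "B \<noteq> C" "A \<noteq> C"
  shows "min (coincidence x y A B) (coincidence x y B C) \<le> coincidence x y A C"
proof -
  obtain N' e' f' where *: "N' > 0" "e' $ 0 = 0" "f' $ 0 = 0" "A = bker x y N' e'" "B = bker x y N' f'"
    using two_branches_cases[OF xy A B] by blast
  obtain M g' where g': "M > 0" "g' $ 0 = 0" "C = bker x y M g'" using branch_cases[OF xy C] .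
  define N e f g where "N = N' * M" "e = e' oo fps_X ^ M" "f = f' oo fps_X ^ M" "g = g' oo fps_X ^ N'"
  then have N: "N > 0" and 0: "e $ 0 = 0" "f $ 0 = 0" "g $ 0 = 0"
    and eq: "A = bker x y N e" "B = bker x y N f" "C = bker x y N g"
    using * g' bker_compose[of N' M e' x y] bker_compose[of N' M f' x y] bker_compose[of M N' g' x y]
    by (simp_all add: mult.commute)
  obtain f1 where f1: "coincidence x y A B = of_nat (subdegree (e - f1)) / of_nat N" "f1 \<in> conjugates N f" "f1 \<noteq> e"
    using coincidence_contact(1)[OF A B assms(7)] unfolding eq contacts_bker[OF xy N 0(1,2)] by blast
  have f1': "f1 $ 0 = 0" "B = bker x y N f1"
    using conjugates_nth_0[OF 0(2) f1(2)] bker_conjugate[OF N 0(2) f1(2)] eq(2) by simp_all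
  obtain g1 where g1: "coincidence x y B C = of_nat (subdegree (f1 - g1)) / of_nat N" "g1 \<in> conjugates N g" "g1 \<noteq> f1"
    using coincidence_contact(1)[OF B C assms(8)] unfolding f1'(2) eq(3) contacts_bker[OF xy N f1'(1) 0(3)] by blast
  have "g1 \<noteq> e"
    using bker_conjugate[OF N 0(3) g1(2), of x y] eq(1,3) assms(9) by auto
  then have "of_nat (subdegree (e - g1)) / of_nat N \<in> contacts x y A C"
    unfolding eq(1,3) contacts_bker[OF xy N 0(1,3)] using g1(2) by blast
  then have "of_nat (subdegree (e - g1)) / of_nat N \<le> coincidence x y A C"
    by (rule coincidence_contact(2)[OF A C assms(9)])
  moreover have "min (subdegree (e - f1)) (subdegree (f1 - g1)) \<le> subdegree (e - g1)"
    using subdegree_add_ge'[of "e - f1" "f1 - g1"] \<open>g1 \<noteq> e\<close> by simp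
  then have "subdegree (e - f1) \<le> subdegree (e - g1) \<or> subdegree (f1 - g1) \<le> subdegree (e - g1)" by linarith
  then have "min (of_nat (subdegree (e - f1)) / of_nat N) (of_nat (subdegree (f1 - g1)) / of_nat N)
      \<le> (of_nat (subdegree (e - g1)) / of_nat N :: rat)"
    unfolding min_le_iff_disj using N by (auto intro: divide_right_mono)
  ultimately show ?thesis unfolding f1(1) g1(1) by (rule order_trans[rotated])
qed

text \<open>
  Two roots whose difference has order \<open>k\<close> have the same coefficients below \<open>k\<close>, so each of their
  conjugations changes both at the same place if it does so below \<open>k\<close>.
\<close>

lemma char_exponents_below_coincidence:
  assumes A: "branch A" "A \<noteq> Z x" and B: "branch B" "B \<noteq> Z x" and "A \<noteq> B"
    and r: "r \<in> char_exponents x y A" "r < coincidence x y A B"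
  shows "r \<in> char_exponents x y B"
proof -
  obtain N e f where *: "N > 0" "e $ 0 = 0" "f $ 0 = 0" "A = bker x y N e" "B = bker x y N f"
    using two_branches_cases[OF xy A B] by blast
  obtain f1 where f1: "coincidence x y A B = of_nat (subdegree (e - f1)) / of_nat N" "f1 \<in> conjugates N f" "f1 \<noteq> e"
    using coincidence_contact(1)[OF A B assms(5)] unfolding *(4,5) contacts_bker[OF xy *(1-3)] by blast
  have f10: "f1 $ 0 = 0" "B = bker x y N f1"
    using conjugates_nth_0[OF *(3) f1(2)] bker_conjugate[OF *(1,3) f1(2)] *(5) by simp_all
  obtain \<zeta> where \<zeta>: "\<zeta> ^ N = 1" "rot \<zeta> e \<noteq> e" "r = of_nat (subdegree (e - rot \<zeta> e)) / of_nat N"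
    using r(1) unfolding char_exponents_eq *(4) contacts_bker[OF xy *(1,2,2)] conjugates_def by blast
  define m where "m = subdegree (e - rot \<zeta> e)"
  have "m < subdegree (e - f1)"
    using r(2) *(1) unfolding f1(1) \<zeta>(3) m_def by (simp add: divide_less_cancel)
  \<comment> \<open>As the inequality is strict, the coefficients agree also at \<open>m\<close>
    itself, where the conjugation first acts.\<close>
  then have same: "f1 $ i = e $ i" if "i \<le> m" for i
    using nth_less_subdegree_zero[of i "e - f1"] that by simp
  have "subdegree (f1 - rot \<zeta> f1) = m"
  proof (rule subdegreeI)
    have "(e - rot \<zeta> e) $ m \<noteq> 0" unfolding m_def using \<zeta>(2) by (intro nth_subdegree_nonzero) auto
    then show "(f1 - rot \<zeta> f1) $ m \<noteq> 0" using same[of m] by simp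
    fix i assume "i < m"
    then have "(e - rot \<zeta> e) $ i = 0" unfolding m_def by (rule nth_less_subdegree_zero)
    then show "(f1 - rot \<zeta> f1) $ i = 0" using same[of i] \<open>i < m\<close> by simp
  qed
  moreover have "rot \<zeta> f1 \<noteq> f1"
  proof
    assume "rot \<zeta> f1 = f1"
    then have "(f1 - rot \<zeta> f1) $ m = 0" by simp
    then have "(e - rot \<zeta> e) $ m = 0" using same[of m] by simp
    then show False unfolding m_def using \<zeta>(2) nth_subdegree_nonzero[of "e - rot \<zeta> e"] by auto
  qed
  ultimately show ?thesis
    unfolding char_exponents_eq f10(2) contacts_bker[OF xy *(1) f10(1,1)] conjugates_def \<zeta>(3) m_def[symmetric]
    using \<zeta>(1) by (metis (mono_tags, lifting) imageI mem_Collect_eq)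
qed

text \<open>Branches may be glued at an exponent equal to their coincidence. The index counts only
  characteristic exponents strictly below that point, hence strictly below the coincidence, and
  these are common to both branches.\<close>

lemma index_at_below_coincidence:
  assumes A: "branch A" "A \<noteq> Z x" and B: "branch B" "B \<noteq> Z x" and "A \<noteq> B"
    and e: "e \<le> ennreal (of_rat (coincidence x y A B))"
  shows "index_at x y A e = index_at x y B e"
proof -
  have less: "r < coincidence x y A B" if "ennreal (of_rat r) < e" for r
  proof -
    have "ennreal (of_rat r) < ennreal (of_rat (coincidence x y A B))" using that e by (rule less_le_trans)
    then have "(of_rat r :: real) < of_rat (coincidence x y A B)" using ennreal_leI by (metis linorder_not_less)
    then show ?thesis by (simp add: of_rat_less)
  qed
  have "{r \<in> char_exponents x y A. ennreal (of_rat r) < e} = {r \<in> char_exponents x y B. ennreal (of_rat r) < e}"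
    using char_exponents_below_coincidence[OF A B assms(5)]
      char_exponents_below_coincidence[OF B A not_sym[OF assms(5)]]
      coincidence_commute[OF A B assms(5)] less by auto
  then show ?thesis by (simp add: index_at_eq index_below_def)
qed

context
  fixes D :: curve
  assumes D: "Z x \<notin> branches_of D"
begin

lemma branches_ofD: "A \<in> branches_of D \<Longrightarrow> branch A \<and> A \<noteq> Z x"
  using D by (auto simp: branches_of_def)

text \<open>Transitivity of the gluing is the ultrametric inequality for coincidences.\<close>

lemma equiv_ew_glue: "equiv (branches_of D \<times> UNIV) (ew_glue x y D)"
proof (rule equivI)
  show "ew_glue x y D \<subseteq> (branches_of D \<times> UNIV) \<times> (branches_of D \<times> UNIV)" by (auto simp: ew_glue_def)
  show "refl_on (branches_of D \<times> UNIV) (ew_glue x y D)" by (auto simp: refl_on_def ew_glue_def)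
  show "sym (ew_glue x y D)"
  proof (rule symI)
    fix p q assume "(p, q) \<in> ew_glue x y D"
    then obtain A B e where AB: "p = (A, e)" "q = (B, e)" "A \<in> branches_of D" "B \<in> branches_of D"
      "A = B \<or> e \<le> ennreal (of_rat (coincidence x y A B))"
      unfolding ew_glue_def by blast
    then have "B = A \<or> e \<le> ennreal (of_rat (coincidence x y B A))"
      using coincidence_commute[of A B] branches_ofD by metis
    then show "(q, p) \<in> ew_glue x y D" unfolding AB(1,2) ew_glue_def using AB(3,4) by blast
  qed
  show "trans (ew_glue x y D)"
  proof (rule transI)
    fix p q r assume "(p, q) \<in> ew_glue x y D" "(q, r) \<in> ew_glue x y D"
    then obtain A B C e where pqr: "p = (A, e)" "q = (B, e)" "r = (C, e)"
      and br: "A \<in> branches_of D" "B \<in> branches_of D" "C \<in> branches_of D"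
      and AB: "A = B \<or> e \<le> ennreal (of_rat (coincidence x y A B))"
      and BC: "B = C \<or> e \<le> ennreal (of_rat (coincidence x y B C))"
      unfolding ew_glue_def by blast
    have "e \<le> ennreal (of_rat (coincidence x y A C))" if AC: "A \<noteq> C"
    proof (cases "A = B \<or> B = C")
      case True
      then show ?thesis using AB BC AC by metis
    next
      case False
      define k where "k = min (coincidence x y A B) (coincidence x y B C)"
      have "k \<le> coincidence x y A C"
        unfolding k_def using coincidence_ultrametric[of A B C] branches_ofD br False AC by blast
      then have "ennreal (of_rat k) \<le> ennreal (of_rat (coincidence x y A C))"
        by (intro ennreal_leI) (simp add: of_rat_less_eq)
      moreover have "e \<le> ennreal (of_rat k)"
        using AB BC False unfolding k_def min_def by presburger
      ultimately show ?thesis by (rule order_trans[rotated])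
    qed
    then show "(p, r) \<in> ew_glue x y D" unfolding pqr ew_glue_def using br by blast
  qed
qed

lemma ew_class_mem: "A \<in> branches_of D \<Longrightarrow> (A, e) \<in> ew_glue x y D `` {(A, e)}"
  by (auto simp: ew_glue_def)

lemma ew_exponent_class:
  assumes "A \<in> branches_of D"
  shows "ew_exponent (ew_glue x y D `` {(A, e)}) = e"
proof -
  have "snd ` (ew_glue x y D `` {(A, e)}) = {e}"
    by (rule image_eq_singleton[OF ew_class_mem[OF assms, of e]]) (auto simp: ew_glue_def)
  then show ?thesis by (simp add: ew_exponent_def)
qed

lemma ew_index_class:
  assumes "A \<in> branches_of D"
  shows "ew_index x y (ew_glue x y D `` {(A, e)}) = index_at x y A e"
proof -
  have "index_at x y B e' = index_at x y A e" if "(B, e') \<in> ew_glue x y D `` {(A, e)}" for B e'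
  proof -
    have "A \<in> branches_of D" "B \<in> branches_of D" "e' = e"
      "A = B \<or> e \<le> ennreal (of_rat (coincidence x y A B))"
      using that unfolding ew_glue_def by auto
    then show ?thesis using index_at_below_coincidence[of A B e] branches_ofD by metis
  qed
  then have "(\<lambda>(B, e'). index_at x y B e') ` (ew_glue x y D `` {(A, e)}) = {index_at x y A e}"
    by (intro image_eq_singleton[OF ew_class_mem[OF assms, of e]]) auto
  then show ?thesis by (simp add: ew_index_def)
qed

end

end

text \<open>The class of (A, e) is sent to that of (\<open>image A\<close>,
  \<open>shift_exponent c d e\<close>), and both relations are read off on representatives. The
  monomial chart serves to compute contacts, which are then carried over to the given coordinates by
  \<open>contacts_coords\<close>.\<close>

lemma (in toric_chart) image_trees:
  assumes x'y': "local_coords x' y'" "Z x' = Z x" and u'v': "local_coords u' v'" "Z u' = Z u"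
    and D: "reduced_curve D" "Z u \<notin> branches_of D"
    and Q: "Q \<in> ew_tree u' v' D"
  defines "\<iota> \<equiv> natural_embedding c d image u' v' x' y' D"
  shows "\<iota> Q \<in> ew_tree x' y' (image D)"
    "ew_exponent Q \<noteq> 0 \<or> c = 1 \<Longrightarrow> ew_index x' y' (\<iota> Q) = c * ew_index u' v' Q"
    "ew_exponent (\<iota> Q) = 1 / of_nat c * ew_exponent Q + of_nat d / of_nat c"
proof -
  have D': "Z u' \<notin> branches_of D" "Z x' \<notin> branches_of (image D)"
    using D root_not_branch_of_image x'y'(2) u'v'(2) by simp_all
  have br: "branch A" "A \<noteq> Z u" "A \<noteq> Z u'" if "A \<in> branches_of D" for A
    using that D(2) u'v'(2) by (auto simp: branches_of_def)
  have im: "image A \<in> branches_of (image D)" if "A \<in> branches_of D" for A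
    using image_in_branches_of that br by blast
  have contacts: "contacts x' y' (image A) (image B) = shift_exps c d (contacts u' v' A B)"
    if A: "A \<in> branches_of D" and B: "B \<in> branches_of D" for A B
  proof -
    have "contacts x' y' (image A) (image B) = contacts x y (image A) (image B)"
      using contacts_coords[OF x'y'(1) xy x'y'(2)] image_branch br A B x'y'(2) by metis
    also have "\<dots> = shift_exps c d (contacts u v A B)"
      unfolding shift_exps_def using image_contacts br A B by blast
    also have "contacts u v A B = contacts u' v' A B"
      using contacts_coords[OF uv u'v'(1) u'v'(2)[symmetric]] br A B by blast
    finally show ?thesis .
  qed
  have fin: "finite (char_exponents u' v' A)" "\<And>k. k \<in> char_exponents u' v' A \<Longrightarrow> k > 0"
    if "A \<in> branches_of D" for A
    unfolding char_exponents_eq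
    using contacts_finite_pos(1,2)[OF u'v'(1) br(1,3)[OF that] br(1,3)[OF that]] by blast+
  have char: "char_exponents x' y' (image A) = shift_exps c d (char_exponents u' v' A)" if "A \<in> branches_of D" for A
    unfolding char_exponents_eq by (rule contacts[OF that that])
  have emb0: "contact_below (shift_exps c d (char_exponents u' v' A)) (shift_exponent c d e)
      = 1 / of_nat c ^ 2 * contact_below (char_exponents u' v' A) e + of_nat d / of_nat c"
    if A: "A \<in> branches_of D" for A e
    using contact_below_shift[OF c cd] fin[OF A] by blast
  \<comment> \<open>The shifted exponent solves the defining equation, and injectivity of contact
    complexity makes it the only solution, so the definite description returns it.\<close>
  have emb: "branch_embedding c d image u' v' x' y' A e = shift_exponent c d e" if A: "A \<in> branches_of D" for A e
    unfolding branch_embedding_def contact_at_eq char[OF A] emb0[OF A, symmetric]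
    using contact_below_inject[OF finite_shift_exps[OF fin(1)[OF A]]] by (intro the_equality) blast+
  obtain A e where A: "A \<in> branches_of D" and Qe: "Q = ew_glue u' v' D `` {(A, e)}"
    using Q unfolding ew_tree_def by (elim quotientE) blast
  define P where "P = ew_glue x' y' (image D) `` {(image A, shift_exponent c d e)}"
  have "ew_glue x' y' (image D) `` {(image B, branch_embedding c d image u' v' x' y' B e')} = P"
    if "(B, e') \<in> Q" for B e'
  proof -
    have B: "B \<in> branches_of D" "e' = e" "A = B \<or> e \<le> ennreal (of_rat (coincidence u' v' A B))"
      using that unfolding Qe ew_glue_def by blast+
    \<comment> \<open>Gluing is preserved: the coincidence \<open>k\<close> of \<open>A\<close> and
      \<open>B\<close> gives a contact (d + k)/c of the images, so their coincidence is at least the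
      shift of \<open>k\<close>.\<close>
    have "image A = image B \<or> shift_exponent c d e \<le> ennreal (of_rat (coincidence x' y' (image A) (image B)))"
    proof (cases "image A = image B")
      case False
      then have "A \<noteq> B" by metis
      define k where "k = coincidence u' v' A B"
      have k: "k \<in> contacts u' v' A B"
        unfolding k_def by (rule coincidence_contact(1)[OF u'v'(1) br(1,3)[OF A] br(1,3)[OF B(1)] \<open>A \<noteq> B\<close>])
      have "k > 0" by (rule contacts_finite_pos(2)[OF u'v'(1) br(1,3)[OF A] br(1,3)[OF B(1)] k])
      have "of_nat d / of_nat c + k / of_nat c \<in> contacts x' y' (image A) (image B)"
        unfolding contacts[OF A B(1)] shift_exps_def using k by blast
      then have "of_nat d / of_nat c + k / of_nat c \<le> coincidence x' y' (image A) (image B)"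
        using coincidence_contact(2)[OF x'y'(1) _ _ _ _ False] image_branch[OF br(1,2)[OF A]]
          image_branch[OF br(1,2)[OF B(1)]] x'y'(2) by metis
      then have "ennreal (of_rat (of_nat d / of_nat c + k / of_nat c)) \<le> ennreal (of_rat (coincidence x' y' (image A) (image B)))"
        by (intro ennreal_leI) (simp only: of_rat_less_eq)
      moreover have "shift_exponent c d e \<le> ennreal (of_rat (of_nat d / of_nat c + k / of_nat c))"
        using shift_less_iff[OF c, of k d e] B(3) \<open>A \<noteq> B\<close> \<open>k > 0\<close> unfolding k_def[symmetric]
        by (metis less_imp_le not_less)
      ultimately show ?thesis by (metis order_trans)
    qed simp
    then have "((image A, shift_exponent c d e), (image B, shift_exponent c d e)) \<in> ew_glue x' y' (image D)"
      using im[OF A] im[OF B(1)] by (simp add: ew_glue_def)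
    then have "ew_glue x' y' (image D) `` {(image A, shift_exponent c d e)} = ew_glue x' y' (image D) `` {(image B, shift_exponent c d e)}"
      by (rule equiv_class_eq[OF equiv_ew_glue[OF x'y'(1) D'(2)]])
    then show ?thesis by (simp add: P_def emb[OF B(1)] B(2))
  qed
  moreover have "(A, e) \<in> Q" unfolding Qe by (rule ew_class_mem[OF u'v'(1) D'(1) A])
  ultimately have "(\<lambda>(B, e'). ew_glue x' y' (image D) `` {(image B, branch_embedding c d image u' v' x' y' B e')}) ` Q = {P}"
    by (intro image_eq_singleton) auto
  then have \<iota>: "\<iota> Q = P" unfolding \<iota>_def natural_embedding_def by simp
  have exps: "ew_exponent Q = e" "ew_exponent P = shift_exponent c d e"
    unfolding Qe P_def by (rule ew_exponent_class[OF u'v'(1) D'(1) A] ew_exponent_class[OF x'y'(1) D'(2) im[OF A]])+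
  show "\<iota> Q \<in> ew_tree x' y' (image D)"
    unfolding \<iota> P_def ew_tree_def by (rule quotientI) (simp add: im[OF A])
  show "ew_exponent (\<iota> Q) = 1 / of_nat c * ew_exponent Q + of_nat d / of_nat c"
    unfolding \<iota> exps by (simp add: shift_exponent_def)
  assume "ew_exponent Q \<noteq> 0 \<or> c = 1"
  then have "e > 0 \<or> c = 1" by (simp add: exps zero_less_iff_neq_zero)
  moreover have "ew_index x' y' P = index_at x' y' (image A) (shift_exponent c d e)"
    unfolding P_def by (rule ew_index_class[OF x'y'(1) D'(2) im[OF A]])
  moreover have "ew_index u' v' Q = index_at u' v' A e"
    unfolding Qe by (rule ew_index_class[OF u'v'(1) D'(1) A])
  ultimately show "ew_index x' y' (\<iota> Q) = c * ew_index u' v' Q"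
    unfolding \<iota> index_at_eq char[OF A] using index_below_shift[OF c cd fin(2)[OF A]] by simp
qed

theorem proposition6p22:
  fixes x y x' y' u v :: ser2
    and L L' E C C\<^sub>w :: curve
    and c d :: nat
    and \<gamma> :: "int \<Rightarrow> int \<Rightarrow> complex"
    and \<phi> :: "int \<Rightarrow> int \<Rightarrow> ser2"
    and \<iota> :: "ew_point \<Rightarrow> ew_point"
  assumes "is_cross L L'"
    and "defines_cross x y L L'"
    and "c > 0" and "d > 0" and "coprime c d"
    and "point_of_exc c d \<gamma>"
    and "completion_at c d \<gamma> \<phi>"
    and "E = exc_divisor c d \<phi>"
    and "reduced_curve C\<^sub>w" and "E \<notin> branches_of C\<^sub>w"
    and "C = image_curve x y \<phi> C\<^sub>w"
    \<comment> \<open>arbitrary coordinates computing the trees relative to \<open>L\<close> and to \<open>E\<^sub>w\<close>\<close>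
    and "local_coords x' y'" and "Z x' = L"
    and "local_coords u v" and "Z u = E"
    and "\<iota> = natural_embedding c d (image_curve x y \<phi>) u v x' y' C\<^sub>w"
  \<comment> \<open>the root \<open>E\<^sub>w\<close> has exponent \<open>0\<close> and its image has index \<open>1\<close>, so the index relation
     holds at the root exactly when \<open>c = 1\<close>\<close>
  shows "\<forall>Q \<in> ew_tree u v C\<^sub>w. \<iota> Q \<in> ew_tree x' y' C \<and>
      (ew_exponent Q \<noteq> 0 \<or> c = 1 \<longrightarrow> ew_index x' y' (\<iota> Q) = c * ew_index u v Q) \<and>
      ew_exponent (\<iota> Q) = 1 / of_nat c * ew_exponent Q + of_nat d / of_nat c"
proof
  fix Q assume Q: "Q \<in> ew_tree u v C\<^sub>w"
  \<comment> \<open>The given \<open>u\<close>, \<open>v\<close> need not be monomial, so the chart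
    uses its own coordinates, which define the same exceptional branch.\<close>
  obtain u\<^sub>1 v\<^sub>1 \<mu> where chart: "local_coords u\<^sub>1 v\<^sub>1" "Z u\<^sub>1 = exc_divisor c d \<phi>" "\<mu> \<noteq> 0"
    "\<phi> 1 0 = u\<^sub>1 ^ c" "\<phi> 0 1 = u\<^sub>1 ^ d * (const2 \<mu> + v\<^sub>1)"
    using toric_normal_form[OF assms(3-7)] .
  have "local_coords x y" "L = Z x" using assms(2) by (auto simp: defines_cross_def)
  then interpret toric_chart x y u\<^sub>1 v\<^sub>1 c d \<phi> \<mu>
    using assms(3-5) chart by unfold_locales
  have "Z x' = Z x" "Z u = Z u\<^sub>1" "Z u\<^sub>1 \<notin> branches_of C\<^sub>w"
    using assms chart(2) \<open>L = Z x\<close> by simp_all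
  then show "\<iota> Q \<in> ew_tree x' y' C \<and>
      (ew_exponent Q \<noteq> 0 \<or> c = 1 \<longrightarrow> ew_index x' y' (\<iota> Q) = c * ew_index u v Q) \<and>
      ew_exponent (\<iota> Q) = 1 / of_nat c * ew_exponent Q + of_nat d / of_nat c"
    using image_trees[OF assms(12) _ assms(14) _ assms(9) _ Q] unfolding assms(11,16) by blast
qed

end
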